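(* Suppose $x\in O_p$ is a nontrivial fixed point of $[X]_q$ for some $q\in B(1,p^{-1/(p-1)})$, i.e. $(x,q)\in M$ for some $q$. Then: (1) $\mathrm{Card}(\phi_1^{-1}(x))=p-2$, and distinct elements $(x,q)\in\phi_1^{-1}(x)$ determine distinct residues $\bar u$, where $u\in O_p^*$ is defined by $q=1+p^{v(q-1)}u$. (2) If $(x,q)\in M$ and $x'\in B(x,|A_{p-2}(x)|)$, then there exists a unique $q'\in B(q,|q-1|)$ such that $(x',q')\in M$, and the resulting map $$Q:B(x,|A_{p-2}(x)|)\to B(q,|q-1|),\qquad Q(x')=q',$$ is an analytic surjection satisfying $$|q'-q|=\left|\frac{[x']_q-x'}{x'(x'-1)}\right|$$ (where for $x'\in\{0,1\}$ the right-hand side is understood as the value $|(q-1)g(x',q)|$). (3) For $(x,q)\in M$, the following are equivalent: (i) the map $Q$ of (2) is a (bijective) contraction by $p^{1-(p-1)v(q-1)}$, i.e. it is bijective and $|Q(x')-Q(x'')|=p^{1-(p-1)v(q-1)}|x'-x''|$ for all $x',x''\in B(x,|A_{p-2}(x)|)$; (ii) $|A_{p-2}^{(1)}(x)|=1$; (iii) the multiplicity of $\bar x$ in $\overline{M}_q$ is one. These conditions hold for all but finitely many residue classes $\bar x$ of $x$.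
   Context: Let $p$ be a prime, $\mathbb{C}_p$ the $p$-adic complex numbers with absolute value $|\cdot|$ and additive valuation $v$, $|x|=p^{-v(x)}$, $v(p)=1$. Let $O_p=\{x\in\mathbb{C}_p:|x|\le 1\}$, $O_p^*$ its unit group, and $B(a,r)=\{b\in\mathbb{C}_p:|b-a|<r\}$. For $x\in O_p$, $\bar x$ denotes its residue in the residue field of $O_p$. For rational $r$, $p^{r}\in\mathbb{C}_p$ denotes a fixed choice of element of valuation $r$ (when not a real number). For $x\in O_p$ and $q\in B(1,p^{-1/(p-1)})$ put $q^x=\exp(x\log q)$ ($p$-adic $\exp$ and $\log$), and define the $q$-bracket by $[x]_q=\frac{q^x-1}{q-1}$ if $q\ne 1$ and $[x]_1=x$. Set $A_0(X)=1$ and $A_n(X)=(X-2)(X-3)\cdots(X-(n+1))$ for $n>0$; $A_n^{(1)}$ is the formal derivative of $A_n$. The equation $[x]_q=x$ has the trivial solutions $q=1$, $x=0$, $x=1$. To remove them, let $g(X,Q)=\frac{[X]_Q-X}{(Q-1)X(X-1)}$, understood as the analytic function on $O_p\times B(1,p^{-1/(p-1)})$ given by the convergent series $g(X,Q)=\sum_{n\ge 0}\frac{A_n(X)}{(n+2)!}(Q-1)^n$. Define $M=\{(x,q)\in O_p\times B(1,p^{-1/(p-1)}): g(x,q)=0\}$; $x$ is called a nontrivial fixed point of $[X]_q$ if $(x,q)\in M$. ($M$ is empty when $p=2$.) Let $\phi_1:M\to O_p$, $(x,q)\mapsto x$, and $\phi_2:M\to B(1,p^{-1/(p-1)})$, $(x,q)\mapsto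 q$, be the projections, and let $M_q=\{x\in O_p:(x,q)\in M\}$ (the fiber $\phi_2^{-1}(q)$ identified with its image under $\phi_1$). $\overline{M}_q$ denotes the set of residues of elements of $M_q$; the multiplicity of $\bar x$ in $\overline{M}_q$ is the number of elements of $M_q$ with residue $\bar x$, each $y\in M_q$ being counted with its order of vanishing as a zero of the analytic function $X\mapsto g(X,q)$. *)

theory Defs
  imports "HOL-Analysis.Analysis" "HOL-Computational_Algebra.Computational_Algebra"
begin

text \<open>
  The absolute value is the distance to zero, so that the library's balls, closures, completeness
  and series (all based on the metric) are the ones belonging to it.
\<close>

definition pabs :: "'a::{metric_space,zero} \<Rightarrow> real" where
  "pabs x = dist x 0"

text \<open>
  The type \<open>'a\<close> is the field of \<open>p\<close>-adic complex numbers, i.e. the completion of an algebraic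
  closure of the field of \<open>p\<close>-adic numbers. The latter is the closure of the rational numbers: the
  axioms on \<open>pabs\<close> force it to restrict to the \<open>p\<close>-adic absolute value there, and \<open>'a\<close> is complete.
  By the axiom \<open>algebraic_dense\<close> the field is determined up to isometric isomorphism.
  Algebraic closedness is part of the sort; the completion is known to have this property.
\<close>

definition padic_numbers :: "'a::{field_char_0,metric_space} set" where
  "padic_numbers = closure (range of_rat)"

definition algebraic_over :: "'a::field set \<Rightarrow> 'a \<Rightarrow> bool" where
  "algebraic_over k x \<longleftrightarrow> (\<exists>f. f \<noteq> 0 \<and> (\<forall>i. coeff f i \<in> k) \<and> poly f x = 0)"

locale padic_complex =
  fixes T :: "'a::{alg_closed_field,field_char_0,complete_space} itself"
    and p :: nat
  assumes prime_p: "prime p"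
    and dist_eq_pabs: "\<And>x y :: 'a. dist x y = pabs (x - y)"
    and pabs_mult: "\<And>x y :: 'a. pabs (x * y) = pabs x * pabs y"
    and pabs_ultrametric: "\<And>x y :: 'a. pabs (x + y) \<le> max (pabs x) (pabs y)"
    and pabs_p: "pabs (of_nat p :: 'a) = 1 / real p"
    and algebraic_dense: "closure {x :: 'a. algebraic_over padic_numbers x} = UNIV"

definition pval :: "nat \<Rightarrow> 'a::{metric_space,zero} \<Rightarrow> real" where
  "pval p x = - log (real p) (pabs x)"

abbreviation O_p :: "'a::{metric_space,zero} set" where
  "O_p \<equiv> cball 0 1"

definition O_units :: "'a::{metric_space,zero} set" where
  "O_units = {x. pabs x = 1}"

text \<open>
  An element of the residue field, as a coset of the maximal ideal of \<open>O_p\<close>. It is only used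
  for \<open>x \<in> O_p\<close>.
\<close>

definition residue :: "'a::{metric_space,group_add} \<Rightarrow> 'a set" where
  "residue x = {y. pabs (y - x) < 1}"

definition q_domain :: "nat \<Rightarrow> 'a::{metric_space,one} set" where
  "q_domain p = ball 1 (real p powr (- 1 / (real p - 1)))"

definition pexp :: "'a::{field_char_0,metric_space} \<Rightarrow> 'a" where
  "pexp y = (\<Sum>n. y ^ n / fact n)"

definition plog :: "'a::{field_char_0,metric_space} \<Rightarrow> 'a" where
  "plog q = (\<Sum>n. (- 1) ^ n * (q - 1) ^ Suc n / of_nat (Suc n))"

definition q_power :: "'a::{field_char_0,metric_space} \<Rightarrow> 'a \<Rightarrow> 'a" where
  "q_power q x = pexp (x * plog q)"

definition q_bracket :: "'a::{field_char_0,metric_space} \<Rightarrow> 'a \<Rightarrow> 'a" where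
  "q_bracket q x = (if q = 1 then x else (q_power q x - 1) / (q - 1))"

definition A :: "nat \<Rightarrow> 'a::field_char_0 poly" where
  "A n = (\<Prod>k\<in>{2..n+1}. [:- of_nat k, 1:])"

definition g :: "'a::{field_char_0,metric_space} \<Rightarrow> 'a \<Rightarrow> 'a" where
  "g x q = (\<Sum>n. poly (A n) x / fact (n + 2) * (q - 1) ^ n)"

definition M :: "nat \<Rightarrow> ('a::{field_char_0,metric_space} \<times> 'a) set" where
  "M p = {(x, q). x \<in> O_p \<and> q \<in> q_domain p \<and> g x q = 0}"

definition phi1_fiber :: "nat \<Rightarrow> 'a::{field_char_0,metric_space} \<Rightarrow> ('a \<times> 'a) set" where
  "phi1_fiber p x = {y \<in> M p. fst y = x}"

definition M_fiber :: "nat \<Rightarrow> 'a::{field_char_0,metric_space} \<Rightarrow> 'a set" where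
  "M_fiber p q = {x. (x, q) \<in> M p}"

definition has_power_series_on ::
    "('a::{field,metric_space} \<Rightarrow> 'a) \<Rightarrow> 'a \<Rightarrow> real \<Rightarrow> (nat \<Rightarrow> 'a) \<Rightarrow> bool" where
  "has_power_series_on f a r c \<longleftrightarrow> (\<forall>z\<in>ball a r. (\<lambda>n. c n * (z - a) ^ n) sums f z)"

definition analytic_on_ball ::
    "('a::{field,metric_space} \<Rightarrow> 'a) \<Rightarrow> 'a \<Rightarrow> real \<Rightarrow> bool" where
  "analytic_on_ball f a r \<longleftrightarrow> (\<exists>c. has_power_series_on f a r c)"

text \<open>
  The order of vanishing at \<open>y\<close>: the index of the first nonzero coefficient of the power
  series of \<open>f\<close> at \<open>y\<close> (unspecified if \<open>f\<close> has no such series or vanishes near \<open>y\<close>).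
\<close>

definition vanishing_order :: "('a::{field,metric_space} \<Rightarrow> 'a) \<Rightarrow> 'a \<Rightarrow> nat" where
  "vanishing_order f y =
     (LEAST m. \<exists>c. (\<exists>r>0. has_power_series_on f y r c) \<and> c m \<noteq> 0)"

definition residue_multiplicity :: "nat \<Rightarrow> 'a::{field_char_0,metric_space} \<Rightarrow> 'a \<Rightarrow> nat" where
  "residue_multiplicity p q x =
     (\<Sum>y \<in> {y \<in> M_fiber p q. residue y = residue x}. vanishing_order (\<lambda>X. g X q) y)"

definition Q_radius :: "nat \<Rightarrow> 'a::{field_char_0,metric_space} \<Rightarrow> real" where
  "Q_radius p x = pabs (poly (A (p - 2)) x)"

definition Q_map :: "nat \<Rightarrow> 'a::{field_char_0,metric_space} \<Rightarrow> 'a \<Rightarrow> 'a" where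
  "Q_map p q x' = (THE q'. q' \<in> ball q (pabs (q - 1)) \<and> (x', q') \<in> M p)"

definition Q_bijective_contraction :: "nat \<Rightarrow> 'a::{field_char_0,metric_space} \<Rightarrow> 'a \<Rightarrow> bool" where
  "Q_bijective_contraction p x q \<longleftrightarrow>
     bij_betw (Q_map p q) (ball x (Q_radius p x)) (ball q (pabs (q - 1))) \<and>
     (\<forall>x'\<in>ball x (Q_radius p x). \<forall>x''\<in>ball x (Q_radius p x).
        pabs (Q_map p q x' - Q_map p q x'') =
          real p powr (1 - (real p - 1) * pval p (q - 1)) * pabs (x' - x''))"

definition A_deriv_unit :: "nat \<Rightarrow> 'a::{field_char_0,metric_space} \<Rightarrow> bool" where
  "A_deriv_unit p x \<longleftrightarrow> pabs (poly (pderiv (A (p - 2))) x) = 1"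

end

theory Submission
  imports Defs
begin

text \<open>
  Write \<open>t = q - 1\<close> and let \<open>\<rho>\<close> be the radius of convergence of the exponential series. The denominators
  of \<open>g\<close> are controlled by Legendre's bound on the valuation of \<open>n!\<close>: for \<open>pabs t < \<rho>\<close>, the term of index
  \<open>p - 2\<close>, which is \<open>A_{p-2}(x) t^{p-2} / p!\<close>, strictly dominates all later terms, and the initial term
  \<open>1/2\<close> strictly dominates those of index between \<open>0\<close> and \<open>p - 2\<close>. For \<open>p = 2\<close> the two distinguished
  terms coincide and there is no zero. For odd \<open>p\<close>, \<open>g\<close> can vanish only where both have
  absolute value \<open>1\<close>; this fixes \<open>pabs t\<close> in terms of \<open>pabs (A_{p-2}(x))\<close>
  (\<open>M_imp_critical\<close>). On that circle, \<open>g\<close> reduces to a binomial \<open>1/2 + c t^{p-2}\<close> modulo the maximal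
  ideal (\<open>g_reduction\<close>).

  The exponent \<open>p - 2\<close> is prime to \<open>p\<close>, so the binomial is separable: its \<open>p - 2\<close> roots differ by roots
  of unity with distinct residues, and Newton's iteration lifts each of them to exactly one zero
  (\<open>card_zeros_above\<close>). This is part (1); that \<open>t\<close> is a power \<open>p^r\<close> times a unit holds because
  valuations are rational, by the density of the algebraic elements (\<open>pval_rational\<close>). The same iteration,
  carried out over power series in \<open>x' - x\<close>, continues a zero analytically (\<open>implicit_function\<close>,
  \<open>Q_map_analytic\<close>). It converges for \<open>pabs (x' - x) < pabs (A_{p-2}(x))\<close> because the reduction of \<open>g\<close> does
  not change there. As the zeros are simple, \<open>pabs (g(x', q))\<close> is the distance to the nearest zero divided
  by \<open>pabs t\<close> (\<open>pabs_g_diff\<close>); this is the formula for \<open>pabs (Q(x') - q)\<close>, once the binomial series has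
  identified \<open>[x']_q - x'\<close> with \<open>(q - 1) x' (x' - 1) g(x', q)\<close> (\<open>q_bracket_minus_self\<close>).

  For fixed \<open>t\<close> on the critical circle, \<open>p! / t^{p-2}\<close> times \<open>g\<close> is a limit of polynomials in \<open>X\<close> with
  integral coefficients that are congruent to \<open>A_{p-2}(X)\<close> plus a constant (\<open>x_poly_reduction\<close>). Since
  the field is algebraically closed, zeros of the reduction lift to zeros of \<open>g\<close>
  (\<open>zero_of_polynomial_limit\<close>), which makes \<open>Q\<close> surjective. The number of zeros in a residue class is the
  multiplicity of the reduced root, so it is one if and only if \<open>A_{p-2}'(x)\<close> is a unit
  (\<open>multiplicity_one_iff\<close>). In that case \<open>g\<close> is, up to scaling, isometric on the residue class, which
  turns the previous distance formula into the contraction property of \<open>Q\<close>; otherwise its increments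
  are strictly smaller (\<open>bijective_contraction_iff\<close>). Finally \<open>A_{p-2}'\<close> has unit leading coefficient \<open>p - 2\<close>, so
  it is small only in the residue classes of its roots (\<open>deriv_A_nonunit_residue\<close>).
\<close>

(* The dollar sign denotes the coefficients of a power series throughout. *)
unbundle no vec_syntax

context padic_complex
begin

section \<open>The absolute value\<close>

lemma pabs_0 [simp]: "pabs (0::'a) = 0"
  by (simp add: pabs_def)

lemma pabs_nonneg [simp]: "0 \<le> pabs (x::'a)"
  by (simp add: pabs_def)

lemma pabs_eq_0 [simp]: "pabs (x::'a) = 0 \<longleftrightarrow> x = 0"
  by (simp add: pabs_def)

lemma pabs_pos [simp]: "0 < pabs (x::'a) \<longleftrightarrow> x \<noteq> 0"
  using pabs_nonneg[of x] pabs_eq_0[of x] by linarith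

lemma pabs_1 [simp]: "pabs (1::'a) = 1"
  using pabs_mult[of 1 1] pabs_pos[of 1] by simp

lemma pabs_minus [simp]: "pabs (- x) = pabs (x::'a)"
proof -
  have "pabs (-1::'a) * pabs (-1::'a) = 1"
    using pabs_mult[of "-1" "-1"] by simp
  then have "pabs (-1::'a) = 1"
    using power2_eq_1_iff[of "pabs (-1::'a)"] pabs_nonneg[of "-1"] by (simp add: power2_eq_square)
  then show ?thesis
    using pabs_mult[of "-1" x] by simp
qed

lemma pabs_minus_commute: "pabs (x - y) = pabs (y - x)" for x y :: 'a
  using pabs_minus[of "x - y"] by simp

lemma pabs_power [simp]: "pabs (x ^ n) = pabs (x::'a) ^ n"
  by (induction n) (simp_all add: pabs_mult)

lemma pabs_inverse [simp]: "pabs (inverse x) = inverse (pabs (x::'a))"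
proof (cases "x = 0")
  case False
  then have "pabs x * pabs (inverse x) = 1"
    by (simp flip: pabs_mult)
  then show ?thesis
    by (simp add: inverse_unique)
qed simp

lemma pabs_divide [simp]: "pabs (x / y) = pabs x / pabs (y::'a)"
  by (simp add: divide_inverse pabs_mult)

lemma pabs_prod: "pabs (prod f S) = (\<Prod>i\<in>S. pabs (f i :: 'a))"
  by (induction S rule: infinite_finite_induct) (simp_all add: pabs_mult)

lemma pabs_add_le: "pabs x \<le> B \<Longrightarrow> pabs y \<le> B \<Longrightarrow> pabs (x + y :: 'a) \<le> B"
  using pabs_ultrametric[of x y] by linarith

lemma pabs_triangle: "pabs (x + y) \<le> pabs x + pabs y" for x y :: 'a
  by (rule pabs_add_le) simp_all

lemma pabs_diff_le: "pabs x \<le> B \<Longrightarrow> pabs y \<le> B \<Longrightarrow> pabs (x - y :: 'a) \<le> B"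
  using pabs_add_le[of x B "- y"] by simp

lemma pabs_add_less: "pabs x < B \<Longrightarrow> pabs y < B \<Longrightarrow> pabs (x + y :: 'a) < B"
  using pabs_ultrametric[of x y] by linarith

lemma pabs_diff_less: "pabs x < B \<Longrightarrow> pabs y < B \<Longrightarrow> pabs (x - y :: 'a) < B"
  using pabs_add_less[of x B "- y"] by simp

lemma pabs_sum_le: "0 \<le> B \<Longrightarrow> (\<And>i. i \<in> S \<Longrightarrow> pabs (f i) \<le> B) \<Longrightarrow> pabs (sum f S :: 'a) \<le> B"
  by (induction S rule: infinite_finite_induct) (simp_all add: pabs_add_le)

text \<open>
  All triangles are isosceles: a perturbation smaller than the element itself does not change the
  absolute value.
\<close>

lemma pabs_eq_if_close:
  fixes x y :: 'a
  assumes "pabs (x - y) < pabs y"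
  shows "pabs x = pabs y"
  using pabs_ultrametric[of "x - y" y] pabs_ultrametric[of "y - x" x] assms
    pabs_minus_commute[of x y] by auto

lemma pabs_of_nat_le_1: "pabs (of_nat n :: 'a) \<le> 1"
  by (induction n) (auto intro: pabs_add_le)

lemma pabs_of_int_le_1: "pabs (of_int k :: 'a) \<le> 1"
  using pabs_of_nat_le_1 by (cases k rule: int_cases2) auto

lemma p_gt_1: "1 < p"
  using prime_p prime_gt_1_nat by blast

lemma pabs_of_nat_coprime:
  assumes "coprime n p"
  shows "pabs (of_nat n :: 'a) = 1"
proof -
  obtain a b where "a * int n + b * int p = 1"
    using assms bezout_int[of "int n" "int p"] by (metis coprime_int_iff coprime_imp_gcd_eq_1)
  then have "(1::'a) = of_int a * of_nat n + of_int b * of_nat p"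
    by (metis of_int_1 of_int_add of_int_mult of_int_of_nat_eq)
  then have *: "1 - of_int a * of_nat n = (of_int b * of_nat p :: 'a)"
    by (metis add_diff_cancel_left')
  have "pabs (of_int b * of_nat p :: 'a) < 1"
    using le_less_trans[OF pabs_of_int_le_1[of b], of "real p"] p_gt_1
    by (simp add: pabs_mult pabs_p)
  then have "pabs (of_int a * of_nat n :: 'a) = 1"
    using pabs_eq_if_close[of "of_int a * of_nat n" 1] * pabs_minus_commute by (metis pabs_1)
  then have "1 \<le> pabs (of_nat n :: 'a)"
    using pabs_of_int_le_1[of a] mult_right_mono[of "pabs (of_int a :: 'a)" 1 "pabs (of_nat n :: 'a)"]
    by (simp add: pabs_mult)
  then show ?thesis
    using pabs_of_nat_le_1[of n] by linarith
qed

lemma pabs_of_nat_less_p: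
  assumes "0 < n" "n < p"
  shows "pabs (of_nat n :: 'a) = 1"
  using assms prime_p by (intro pabs_of_nat_coprime) (metis coprime_commute nat_dvd_not_less prime_imp_coprime)

lemma small_nonzero_element:
  assumes "0 < e"
  obtains y :: 'a where "y \<noteq> 0" "pabs y < e"
proof -
  obtain k where "(1 / real p) ^ k < e"
    using assms p_gt_1 real_arch_pow_inv[of e "1 / real p"] by auto
  then have "pabs (of_nat p ^ k :: 'a) < e"
    by (simp add: pabs_p)
  moreover have "(of_nat p ^ k :: 'a) \<noteq> 0"
    using p_gt_1 by simp
  ultimately show ?thesis
    using that by blast
qed

subsection \<open>The value group\<close>

definition p_power_valued :: "'a \<Rightarrow> bool" where
  "p_power_valued x \<longleftrightarrow> (\<exists>k::int. pabs x = real p powi k)"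

lemma p_power_valued_of_nat:
  assumes "0 < n"
  shows "p_power_valued (of_nat n)"
proof -
  obtain m where m: "n = p ^ multiplicity p n * m" "\<not> p dvd m"
    using assms prime_p multiplicity_decompose'[of n p] by (metis not_prime_unit not_gr_zero)
  then have "pabs (of_nat m :: 'a) = 1"
    using prime_p by (intro pabs_of_nat_coprime) (metis coprime_commute prime_imp_coprime)
  then have "pabs (of_nat n :: 'a) = (1 / real p) ^ multiplicity p n"
    by (subst m(1)) (simp add: pabs_mult pabs_p)
  then have "pabs (of_nat n :: 'a) = real p powi (- int (multiplicity p n))"
    by (simp add: power_int_minus field_simps)
  then show ?thesis
    unfolding p_power_valued_def by blast
qed

lemma p_power_valued_divide:
  assumes "p_power_valued x" "p_power_valued y"
  shows "p_power_valued (x / y)"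
proof -
  obtain k l where "pabs x = real p powi k" "pabs y = real p powi l"
    using assms unfolding p_power_valued_def by blast
  then have "pabs (x / y) = real p powi (k - l)"
    using p_gt_1 by (simp add: power_int_diff)
  then show ?thesis
    unfolding p_power_valued_def by blast
qed

lemma p_power_valued_of_rat:
  assumes "q \<noteq> 0"
  shows "p_power_valued (of_rat q)"
proof -
  obtain a b :: int where q: "q = Rat.Fract a b" "0 < b"
    by (cases q) auto
  have "a \<noteq> 0"
    using assms q by (auto simp: rat_number_collapse)
  have int: "p_power_valued (of_int c)" if "c \<noteq> 0" for c
    using that p_power_valued_of_nat[of "nat \<bar>c\<bar>"]
    by (cases c rule: int_cases2) (auto simp: p_power_valued_def)
  show ?thesis
    using p_power_valued_divide[OF int int, of a b] \<open>a \<noteq> 0\<close> q by (simp add: of_rat_rat)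
qed

lemma p_power_valued_padic:
  assumes "x \<in> padic_numbers" "x \<noteq> 0"
  shows "p_power_valued x"
proof -
  obtain q where "dist (of_rat q) x < pabs x"
    using assms unfolding padic_numbers_def closure_approachable by (metis pabs_pos rangeE)
  then have "pabs (of_rat q :: 'a) = pabs x"
    using pabs_eq_if_close[of "of_rat q" x] by (simp add: dist_eq_pabs)
  then show ?thesis
    using p_power_valued_of_rat[of q] assms(2) by (cases "q = 0") (auto simp: p_power_valued_def)
qed

text \<open>
  A vanishing sum has two nonzero summands of the same absolute value, since a single summand of
  maximal absolute value would determine that of the sum.
\<close>

lemma sum_eq_0_imp_two_pabs_eq:
  fixes f :: "'b \<Rightarrow> 'a"
  assumes "finite S" "sum f S = 0" "i \<in> S" "f i \<noteq> 0"
  obtains j k where "j \<in> S" "k \<in> S" "j \<noteq> k" "f j \<noteq> 0" "pabs (f j) = pabs (f k)"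
proof -
  define m where "m = Max ((pabs \<circ> f) ` S)"
  have "m \<in> (pabs \<circ> f) ` S"
    unfolding m_def using assms by (intro Max_in) auto
  then obtain j where j: "j \<in> S" "pabs (f j) = m"
    by auto
  have le: "pabs (f k) \<le> m" if "k \<in> S" for k
    unfolding m_def using assms that by (intro Max_ge) auto
  have "0 < m"
    using le[OF assms(3)] assms(4) pabs_pos by (meson less_le_trans)
  have "\<exists>k\<in>S - {j}. m \<le> pabs (f k)"
  proof (rule ccontr)
    assume "\<not> ?thesis"
    then have small: "\<And>k. k \<in> S - {j} \<Longrightarrow> pabs (f k) < m"
      by (auto simp: not_le)
    have "pabs (sum f (S - {j})) < m"
    proof (cases "S - {j} = {}")
      case False
      define m' where "m' = Max ((pabs \<circ> f) ` (S - {j}))"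
      have "m' \<in> (pabs \<circ> f) ` (S - {j})"
        unfolding m'_def using assms False by (intro Max_in) auto
      then obtain l where "l \<in> S - {j}" "m' = pabs (f l)"
        by auto
      then have "m' < m" "0 \<le> m'"
        using small by auto
      moreover have "pabs (f k) \<le> m'" if "k \<in> S - {j}" for k
        unfolding m'_def using assms that by (intro Max_ge) auto
      then have "pabs (sum f (S - {j})) \<le> m'"
        using \<open>0 \<le> m'\<close> by (intro pabs_sum_le)
      ultimately show ?thesis by linarith
    qed (use \<open>0 < m\<close> in \<open>simp only: sum.empty pabs_0\<close>)
    moreover have "sum f (S - {j}) = - f j"
      using assms j by (simp add: sum_diff1)
    ultimately show False
      using j by simp
  qed
  then obtain k where "k \<in> S" "k \<noteq> j" "pabs (f k) = m"
    using le by force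
  then show ?thesis
    using that[of j k] j \<open>0 < m\<close> pabs_pos[of "f j"] by metis
qed

text \<open>
  If \<open>y\<close> is a root of a polynomial over the \<open>p\<close>-adic numbers, two of its terms have the same
  absolute value, so a power of \<open>pabs y\<close> is an integral power of \<open>p\<close>. Algebraic numbers are dense
  and close elements have equal absolute values.
\<close>

lemma pval_rational:
  fixes x :: 'a
  assumes "x \<noteq> 0"
  shows "pval p x \<in> \<rat>"
proof -
  have "x \<in> closure {x :: 'a. algebraic_over padic_numbers x}"
    using algebraic_dense by simp
  then obtain y where y: "algebraic_over padic_numbers y" "dist y x < pabs x"
    unfolding closure_approachable using assms by (metis mem_Collect_eq pabs_pos)
  then have yx: "pabs y = pabs x"
    using pabs_eq_if_close[of y x] by (simp add: dist_eq_pabs)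
  obtain f where f: "f \<noteq> 0" "\<And>i. coeff f i \<in> padic_numbers" "poly f y = 0"
    using y(1) unfolding algebraic_over_def by blast
  have "y \<noteq> 0"
    using yx assms by auto
  have "(\<Sum>i\<le>degree f. coeff f i * y ^ i) = 0"
    using f(3) by (simp add: poly_altdef)
  then obtain j k where jk: "j \<noteq> k" "coeff f j * y ^ j \<noteq> 0"
    "pabs (coeff f j * y ^ j) = pabs (coeff f k * y ^ k)"
    using f(1) \<open>y \<noteq> 0\<close>
    by (elim sum_eq_0_imp_two_pabs_eq[rotated, where i = "degree f"]) auto
  then have "coeff f k * y ^ k \<noteq> 0"
    by (metis pabs_eq_0)
  then have nz: "coeff f j \<noteq> 0" "coeff f k \<noteq> 0"
    using jk by auto
  obtain a b :: int where ab: "pabs (coeff f j) = real p powi a" "pabs (coeff f k) = real p powi b"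
    using p_power_valued_padic f(2) nz unfolding p_power_valued_def by meson
  have logy: "log p (pabs (coeff f i * y ^ i)) = c + real i * log p (pabs y)"
    if "pabs (coeff f i) = real p powi c" for i c
    using that \<open>y \<noteq> 0\<close> p_gt_1
    by (simp add: pabs_mult log_mult log_nat_power flip: powr_real_of_int')
  have "real_of_int a + real j * log p (pabs y) = b + real k * log p (pabs y)"
    using jk(3) logy[OF ab(1)] logy[OF ab(2)] by simp
  then have "(real j - real k) * log p (pabs y) = real_of_int b - real_of_int a"
    by (simp add: algebra_simps)
  then have "log p (pabs y) = (real_of_int b - real_of_int a) / (real j - real k)"
    using jk(1) by (simp add: field_simps)
  also have "\<dots> \<in> \<rat>"
    by simp
  finally show ?thesis
    unfolding pval_def yx by simp
qed

lemma powr_minus_pval: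
  fixes x :: 'a
  assumes "x \<noteq> 0"
  shows "real p powr (- pval p x) = pabs x"
  using assms p_gt_1 by (simp add: pval_def)

section \<open>Convergence\<close>

lemma tendsto_iff_pabs: "X \<longlonglongrightarrow> (L::'a) \<longleftrightarrow> (\<lambda>n. pabs (X n - L)) \<longlonglongrightarrow> 0"
  using tendsto_dist_iff[of X L sequentially] by (simp add: dist_eq_pabs)

lemma tendsto_pabs_le:
  fixes X :: "nat \<Rightarrow> 'a"
  assumes "\<And>n. pabs (X n - L) \<le> e n" "e \<longlonglongrightarrow> 0"
  shows "X \<longlonglongrightarrow> L"
  unfolding tendsto_iff_pabs using assms
  by (intro tendsto_sandwich[of "\<lambda>_. 0" "\<lambda>n. pabs (X n - L)" sequentially e 0]) auto

lemma padic_tendsto_add: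
  fixes X Y :: "nat \<Rightarrow> 'a"
  assumes "X \<longlonglongrightarrow> a" "Y \<longlonglongrightarrow> b"
  shows "(\<lambda>n. X n + Y n) \<longlonglongrightarrow> a + b"
proof (rule tendsto_pabs_le)
  show "pabs (X n + Y n - (a + b)) \<le> pabs (X n - a) + pabs (Y n - b)" for n
    using pabs_triangle[of "X n - a" "Y n - b"] by (simp add: add_diff_add)
  show "(\<lambda>n. pabs (X n - a) + pabs (Y n - b)) \<longlonglongrightarrow> 0"
    using tendsto_add[OF assms[unfolded tendsto_iff_pabs]] by simp
qed

lemma padic_tendsto_cmult:
  fixes X :: "nat \<Rightarrow> 'a"
  assumes "X \<longlonglongrightarrow> a"
  shows "(\<lambda>n. c * X n) \<longlonglongrightarrow> c * a"
proof (rule tendsto_pabs_le)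
  show "pabs (c * X n - c * a) \<le> pabs c * pabs (X n - a)" for n
    by (simp flip: pabs_mult right_diff_distrib)
  show "(\<lambda>n. pabs c * pabs (X n - a)) \<longlonglongrightarrow> 0"
    using tendsto_mult_left[OF assms[unfolded tendsto_iff_pabs], of "pabs c"] by simp
qed

lemma padic_tendsto_diff:
  fixes X Y :: "nat \<Rightarrow> 'a"
  assumes "X \<longlonglongrightarrow> a" "Y \<longlonglongrightarrow> b"
  shows "(\<lambda>n. X n - Y n) \<longlonglongrightarrow> a - b"
  using padic_tendsto_add[OF assms(1) padic_tendsto_cmult[OF assms(2), of "-1"]] by simp

lemma padic_tendsto_mult:
  fixes X Y :: "nat \<Rightarrow> 'a"
  assumes "X \<longlonglongrightarrow> a" "Y \<longlonglongrightarrow> b"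
  shows "(\<lambda>n. X n * Y n) \<longlonglongrightarrow> a * b"
proof -
  have "(\<lambda>n. X n * (Y n - b)) \<longlonglongrightarrow> 0"
  proof -
    have "(\<lambda>n. pabs (X n - a) * pabs (Y n - b) + pabs a * pabs (Y n - b)) \<longlonglongrightarrow> 0 * 0 + pabs a * 0"
      using assms[unfolded tendsto_iff_pabs] by (intro tendsto_intros)
    moreover have "pabs (X n * (Y n - b) - 0) \<le> pabs (X n - a) * pabs (Y n - b) + pabs a * pabs (Y n - b)" for n
      using pabs_triangle[of "(X n - a) * (Y n - b)" "a * (Y n - b)"]
      by (simp only: pabs_mult diff_zero flip: distrib_right) simp
    ultimately show ?thesis
      by (intro tendsto_pabs_le) auto
  qed
  from padic_tendsto_add[OF this padic_tendsto_cmult[OF assms(1), of b]] show ?thesis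
    by (simp add: algebra_simps)
qed

lemma tendsto_pabs: "X \<longlonglongrightarrow> (L::'a) \<Longrightarrow> (\<lambda>n. pabs (X n)) \<longlonglongrightarrow> pabs L"
  unfolding pabs_def by (intro tendsto_dist tendsto_const)

lemma pabs_limit_le:
  fixes X :: "nat \<Rightarrow> 'a"
  assumes "X \<longlonglongrightarrow> L" "\<And>n. N \<le> n \<Longrightarrow> pabs (X n) \<le> B"
  shows "pabs L \<le> B"
  using LIMSEQ_le_const2[OF tendsto_pabs[OF assms(1)]] assms(2) by blast

text \<open>Ultrametric convergence: a series converges as soon as its terms tend to zero.\<close>

lemma padic_summable:
  fixes f :: "nat \<Rightarrow> 'a"
  assumes "f \<longlonglongrightarrow> 0"
  shows "summable f"
proof -
  have "Cauchy (\<lambda>n. sum f {..<n})"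
  proof (rule metric_CauchyI)
    fix e :: real assume "0 < e"
    then obtain N where N: "\<And>n. N \<le> n \<Longrightarrow> pabs (f n) < e / 2"
      using assms unfolding lim_sequentially by (metis dist_eq_pabs diff_zero half_gt_zero)
    have *: "pabs (sum f {..<m} - sum f {..<n}) < e" if "N \<le> n" "n \<le> m" for m n
    proof -
      have "sum f {..<m} - sum f {..<n} = sum f {n..<m}"
        using that by (metis diff_add_cancel sum_diff_nat_ivl le0 lessThan_atLeast0)
      moreover have "pabs (sum f {n..<m}) \<le> e / 2"
        using N that \<open>0 < e\<close> by (intro pabs_sum_le) (auto intro!: less_imp_le)
      ultimately show ?thesis
        using \<open>0 < e\<close> by simp
    qed
    have "dist (sum f {..<m}) (sum f {..<n}) < e" if "N \<le> m" "N \<le> n" for m n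
      using *[of n m] *[of m n] that by (cases "n \<le> m") (auto simp: dist_eq_pabs pabs_minus_commute)
    then show "\<exists>N. \<forall>m\<ge>N. \<forall>n\<ge>N. dist (sum f {..<m}) (sum f {..<n}) < e"
      by blast
  qed
  then show ?thesis
    by (auto simp: summable_iff_convergent Cauchy_convergent_iff)
qed

lemma padic_sums_add: "f sums a \<Longrightarrow> h sums b \<Longrightarrow> (\<lambda>n. f n + h n) sums (a + b)" for a b :: 'a
  unfolding sums_def by (simp add: sum.distrib padic_tendsto_add)

lemma padic_sums_cmult: "f sums a \<Longrightarrow> (\<lambda>n. c * f n) sums (c * a)" for a c :: 'a
  unfolding sums_def by (simp add: padic_tendsto_cmult flip: sum_distrib_left)

lemma padic_sums_diff: "f sums a \<Longrightarrow> h sums b \<Longrightarrow> (\<lambda>n. f n - h n) sums (a - b)" for a b :: 'a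
  unfolding sums_def by (simp add: sum_subtractf padic_tendsto_diff)

lemma padic_sums_shift:
  fixes f :: "nat \<Rightarrow> 'a"
  assumes "f sums a"
  shows "(\<lambda>n. f (n + k)) sums (a - sum f {..<k})"
proof -
  have "(\<lambda>n. sum f {..<n + k}) \<longlonglongrightarrow> a"
    using assms unfolding sums_def by (rule LIMSEQ_ignore_initial_segment)
  moreover have "sum f {..<n + k} - sum f {..<k} = (\<Sum>i<n. f (i + k))" for n
    using sum.atLeastLessThan_concat[of 0 k "n + k" f] sum.shift_bounds_nat_ivl[of f 0 k n]
    by (simp add: lessThan_atLeast0 algebra_simps)
  ultimately show ?thesis
    using padic_tendsto_diff[OF _ tendsto_const, of "\<lambda>n. sum f {..<n + k}" a "sum f {..<k}"]
    by (simp add: sums_def)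
qed

lemma padic_sums_le:
  fixes f :: "nat \<Rightarrow> 'a"
  assumes "f sums a" "\<And>n. pabs (f n) \<le> B"
  shows "pabs a \<le> B"
proof (rule pabs_limit_le)
  show "(\<lambda>n. sum f {..<n}) \<longlonglongrightarrow> a"
    using assms by (simp add: sums_def)
  have "0 \<le> B"
    using assms(2)[of 0] pabs_nonneg by (meson order_trans)
  then show "pabs (sum f {..<n}) \<le> B" for n
    by (intro pabs_sum_le assms)
qed

lemma tendsto_0_geometric:
  fixes f :: "nat \<Rightarrow> 'a"
  assumes "\<And>n. pabs (f n) \<le> C * \<theta> ^ n" "0 \<le> \<theta>" "\<theta> < 1"
  shows "f \<longlonglongrightarrow> 0"
proof (rule tendsto_pabs_le)
  show "pabs (f n - 0) \<le> C * \<theta> ^ n" for n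
    using assms(1) by simp
  show "(\<lambda>n. C * \<theta> ^ n) \<longlonglongrightarrow> 0"
    using tendsto_mult_left[OF LIMSEQ_realpow_zero[OF assms(2,3)], of C] by simp
qed

section \<open>Factorials\<close>

text \<open>The radius of convergence of the exponential series.\<close>

definition \<rho> :: real where "\<rho> = real p powr (- 1 / (real p - 1))"

lemma rho_pos: "0 < \<rho>"
  using p_gt_1 by (simp add: \<rho>_def)

lemma rho_less_1: "\<rho> < 1"
  using p_gt_1 by (simp add: \<rho>_def powr_less_one)

lemma rho_power: "\<rho> ^ (p - 1) = 1 / real p"
proof -
  have "\<rho> ^ (p - 1) = real p powr (- 1 / (real p - 1) * real (p - 1))"
    using p_gt_1 unfolding \<rho>_def by (subst powr_power) auto
  also have "- 1 / (real p - 1) * real (p - 1) = - 1"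
    using p_gt_1 by (simp add: field_simps of_nat_diff)
  finally show ?thesis
    using p_gt_1 by (simp add: powr_minus_divide)
qed

lemma pabs_fact_div: "pabs (fact m :: 'a) = (1 / real p) ^ (m div p) * pabs (fact (m div p) :: 'a)"
proof (induction m)
  case (Suc m)
  show ?case
  proof (cases "p dvd Suc m")
    case True
    then have "Suc m = p * (Suc m div p)"
      by simp
    moreover have "Suc m div p = Suc (m div p)"
      using True p_gt_1 by (simp add: div_Suc mod_eq_0_iff_dvd)
    ultimately have "pabs (of_nat (Suc m) :: 'a) = (1 / real p) * pabs (of_nat (Suc (m div p)) :: 'a)"
      by (metis of_nat_mult pabs_mult pabs_p)
    then show ?thesis
      using Suc.IH \<open>Suc m div p = Suc (m div p)\<close> by (simp only: fact_Suc pabs_mult) simp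
  next
    case False
    then have "pabs (of_nat (Suc m) :: 'a) = 1"
      using prime_p by (intro pabs_of_nat_coprime) (metis coprime_commute prime_imp_coprime)
    moreover have "Suc m div p = m div p"
      using False by (simp add: div_Suc dvd_eq_mod_eq_0)
    ultimately show ?thesis
      using Suc.IH by (simp only: fact_Suc pabs_mult)
  qed
qed simp

text \<open>
  Legendre's bound \<open>v(m!) \<le> (m - 1) / (p - 1)\<close>, by descent from \<open>m\<close> to \<open>m div p\<close>.
\<close>

lemma pabs_fact_ge: "0 < m \<Longrightarrow> \<rho> ^ (m - 1) \<le> pabs (fact m :: 'a)"
proof (induction m rule: less_induct)
  case (less m)
  show ?case
  proof (cases "m < p")
    case True
    then have "pabs (fact m :: 'a) = 1"
      using pabs_fact_div[of m] by simp
    then show ?thesis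
      using rho_pos rho_less_1 by (simp add: power_le_one)
  next
    case False
    define k where "k = m div p"
    have k: "0 < k" "k < m" "p * k \<le> m"
      using False p_gt_1 less.prems by (auto simp: k_def div_greater_zero_iff)
    have "\<rho> ^ (m - 1) \<le> \<rho> ^ ((p - 1) * k + (k - 1))"
    proof (rule power_decreasing)
      have "(p - 1) * k + k = p * k"
        using p_gt_1 by (simp add: algebra_simps)
      then show "(p - 1) * k + (k - 1) \<le> m - 1"
        using k by linarith
    qed (use rho_pos rho_less_1 in auto)
    also have "\<dots> = (1 / real p) ^ k * \<rho> ^ (k - 1)"
      by (simp only: power_add power_mult rho_power)
    also have "\<dots> \<le> (1 / real p) ^ k * pabs (fact k :: 'a)"
      using less.IH[OF k(2,1)] by (intro mult_left_mono) auto
    also have "\<dots> = pabs (fact m :: 'a)"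
      using pabs_fact_div[of m] by (simp add: k_def)
    finally show ?thesis .
  qed
qed

lemma pabs_inverse_fact_le:
  assumes "0 < m"
  shows "pabs (1 / fact m :: 'a) \<le> 1 / \<rho> ^ (m - 1)"
  using frac_le[OF zero_le_one order_refl _ pabs_fact_ge[OF assms]] rho_pos by simp

lemma pabs_fact_less_p: "m < p \<Longrightarrow> pabs (fact m :: 'a) = 1"
  by (subst pabs_fact_div) simp

lemma pabs_fact_p: "pabs (fact p :: 'a) = 1 / real p"
  using p_gt_1 by (subst pabs_fact_div) simp

section \<open>Power series and Gauss norms\<close>

text \<open>
  \<open>gauss_le r B f\<close> bounds the Gauss norm of \<open>f\<close> for the radius \<open>r\<close>. Only upper bounds are ever
  used, which avoids having to single out the power series whose Gauss norm is finite.
\<close>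

definition gauss_le :: "real \<Rightarrow> real \<Rightarrow> 'a fps \<Rightarrow> bool" where
  "gauss_le r B f \<longleftrightarrow> (\<forall>m. pabs (f $ m) * r ^ m \<le> B)"

lemma gauss_leD: "gauss_le r B f \<Longrightarrow> pabs (f $ m) * r ^ m \<le> B"
  by (simp add: gauss_le_def)

lemma gauss_le_nonneg: "gauss_le r B f \<Longrightarrow> 0 \<le> B"
  using gauss_leD[of r B f 0] order_trans[OF pabs_nonneg[of "f $ 0"]] by simp

lemma gauss_le_mono: "gauss_le r B f \<Longrightarrow> B \<le> C \<Longrightarrow> gauss_le r C f"
  unfolding gauss_le_def by (meson order_trans)

lemma gauss_le_const_iff: "gauss_le r B (fps_const c) \<longleftrightarrow> pabs c \<le> B"
proof
  assume "pabs c \<le> B"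
  moreover from this have "0 \<le> B"
    using pabs_nonneg[of c] by linarith
  ultimately show "gauss_le r B (fps_const c)"
    unfolding gauss_le_def by auto
qed (use gauss_leD[of r B _ 0] in fastforce)

lemma gauss_le_0 [simp]: "gauss_le r B 0 \<longleftrightarrow> 0 \<le> B"
  by (simp add: gauss_le_def)

lemma gauss_le_1: "1 \<le> B \<Longrightarrow> gauss_le r B 1"
  using gauss_le_const_iff[of r B 1] by simp

lemma gauss_le_X: "0 \<le> r \<Longrightarrow> r \<le> B \<Longrightarrow> gauss_le r B fps_X"
  unfolding gauss_le_def by auto

lemma gauss_le_add:
  assumes "0 \<le> r" "gauss_le r B f" "gauss_le r B h"
  shows "gauss_le r B (f + h)"
  unfolding gauss_le_def
proof
  fix m
  have "pabs ((f + h) $ m) * r ^ m \<le> max (pabs (f $ m)) (pabs (h $ m)) * r ^ m"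
    using assms(1) pabs_ultrametric by (intro mult_right_mono) auto
  then show "pabs ((f + h) $ m) * r ^ m \<le> B"
    using gauss_leD[OF assms(2), of m] gauss_leD[OF assms(3), of m]
    by (auto simp: max_def split: if_splits)
qed

lemma gauss_le_minus: "gauss_le r B (- f) \<longleftrightarrow> gauss_le r B f"
  by (simp add: gauss_le_def)

lemma gauss_le_diff:
  assumes "0 \<le> r" "gauss_le r B f" "gauss_le r B h"
  shows "gauss_le r B (f - h)"
  using gauss_le_add[of r B f "- h"] assms by (simp add: gauss_le_minus)

lemma gauss_le_sum:
  assumes "0 \<le> r" "0 \<le> B" "\<And>i. i \<in> S \<Longrightarrow> gauss_le r B (f i)"
  shows "gauss_le r B (sum f S)"
  using assms(3) by (induction S rule: infinite_finite_induct)
    (auto intro!: gauss_le_add assms(1,2))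

lemma gauss_le_mult:
  assumes "0 < r" "gauss_le r B f" "gauss_le r C h"
  shows "gauss_le r (B * C) (f * h)"
  unfolding gauss_le_def
proof
  fix n
  have "pabs ((f * h) $ n) \<le> B * C / r ^ n"
    unfolding fps_mult_nth
  proof (rule pabs_sum_le)
    show "0 \<le> B * C / r ^ n"
      using assms gauss_le_nonneg by (intro divide_nonneg_pos mult_nonneg_nonneg) auto
    fix i assume i: "i \<in> {0..n}"
    have "(pabs (f $ i) * r ^ i) * (pabs (h $ (n - i)) * r ^ (n - i)) \<le> B * C"
      using assms gauss_le_nonneg gauss_leD by (intro mult_mono mult_nonneg_nonneg) auto
    moreover have "r ^ n = r ^ i * r ^ (n - i)"
      using i by (simp flip: power_add)
    ultimately show "pabs (f $ i * h $ (n - i)) \<le> B * C / r ^ n"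
      using assms(1) by (simp add: pabs_mult pos_le_divide_eq mult_ac)
  qed
  then show "pabs ((f * h) $ n) * r ^ n \<le> B * C"
    using assms(1) by (simp add: pos_le_divide_eq)
qed

lemma gauss_le_const_mult:
  assumes "0 < r" "gauss_le r B f"
  shows "gauss_le r (pabs c * B) (fps_const c * f)"
  using gauss_le_mult[OF assms(1) _ assms(2)] gauss_le_const_iff by blast

lemma gauss_le_power:
  assumes "0 < r" "gauss_le r B f"
  shows "gauss_le r (B ^ n) (f ^ n)"
  by (induction n) (auto intro: gauss_le_1 gauss_le_mult assms)

lemma gauss_le_prod_1:
  assumes "0 < r" "\<And>i. i \<in> S \<Longrightarrow> gauss_le r 1 (f i)"
  shows "gauss_le r 1 (prod f S)"
  using assms(2)
proof (induction S rule: infinite_finite_induct)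
  case (insert i S)
  then show ?case
    using gauss_le_mult[OF assms(1), of 1 "f i" 1 "prod f S"] by auto
qed (auto intro: gauss_le_1)

lemma gauss_le_of_nat: "gauss_le r 1 (of_nat n)"
  using gauss_le_const_iff[of r 1 "of_nat n"] pabs_of_nat_le_1[of n] by (simp add: fps_of_nat)

text \<open>Telescoping the product one factor at a time.\<close>

lemma gauss_le_prod_diff:
  assumes "0 < r" "0 \<le> D" "\<And>i. i \<in> S \<Longrightarrow> gauss_le r 1 (f i)" "\<And>i. i \<in> S \<Longrightarrow> gauss_le r 1 (h i)"
    "\<And>i. i \<in> S \<Longrightarrow> gauss_le r D (f i - h i)"
  shows "gauss_le r D (prod f S - prod h S)"
  using assms(3-)
proof (induction S rule: infinite_finite_induct)
  case (insert i S)
  have "prod f (insert i S) - prod h (insert i S)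
      = (f i - h i) * prod f S + h i * (prod f S - prod h S)"
    using insert.hyps by (simp add: algebra_simps)
  moreover have "gauss_le r (D * 1) ((f i - h i) * prod f S)"
    using insert.prems by (intro gauss_le_mult gauss_le_prod_1 assms(1)) auto
  moreover have "gauss_le r (1 * D) (h i * (prod f S - prod h S))"
    using insert by (intro gauss_le_mult assms(1)) auto
  ultimately show ?case
    using assms(1) by (simp add: gauss_le_add)
qed (use assms(2) in auto)

subsection \<open>Evaluation\<close>

definition fps_value :: "'a fps \<Rightarrow> 'a \<Rightarrow> 'a" where
  "fps_value f y = (\<Sum>m. f $ m * y ^ m)"

lemma gauss_le_term:
  assumes "0 < r" "gauss_le r B f"
  shows "pabs (f $ m * y ^ m) \<le> B * (pabs y / r) ^ m"
proof -
  have "pabs (f $ m * y ^ m) = (pabs (f $ m) * r ^ m) * (pabs y / r) ^ m"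
    using assms(1) by (simp add: pabs_mult power_divide)
  also have "\<dots> \<le> B * (pabs y / r) ^ m"
    using assms by (intro mult_right_mono gauss_leD) auto
  finally show ?thesis .
qed

lemma fps_value_sums:
  assumes "0 < r" "gauss_le r B f" "pabs y < r"
  shows "(\<lambda>m. f $ m * y ^ m) sums fps_value f y"
  unfolding fps_value_def using assms(1,3)
  by (intro summable_sums padic_summable tendsto_0_geometric[OF gauss_le_term[OF assms(1,2)]]) auto

lemma fps_value_le:
  assumes "0 < r" "gauss_le r B f" "pabs y < r"
  shows "pabs (fps_value f y) \<le> B"
proof (rule padic_sums_le[OF fps_value_sums[OF assms]])
  fix m
  have "(pabs y / r) ^ m \<le> 1"
    using assms by (intro power_le_one) auto
  then show "pabs (f $ m * y ^ m) \<le> B"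
    using gauss_le_term[OF assms(1,2), of m y] mult_left_mono[of "(pabs y / r) ^ m" 1 B]
      gauss_le_nonneg[OF assms(2)] by linarith
qed

lemma sums_imp_fps_value: "(\<lambda>m. f $ m * y ^ m) sums s \<Longrightarrow> fps_value f y = s"
  unfolding fps_value_def by (rule sums_unique[symmetric])

lemma fps_value_add:
  assumes "0 < r" "gauss_le r B f" "gauss_le r C h" "pabs y < r"
  shows "fps_value (f + h) y = fps_value f y + fps_value h y"
  using padic_sums_add[OF fps_value_sums[OF assms(1,2,4)] fps_value_sums[OF assms(1,3,4)]]
  by (intro sums_imp_fps_value) (simp add: algebra_simps)

lemma fps_value_diff:
  assumes "0 < r" "gauss_le r B f" "gauss_le r C h" "pabs y < r"
  shows "fps_value (f - h) y = fps_value f y - fps_value h y"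
  using padic_sums_diff[OF fps_value_sums[OF assms(1,2,4)] fps_value_sums[OF assms(1,3,4)]]
  by (intro sums_imp_fps_value) (simp add: algebra_simps)

lemma fps_value_const [simp]: "fps_value (fps_const c) y = c"
proof (rule sums_imp_fps_value)
  have "(\<lambda>m. fps_const c $ m * y ^ m) sums (\<Sum>m\<in>{0}. fps_const c $ m * y ^ m)"
    by (intro sums_finite) auto
  then show "(\<lambda>m. fps_const c $ m * y ^ m) sums c"
    by simp
qed

text \<open>
  The product of two partial sums differs from the partial sum of the Cauchy product by terms of
  total degree at least \<open>n\<close>.
\<close>

lemma fps_value_mult:
  assumes "0 < r" "gauss_le r B f" "gauss_le r C h" "pabs y < r"
  shows "fps_value (f * h) y = fps_value f y * fps_value h y"
proof -
  define \<theta> where "\<theta> = pabs y / r"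
  have \<theta>: "0 \<le> \<theta>" "\<theta> < 1"
    using assms by (auto simp: \<theta>_def)
  let ?P = "\<lambda>f n. \<Sum>m<n. f $ m * y ^ m"
  let ?t = "\<lambda>i j. (f $ i * y ^ i) * (h $ j * y ^ j)"
  have lims: "?P f \<longlonglongrightarrow> fps_value f y" "?P h \<longlonglongrightarrow> fps_value h y"
    "?P (f * h) \<longlonglongrightarrow> fps_value (f * h) y"
    using fps_value_sums[OF assms(1,2,4)] fps_value_sums[OF assms(1,3,4)]
      fps_value_sums[OF assms(1) gauss_le_mult[OF assms(1-3)] assms(4)]
    by (simp_all add: sums_def)
  have diff: "pabs (?P f n * ?P h n - ?P (f * h) n) \<le> B * C * \<theta> ^ n" for n
  proof -
    let ?T = "{(i, j). i + j < n}" and ?S = "{..<n} \<times> {..<n}"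
    have "?P (f * h) n = (\<Sum>k<n. \<Sum>i\<le>k. ?t i (k - i))"
      by (auto intro!: sum.cong simp: fps_mult_nth sum_distrib_left atLeast0AtMost mult_ac
          simp flip: power_add)
    also have "\<dots> = sum (\<lambda>(i, j). ?t i j) ?T"
      by (simp add: sum.triangle_reindex)
    finally have "?P f n * ?P h n - ?P (f * h) n = sum (\<lambda>(i, j). ?t i j) ?S - sum (\<lambda>(i, j). ?t i j) ?T"
      by (simp add: sum_product sum.cartesian_product)
    also have "\<dots> = sum (\<lambda>(i, j). ?t i j) (?S - ?T)"
      by (rule sum_diff[symmetric]) auto
    also have "pabs \<dots> \<le> B * C * \<theta> ^ n"
    proof (rule pabs_sum_le)
      show "0 \<le> B * C * \<theta> ^ n"
        using gauss_le_nonneg[OF assms(2)] gauss_le_nonneg[OF assms(3)] \<theta> by simp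
      fix z assume "z \<in> ?S - ?T"
      then obtain i j where z: "z = (i, j)" "n \<le> i + j"
        by auto
      have "pabs (?t i j) \<le> (B * \<theta> ^ i) * (C * \<theta> ^ j)"
        unfolding pabs_mult[of "f $ i * y ^ i"] \<theta>_def using assms(1) gauss_le_nonneg[OF assms(2)]
        by (intro mult_mono gauss_le_term assms) auto
      also have "\<dots> = B * C * \<theta> ^ (i + j)"
        by (simp add: power_add)
      also have "\<dots> \<le> B * C * \<theta> ^ n"
        using z \<theta> gauss_le_nonneg[OF assms(2)] gauss_le_nonneg[OF assms(3)]
        by (intro mult_left_mono power_decreasing) auto
      finally show "pabs (case z of (i, j) \<Rightarrow> ?t i j) \<le> B * C * \<theta> ^ n"
        by (simp add: z)
    qed
    finally show ?thesis .
  qed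
  have "(\<lambda>n. ?P f n * ?P h n - ?P (f * h) n) \<longlonglongrightarrow> 0"
    using tendsto_0_geometric[OF diff \<theta>] .
  moreover have "(\<lambda>n. ?P f n * ?P h n - ?P (f * h) n) \<longlonglongrightarrow>
      fps_value f y * fps_value h y - fps_value (f * h) y"
    by (intro padic_tendsto_diff padic_tendsto_mult lims)
  ultimately show ?thesis
    using LIMSEQ_unique by fastforce
qed

lemma fps_value_const_mult:
  assumes "0 < r" "gauss_le r B f" "pabs y < r"
  shows "fps_value (fps_const c * f) y = c * fps_value f y"
  using fps_value_mult[OF assms(1) _ assms(2,3), of "pabs c" "fps_const c"]
  by (simp add: gauss_le_const_iff)

lemma fps_value_power:
  assumes "0 < r" "gauss_le r B f" "pabs y < r"
  shows "fps_value (f ^ n) y = fps_value f y ^ n"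
proof (induction n)
  case 0
  show ?case
    using fps_value_const[of 1] by (simp del: fps_value_const)
next
  case (Suc n)
  then show ?case
    using fps_value_mult[OF assms(1,2) gauss_le_power[OF assms(1,2)] assms(3)] by simp
qed

lemma fps_value_sum:
  assumes "0 < r" "\<And>i. i \<in> S \<Longrightarrow> gauss_le r (B i) (f i)" "pabs y < r" "finite S"
  shows "fps_value (sum f S) y = (\<Sum>i\<in>S. fps_value (f i) y)"
proof -
  have "(\<lambda>m. sum f S $ m * y ^ m) sums (\<Sum>i\<in>S. fps_value (f i) y)"
    using assms(4,2)
  proof (induction S rule: finite_induct)
    case (insert i S)
    have "(\<lambda>m. f i $ m * y ^ m + sum f S $ m * y ^ m) sums (fps_value (f i) y + (\<Sum>i\<in>S. fps_value (f i) y))"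
      using insert by (intro padic_sums_add fps_value_sums[OF assms(1) _ assms(3)]) auto
    then show ?case
      using insert.hyps by (simp add: algebra_simps)
  qed simp
  then show ?thesis
    by (rule sums_imp_fps_value)
qed

lemma fps_value_prod:
  assumes "0 < r" "\<And>i. i \<in> S \<Longrightarrow> gauss_le r 1 (f i)" "pabs y < r"
  shows "fps_value (prod f S) y = (\<Prod>i\<in>S. fps_value (f i) y)"
  using assms(2)
proof (induction S rule: infinite_finite_induct)
  case (insert i S)
  then show ?case
    using fps_value_mult[OF assms(1) _ gauss_le_prod_1[OF assms(1)] assms(3), of 1 "f i" S f]
    by simp
qed (use fps_value_const[of 1] in \<open>simp_all del: fps_value_const\<close>)

lemma fps_value_X [simp]: "fps_value fps_X y = y"
proof -
  have "(\<lambda>m. fps_X $ m * y ^ m) sums (\<Sum>m\<in>{1}. fps_X $ m * y ^ m)"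
    by (intro sums_finite) auto
  then show ?thesis
    by (intro sums_imp_fps_value) simp
qed

subsection \<open>Limits and composition\<close>

text \<open>
  Completeness for the Gauss norm, stated for geometric convergence because the limit then comes
  with an explicit bound for its distance to each approximation.
\<close>

lemma gauss_geometric_limit:
  assumes "0 < r" "0 \<le> \<theta>" "\<theta> < 1" "\<And>k. gauss_le r (C * \<theta> ^ k) (F (Suc k) - F k)"
  obtains f where "\<And>k. gauss_le r (C * \<theta> ^ k) (f - F k)"
proof -
  have C: "0 \<le> C"
    using gauss_le_nonneg[OF assms(4)[of 0]] by simp
  have step: "gauss_le r (C * \<theta> ^ k) (F n - F k)" if "k \<le> n" for k n
    using that
  proof (induction n rule: dec_induct)
    case (step n)
    have "gauss_le r (C * \<theta> ^ k) (F (Suc n) - F n)"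
      using assms(2,3) C step.hyps by (intro gauss_le_mono[OF assms(4)] mult_left_mono power_decreasing) auto
    from gauss_le_add[OF _ this step.IH] show ?case
      using assms(1) by simp
  qed (use assms(2) C in simp)
  have "\<exists>L. (\<lambda>n. F n $ m) \<longlonglongrightarrow> L" for m
  proof -
    have "pabs (F (Suc n) $ m - F n $ m) \<le> (C / r ^ m) * \<theta> ^ n" for n
      using gauss_leD[OF assms(4), of n m] assms(1) by (simp add: pos_le_divide_eq)
    then have "summable (\<lambda>n. F (Suc n) $ m - F n $ m)"
      by (intro padic_summable tendsto_0_geometric[OF _ assms(2,3)])
    then obtain L where "(\<lambda>n. \<Sum>i<n. F (Suc i) $ m - F i $ m) \<longlonglongrightarrow> L"
      unfolding summable_def sums_def by blast
    then have "(\<lambda>n. F n $ m - F 0 $ m) \<longlonglongrightarrow> L"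
      by (simp only: sum_lessThan_telescope[of "\<lambda>i. F i $ m"])
    from padic_tendsto_add[OF this tendsto_const[of "F 0 $ m"]] show ?thesis
      by auto
  qed
  then obtain L where L: "\<And>m. (\<lambda>n. F n $ m) \<longlonglongrightarrow> L m"
    by metis
  show ?thesis
  proof
    show "gauss_le r (C * \<theta> ^ k) (Abs_fps L - F k)" for k
      unfolding gauss_le_def
    proof
      fix m
      have "pabs (L m - F k $ m) \<le> C * \<theta> ^ k / r ^ m"
      proof (rule pabs_limit_le)
        show "(\<lambda>n. F n $ m - F k $ m) \<longlonglongrightarrow> L m - F k $ m"
          by (intro padic_tendsto_diff L tendsto_const)
        show "pabs (F n $ m - F k $ m) \<le> C * \<theta> ^ k / r ^ m" if "k \<le> n" for n
          using gauss_leD[OF step[OF that], of m] assms(1) by (simp add: pos_le_divide_eq)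
      qed
      then show "pabs ((Abs_fps L - F k) $ m) * r ^ m \<le> C * \<theta> ^ k"
        using assms(1) by (simp add: pos_le_divide_eq)
    qed
  qed
qed

lemma fps_value_compose_sums:
  assumes "0 < r" "0 \<le> \<theta>" "\<theta> < 1" "h $ 0 = 0" "gauss_le r R h"
    "\<And>n. pabs (f $ n) * R ^ n \<le> C * \<theta> ^ n" "pabs y < r"
  shows "(\<lambda>n. f $ n * fps_value h y ^ n) sums fps_value (f oo h) y"
proof -
  define S where "S N = (\<Sum>n<N. fps_const (f $ n) * h ^ n)" for N
  have C: "0 \<le> C"
    using assms(6)[of 0] order_trans[OF pabs_nonneg[of "f $ 0"]] by simp
  have summand: "gauss_le r (C * \<theta> ^ n) (fps_const (f $ n) * h ^ n)" for n
    by (rule gauss_le_mono[OF gauss_le_const_mult[OF assms(1) gauss_le_power[OF assms(1,5)]] assms(6)])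
  have rest: "gauss_le r (C * \<theta> ^ N) ((f oo h) - S N)" for N
    unfolding gauss_le_def
  proof
    fix m
    have "(f oo h) $ m = (\<Sum>i<Suc (m + N). f $ i * (h ^ i) $ m)"
      unfolding fps_compose_nth using startsby_zero_power_prefix[OF assms(4)]
      by (intro sum.mono_neutral_left) auto
    moreover have "sum w {..<Suc (m + N)} = sum w {..<N} + sum w {N..<Suc (m + N)}" for w :: "nat \<Rightarrow> 'a"
      using sum.atLeastLessThan_concat[of 0 N "Suc (m + N)" w]
      by (simp add: lessThan_atLeast0 del: sum.op_ivl_Suc)
    moreover have "((f oo h) - S N) $ m = (f oo h) $ m - (\<Sum>n<N. f $ n * (h ^ n) $ m)"
      by (simp only: S_def fps_sub_nth fps_sum_nth fps_mult_left_const_nth)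
    ultimately have "((f oo h) - S N) $ m = (\<Sum>n\<in>{N..<Suc (m + N)}. fps_const (f $ n) * h ^ n) $ m"
      by (simp add: fps_sum_nth del: sum.op_ivl_Suc sum.lessThan_Suc)
    moreover have "gauss_le r (C * \<theta> ^ N) (\<Sum>n\<in>{N..<Suc (m + N)}. fps_const (f $ n) * h ^ n)"
      using assms(1-3) C
      by (intro gauss_le_sum gauss_le_mono[OF summand] mult_left_mono power_decreasing) auto
    ultimately show "pabs (((f oo h) - S N) $ m) * r ^ m \<le> C * \<theta> ^ N"
      using gauss_leD by metis
  qed
  have "fps_value (S N) y = (\<Sum>n<N. f $ n * fps_value h y ^ n)" for N
    unfolding S_def using assms(1,5,7)
    by (subst fps_value_sum[OF assms(1) summand assms(7)])
      (simp_all add: fps_value_const_mult[OF assms(1) gauss_le_power[OF assms(1,5)] assms(7)]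
        fps_value_power[OF assms(1,5,7)])
  moreover have "(\<lambda>N. fps_value (S N) y) \<longlonglongrightarrow> fps_value (f oo h) y"
  proof (rule tendsto_pabs_le)
    have S0: "gauss_le r (C * \<theta> ^ 0) (f oo h)"
      using rest[of 0] by (simp add: S_def)
    have SN: "gauss_le r C (S N)" for N
      unfolding S_def using assms(1-3) C
      by (intro gauss_le_sum gauss_le_mono[OF summand] mult_left_le power_le_one) auto
    show "pabs (fps_value (S N) y - fps_value (f oo h) y) \<le> C * \<theta> ^ N" for N
      using fps_value_le[OF assms(1) rest assms(7)] fps_value_diff[OF assms(1) S0 SN assms(7)]
      by (simp add: pabs_minus_commute)
    show "(\<lambda>N. C * \<theta> ^ N) \<longlonglongrightarrow> 0"
      using tendsto_mult_left[OF LIMSEQ_realpow_zero[OF assms(2,3)], of C] by simp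
  qed
  ultimately show ?thesis
    by (simp add: sums_def)
qed

section \<open>The binomial series\<close>

lemma fps_exp_compose_ln: "fps_exp c oo fps_ln 1 = fps_binomial (c::'a)"
proof -
  have "fps_deriv (fps_exp c oo fps_ln 1) =
      fps_const c * (fps_exp c oo fps_ln 1) * inverse (1 + fps_X)"
    by (simp add: fps_compose_deriv fps_ln_deriv fps_compose_mult_distrib)
  then show ?thesis
    by (subst fps_binomial_ODE_unique'[symmetric]) (simp add: fps_divide_unit)
qed

lemma pabs_of_nat_ge: "0 < m \<Longrightarrow> \<rho> ^ (m - 1) \<le> pabs (of_nat m :: 'a)"
proof -
  assume "0 < m"
  then have "pabs (fact m :: 'a) = pabs (of_nat m :: 'a) * pabs (fact (m - 1) :: 'a)"
    by (simp add: fact_reduce pabs_mult)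
  also have "\<dots> \<le> pabs (of_nat m :: 'a) * 1"
    by (intro mult_left_mono) (use pabs_of_nat_le_1[of "fact (m - 1)"] in auto)
  finally show ?thesis
    using pabs_fact_ge[OF \<open>0 < m\<close>] by simp
qed

text \<open>
  The radius \<open>\<rho>\<close> is exactly such that \<open>log\<close> maps the ball of radius \<open>r < \<rho>\<close> into itself and
  \<open>exp\<close> converges there, so that the formal identity \<open>exp (x log (1 + T)) = (1 + T) ^ x\<close> can be
  evaluated.
\<close>

lemma q_power_binomial_sums:
  fixes x t :: 'a
  assumes "pabs x \<le> 1" "pabs t < \<rho>"
  shows "(\<lambda>n. (x gchoose n) * t ^ n) sums q_power (1 + t) x"
proof -
  obtain r where r: "pabs t < r" "r < \<rho>"
    using assms(2) dense by blast
  have r0: "0 < r"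
    using r(1) pabs_nonneg[of t] by linarith
  have ratio: "r / \<rho> \<le> 1" "0 \<le> r / \<rho>" "r / \<rho> < 1"
    using r r0 by auto
  have ln: "gauss_le r r (fps_ln 1)"
    unfolding gauss_le_def
  proof
    fix m
    show "pabs (fps_ln (1::'a) $ m) * r ^ m \<le> r"
    proof (cases m)
      case (Suc n)
      have "r ^ n \<le> \<rho> ^ n"
        using r r0 by (intro power_mono) auto
      also have "\<dots> \<le> pabs (of_nat m :: 'a)"
        using pabs_of_nat_ge[of m] Suc by simp
      finally have "r * r ^ n / pabs (of_nat m :: 'a) \<le> r"
        using r0 Suc by (simp add: divide_le_eq del: of_nat_Suc)
      then show ?thesis
        using Suc by (simp add: fps_ln_nth del: of_nat_Suc)
    qed (use r0 in simp)
  qed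
  have exp: "pabs (fps_exp x $ n) * r ^ n \<le> 1 * (r / \<rho>) ^ n" for n
  proof (cases n)
    case (Suc m)
    have "pabs (fps_exp x $ n) * r ^ n = pabs x ^ n * (pabs (1 / fact n :: 'a) * r ^ n)"
      by (simp add: pabs_mult)
    also have "\<dots> \<le> 1 * (1 / \<rho> ^ (n - 1) * r ^ n)"
      using assms(1) r0 pabs_inverse_fact_le[of n] Suc
      by (intro mult_mono power_le_one mult_right_mono) auto
    also have "\<dots> = \<rho> * (r / \<rho>) ^ n"
      using Suc rho_pos by (simp add: power_divide)
    also have "\<dots> \<le> 1 * (r / \<rho>) ^ n"
      using rho_less_1 ratio by (intro mult_right_mono) auto
    finally show ?thesis .
  qed simp
  have "plog (1 + t) = fps_value (fps_ln 1) t"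
  proof -
    have "(\<lambda>m. fps_ln 1 $ (m + 1) * t ^ (m + 1)) sums (fps_value (fps_ln 1) t - 0)"
      using padic_sums_shift[OF fps_value_sums[OF r0 ln r(1)], of 1] by simp
    then show ?thesis
      unfolding plog_def by (intro sums_unique[symmetric]) (simp add: fps_ln_nth)
  qed
  moreover have "(\<lambda>n. fps_exp x $ n * fps_value (fps_ln 1) t ^ n) sums fps_value (fps_binomial x) t"
    using fps_value_compose_sums[OF r0 ratio(2,3) fps_ln_0 ln exp r(1)] by (simp add: fps_exp_compose_ln)
  ultimately have eq: "q_power (1 + t) x = fps_value (fps_binomial x) t"
    unfolding q_power_def pexp_def by (intro sums_unique[symmetric]) (simp add: power_mult_distrib)
  have "gauss_le r 1 (fps_binomial x)"
    unfolding gauss_le_def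
  proof
    fix m
    have "pabs (x gchoose m) \<le> 1 * (1 / \<rho> ^ (m - 1))" if "0 < m"
    proof -
      have "x gchoose m = (\<Prod>i = 0..<m. x - of_nat i) * (1 / fact m)"
        by (simp add: gbinomial_prod_rev)
      also have "pabs \<dots> \<le> 1 * (1 / \<rho> ^ (m - 1))"
        unfolding pabs_mult pabs_prod using that pabs_inverse_fact_le[of m]
        by (intro mult_mono prod_le_1) (auto intro!: pabs_diff_le assms(1) pabs_of_nat_le_1 prod_nonneg)
      finally show ?thesis .
    qed
    then have "pabs (x gchoose m) * r ^ m \<le> 1 / \<rho> ^ (m - 1) * r ^ m" if "0 < m"
      using that r0 by (intro mult_right_mono) auto
    also have "1 / \<rho> ^ (m - 1) * r ^ m = \<rho> * (r / \<rho>) ^ m" if "0 < m"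
      using that rho_pos by (cases m) (auto simp: power_divide)
    moreover have "\<rho> * (r / \<rho>) ^ m \<le> 1"
      using ratio rho_less_1 rho_pos by (intro mult_le_one power_le_one) auto
    ultimately show "pabs (fps_binomial x $ m) * r ^ m \<le> 1"
      by (cases "m = 0") force+
  qed
  from fps_value_sums[OF r0 this r(1)] show ?thesis
    by (simp add: eq)
qed

lemma gbinomial_conv_A: "x gchoose (n + 2) = x * (x - 1) * (poly (A n) x / fact (n + 2))" for x :: 'a
proof -
  have "{0..<n + 2} = insert 0 (insert 1 {2..n + 1})"
    by auto
  then have "(\<Prod>i \<in> {0..<n + 2}. x - of_nat i) = prod (\<lambda>i. x - of_nat i) (insert 0 (insert 1 {2..n + 1}))"
    by (simp only:)
  also have "\<dots> = x * (x - 1) * (\<Prod>i\<in>{2..n + 1}. x - of_nat i)"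
    by (simp add: mult.assoc del: prod.cl_ivl_Suc One_nat_def add_Suc_right Suc_1)
  also have "(\<Prod>i\<in>{2..n + 1}. x - of_nat i) = poly (A n) x"
    unfolding A_def poly_prod by (intro prod.cong) auto
  finally show ?thesis
    by (simp add: gbinomial_prod_rev del: fact_Suc)
qed

lemma q_bracket_minus_self:
  fixes x q :: 'a
  assumes "pabs x \<le> 1" "pabs (q - 1) < \<rho>" "q \<noteq> 1" "x \<noteq> 0" "x \<noteq> 1"
  shows "(q_bracket q x - x) / (x * (x - 1)) = (q - 1) * g x q"
proof -
  define t where "t = q - 1"
  have t: "t \<noteq> 0" "q = 1 + t" "pabs t < \<rho>"
    using assms by (auto simp: t_def)
  define s where "s = q_power q x - 1 - x * t"
  have "{..<2::nat} = {0, 1}"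
    by auto
  then have "(\<lambda>n. (x gchoose (n + 2)) * t ^ (n + 2)) sums s"
    using padic_sums_shift[OF q_power_binomial_sums[OF assms(1) t(3)], of 2]
    by (simp add: s_def t(2) algebra_simps)
  from padic_sums_cmult[OF this, of "1 / (x * (x - 1) * t\<^sup>2)"]
  have "(\<lambda>n. poly (A n) x / fact (n + 2) * t ^ n) sums (1 / (x * (x - 1) * t\<^sup>2) * s)"
    using assms(4,5) t(1) unfolding gbinomial_conv_A
    by (simp add: power_add power2_eq_square mult_ac del: fact_Suc)
  then have "g x q = 1 / (x * (x - 1) * t\<^sup>2) * s"
    unfolding g_def t_def by (intro sums_unique[symmetric])
  then show ?thesis
    using assms(3-5) t(1) by (simp add: q_bracket_def s_def field_simps power2_eq_square t(2))
qed

section \<open>The zeros of \<open>g\<close> in the second variable\<close>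

lemma sum_fps_const: "(\<Sum>i\<in>S. fps_const (f i)) = fps_const (\<Sum>i\<in>S. f i :: 'a)"
  by (induction S rule: infinite_finite_induct) (simp_all flip: fps_const_add)

lemma prod_fps_const: "(\<Prod>i\<in>S. fps_const (f i)) = fps_const (\<Prod>i\<in>S. f i :: 'a)"
  by (induction S rule: infinite_finite_induct) (simp_all flip: fps_const_mult)

definition g_term :: "nat \<Rightarrow> 'a \<Rightarrow> 'a \<Rightarrow> 'a" where
  "g_term n x t = poly (A n) x / fact (n + 2) * t ^ n"

lemma poly_A: "poly (A n) x = (\<Prod>k\<in>{2..n + 1}. x - of_nat k)" for x :: 'a
  unfolding A_def poly_prod by (intro prod.cong) auto

lemma A_index_split:
  assumes "p - 2 \<le> n"
  shows "{2..n + 1} = {2..p - 2 + 1} \<union> {p..n + 1}" "{2..p - 2 + 1} \<inter> {p..n + 1} = {}"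
  using assms p_gt_1 by auto

lemma pabs_minus_of_nat_le_1: "pabs x \<le> 1 \<Longrightarrow> pabs (x - of_nat k) \<le> 1" for x :: 'a
  by (intro pabs_diff_le pabs_of_nat_le_1)

lemma pabs_poly_A_le_1: "pabs x \<le> 1 \<Longrightarrow> pabs (poly (A n) x) \<le> 1" for x :: 'a
  unfolding poly_A pabs_prod by (intro prod_le_1) (auto simp: pabs_minus_of_nat_le_1)

lemma pabs_poly_A_le_radius:
  fixes x :: 'a
  assumes "pabs x \<le> 1" "p - 2 \<le> n"
  shows "pabs (poly (A n) x) \<le> Q_radius p x"
proof -
  have "poly (A n) x = poly (A (p - 2)) x * (\<Prod>k\<in>{p..n + 1}. x - of_nat k)"
    unfolding poly_A A_index_split(1)[OF assms(2)]
    by (rule prod.union_disjoint) (use A_index_split(2)[OF assms(2)] in auto)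
  moreover have "pabs (\<Prod>k\<in>{p..n + 1}. x - of_nat k) \<le> 1"
    unfolding pabs_prod by (intro prod_le_1) (auto simp: assms(1) pabs_minus_of_nat_le_1)
  ultimately show ?thesis
    unfolding Q_radius_def by (simp add: pabs_mult mult_left_le)
qed

lemma Q_radius_le_1: "pabs x \<le> 1 \<Longrightarrow> Q_radius p x \<le> 1" for x :: 'a
  unfolding Q_radius_def by (rule pabs_poly_A_le_1)

lemma pabs_poly_A_diff_le:
  fixes x y :: 'a
  assumes "pabs x \<le> 1" "pabs y \<le> 1"
  shows "pabs (poly (A n) x - poly (A n) y) \<le> pabs (x - y)"
proof -
  have "gauss_le 1 (pabs (x - y))
      ((\<Prod>k\<in>{2..n + 1}. fps_const (x - of_nat k)) - (\<Prod>k\<in>{2..n + 1}. fps_const (y - of_nat k)))"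
    using assms by (intro gauss_le_prod_diff) (auto simp: gauss_le_const_iff pabs_minus_of_nat_le_1)
  then show ?thesis
    unfolding poly_A by (simp only: prod_fps_const fps_const_sub gauss_le_const_iff)
qed

lemma Q_radius_cong:
  fixes x y :: 'a
  assumes "pabs x \<le> 1" "pabs (y - x) < Q_radius p x"
  shows "pabs y \<le> 1" "Q_radius p y = Q_radius p x"
proof -
  show "pabs y \<le> 1"
    using pabs_add_le[of "y - x" 1 x] assms Q_radius_le_1[OF assms(1)] by simp
  then show "Q_radius p y = Q_radius p x"
    unfolding Q_radius_def using assms pabs_poly_A_diff_le[of y x "p - 2"]
    by (intro pabs_eq_if_close) (simp add: Q_radius_def)
qed

lemma g_sums:
  fixes x t :: 'a
  assumes "pabs x \<le> 1" "pabs t < \<rho>"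
  shows "(\<lambda>n. g_term n x t) sums g x (1 + t)"
proof -
  have "pabs (g_term n x t) \<le> (1 / \<rho>) * (pabs t / \<rho>) ^ n" for n
  proof -
    have "pabs (g_term n x t) = pabs (poly (A n) x) * pabs (1 / fact (n + 2) :: 'a) * pabs t ^ n"
      by (simp add: g_term_def pabs_mult)
    also have "\<dots> \<le> 1 * (1 / \<rho> ^ (n + 2 - 1)) * pabs t ^ n"
      by (intro mult_right_mono mult_mono pabs_poly_A_le_1 assms pabs_inverse_fact_le) auto
    finally show ?thesis
      by (simp add: power_divide)
  qed
  from tendsto_0_geometric[OF this] have "summable (\<lambda>n. g_term n x t)"
    using assms(2) rho_pos by (intro padic_summable) auto
  then show ?thesis
    unfolding g_def g_term_def by (simp add: summable_sums)
qed

lemma inverse_fact_power_le: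
  assumes "0 \<le> \<tau>"
  shows "pabs (1 / fact (p - 2 + j + 2) :: 'a) * \<tau> ^ (p - 2 + j) \<le> real p * \<tau> ^ (p - 2) * (\<tau> / \<rho>) ^ j"
proof -
  have "pabs (1 / fact (p - 2 + j + 2) :: 'a) * \<tau> ^ (p - 2 + j)
      \<le> (1 / \<rho> ^ (p - 2 + j + 2 - 1)) * \<tau> ^ (p - 2 + j)"
    using assms by (intro mult_right_mono pabs_inverse_fact_le) auto
  also have "p - 2 + j + 2 - 1 = (p - 1) + j"
    using p_gt_1 by simp
  also have "(1 / \<rho> ^ (p - 1 + j)) * \<tau> ^ (p - 2 + j) = real p * \<tau> ^ (p - 2) * (\<tau> / \<rho>) ^ j"
    by (simp only: power_add rho_power power_divide) (simp add: mult_ac)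
  finally show ?thesis .
qed

lemma g_term_tail_le:
  fixes x t :: 'a
  assumes "pabs x \<le> 1"
  shows "pabs (g_term (p - 2 + j) x t) \<le> real p * Q_radius p x * pabs t ^ (p - 2) * (pabs t / \<rho>) ^ j"
proof -
  have "pabs (g_term (p - 2 + j) x t)
      = pabs (poly (A (p - 2 + j)) x) * (pabs (1 / fact (p - 2 + j + 2) :: 'a) * pabs t ^ (p - 2 + j))"
    by (simp add: g_term_def pabs_mult)
  also have "\<dots> \<le> Q_radius p x * (real p * pabs t ^ (p - 2) * (pabs t / \<rho>) ^ j)"
    by (intro mult_mono pabs_poly_A_le_radius inverse_fact_power_le assms) (auto simp: Q_radius_def)
  finally show ?thesis
    by (simp only: mult_ac)
qed

lemma g_term_beyond_p_le:
  fixes x t :: 'a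
  assumes "pabs x \<le> 1" "pabs t < \<rho>" "p - 2 < n"
  shows "pabs (g_term n x t) \<le> real p * Q_radius p x * pabs t ^ (p - 2) * (pabs t / \<rho>)"
proof -
  obtain j where j: "n = p - 2 + Suc j"
    using less_imp_Suc_add[OF assms(3)] by auto
  have "(pabs t / \<rho>) ^ Suc j \<le> (pabs t / \<rho>) ^ 1"
    using assms(2) rho_pos by (intro power_decreasing) auto
  then have "real p * Q_radius p x * pabs t ^ (p - 2) * (pabs t / \<rho>) ^ Suc j
      \<le> real p * Q_radius p x * pabs t ^ (p - 2) * (pabs t / \<rho>)"
    by (intro mult_left_mono) (auto simp: Q_radius_def)
  then show ?thesis
    unfolding j by (rule order_trans[OF g_term_tail_le[OF assms(1)]])
qed

lemma pabs_g_term_p: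
  fixes x t :: 'a
  shows "pabs (g_term (p - 2) x t) = real p * Q_radius p x * pabs t ^ (p - 2)"
proof -
  have "p - 2 + 2 = p"
    using p_gt_1 by simp
  then show ?thesis
    by (simp add: g_term_def pabs_mult pabs_fact_p Q_radius_def del: fact_Suc add_2_eq_Suc')
qed

lemma pabs_g_term_small_index:
  fixes x t :: 'a
  assumes "pabs x \<le> 1" "n < p - 2"
  shows "pabs (g_term n x t) \<le> pabs t ^ n" "n \<noteq> 0 \<Longrightarrow> pabs t \<le> 1 \<Longrightarrow> pabs (g_term n x t) \<le> pabs t"
proof -
  have "pabs (fact (n + 2) :: 'a) = 1"
    using assms(2) by (intro pabs_fact_less_p) simp
  then have "pabs (g_term n x t) = pabs (poly (A n) x) * pabs t ^ n"
    by (simp add: g_term_def pabs_mult del: fact_Suc add_2_eq_Suc')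
  also have "\<dots> \<le> 1 * pabs t ^ n"
    by (intro mult_right_mono pabs_poly_A_le_1 assms) auto
  finally show *: "pabs (g_term n x t) \<le> pabs t ^ n"
    by simp
  assume "n \<noteq> 0" "pabs t \<le> 1"
  then have "pabs t ^ n \<le> pabs t ^ 1"
    by (intro power_decreasing) auto
  then show "pabs (g_term n x t) \<le> pabs t"
    using * by simp
qed

lemma pabs_g_term_0:
  assumes "2 < p"
  shows "pabs (g_term 0 x t) = 1"
proof -
  have "pabs (fact 2 :: 'a) = 1"
    using assms by (rule pabs_fact_less_p)
  then show ?thesis
    by (simp add: g_term_def A_def numeral_2_eq_2)
qed

lemma padic_sums_remove:
  fixes f :: "nat \<Rightarrow> 'a"
  assumes "f sums s"
  shows "(\<lambda>n. if n = k then 0 else f n) sums (s - f k)"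
proof -
  have "(\<lambda>n. f n - (if n = k then f n else 0)) sums (s - f k)"
    by (intro padic_sums_diff assms sums_single)
  moreover have "(\<lambda>n. f n - (if n = k then f n else 0)) = (\<lambda>n. if n = k then 0 else f n)"
    by auto
  ultimately show ?thesis
    by simp
qed

lemma sums_nonzero_if_dominant_term:
  fixes f :: "nat \<Rightarrow> 'a"
  assumes "f sums s" "\<And>n. n \<noteq> k \<Longrightarrow> pabs (f n) \<le> B" "0 \<le> B" "B < pabs (f k)"
  shows "s \<noteq> 0"
proof
  assume "s = 0"
  have "pabs (s - f k) \<le> B"
    using assms(2,3) by (intro padic_sums_le[OF padic_sums_remove[OF assms(1), of k]]) auto
  then show False
    using assms(4) \<open>s = 0\<close> by simp
qed

text \<open>
  The circle on which the terms of index \<open>0\<close> and \<open>p - 2\<close> of \<open>g\<close> balance. For \<open>p = 2\<close> these are the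
  same term, so that this case has to be excluded.
\<close>

definition critical :: "'a \<Rightarrow> 'a \<Rightarrow> bool" where
  "critical x t \<longleftrightarrow> 2 < p \<and> pabs x \<le> 1 \<and> pabs t < \<rho> \<and> real p * Q_radius p x * pabs t ^ (p - 2) = 1"

lemma criticalD:
  assumes "critical x t"
  shows "2 < p" "pabs x \<le> 1" "pabs t < \<rho>" "real p * Q_radius p x * pabs t ^ (p - 2) = 1"
    "t \<noteq> 0" "0 < Q_radius p x" "0 < pabs t" "pabs t / \<rho> < 1" "pabs t \<le> pabs t / \<rho>" "pabs t < 1"
proof -
  show *: "2 < p" "pabs x \<le> 1" "pabs t < \<rho>" "real p * Q_radius p x * pabs t ^ (p - 2) = 1"
    using assms by (auto simp: critical_def)
  show "t \<noteq> 0"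
    using *(1,4) by (auto simp: zero_power)
  then show "0 < pabs t"
    by simp
  have "Q_radius p x \<noteq> 0"
    using *(4) by auto
  then show "0 < Q_radius p x"
    unfolding Q_radius_def by simp
  show "pabs t / \<rho> < 1" "pabs t \<le> pabs t / \<rho>" "pabs t < 1"
    using *(3) rho_pos rho_less_1 mult_left_le[of \<rho> "pabs t"] by (auto simp: pos_le_divide_eq)
qed

text \<open>
  For \<open>t\<close> inside the domain, the term of index \<open>p - 2\<close> dominates all later ones and the term of
  index \<open>0\<close> dominates those between the two. Hence \<open>g\<close> can only vanish where these two terms
  balance. For \<open>p = 2\<close> they coincide and there is no zero.
\<close>

lemma M_imp_critical:
  assumes "(x, q) \<in> M p"
  shows "critical x (q - 1)"
proof -
  define t where "t = q - 1"
  define \<beta> where "\<beta> = real p * Q_radius p x * pabs t ^ (p - 2)"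
  define \<theta> where "\<theta> = pabs t / \<rho>"
  have x: "pabs x \<le> 1" and t: "pabs t < \<rho>" and zero: "g x (1 + t) = 0"
    using assms by (auto simp: M_def q_domain_def t_def \<rho>_def dist_eq_pabs pabs_minus_commute)
  have \<theta>: "0 \<le> \<theta>" "\<theta> < 1" and t1: "pabs t < 1"
    using t rho_pos rho_less_1 by (auto simp: \<theta>_def)
  have \<beta>: "0 \<le> \<beta>"
    by (simp add: \<beta>_def Q_radius_def)
  note tail = g_term_beyond_p_le[OF x t, folded \<beta>_def \<theta>_def]
  note middle = pabs_g_term_small_index(2)[OF x _ _ less_imp_le[OF t1]]
  have index_p: "pabs (g_term (p - 2) x t) = \<beta>"
    by (simp add: pabs_g_term_p \<beta>_def)
  note nonzero = sums_nonzero_if_dominant_term[OF g_sums[OF x t]]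
  have p2: "2 < p"
  proof (rule ccontr)
    assume "\<not> 2 < p"
    then have "p = 2"
      using p_gt_1 by simp
    then have "\<beta> = 2"
      by (simp add: \<beta>_def Q_radius_def A_def)
    then have "pabs (g_term n x t) \<le> 2 * \<theta>" if "n \<noteq> 0" for n
      using tail[of n] that \<open>p = 2\<close> by simp
    moreover have "pabs (g_term 0 x t) = 2"
      using index_p \<open>p = 2\<close> \<open>\<beta> = 2\<close> by simp
    ultimately show False
      using nonzero[of 0 "2 * \<theta>"] \<theta> zero by simp
  qed
  have "\<beta> = 1"
  proof (rule linorder_cases[of \<beta> 1])
    assume "\<beta> < 1"
    have "pabs (g_term n x t) \<le> max (pabs t) \<beta>" if "n \<noteq> 0" for n
      using tail[of n] middle[of n] index_p that \<theta> mult_left_le[of \<theta> \<beta>] \<beta>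
      by (cases n "p - 2" rule: linorder_cases) auto
    then show ?thesis
      using nonzero[of 0 "max (pabs t) \<beta>"] \<open>\<beta> < 1\<close> t1 pabs_g_term_0[OF p2] zero
      by (auto simp: le_max_iff_disj)
  next
    assume "1 < \<beta>"
    have "pabs (g_term n x t) \<le> max 1 (\<beta> * \<theta>)" if "n \<noteq> p - 2" for n
      using tail[of n] middle[of n] pabs_g_term_0[OF p2, of x t] that t1
      by (cases "n = 0"; cases n "p - 2" rule: linorder_cases) auto
    moreover have "max 1 (\<beta> * \<theta>) < \<beta>"
      using \<theta> \<open>1 < \<beta>\<close> by simp
    ultimately show ?thesis
      using nonzero[of "p - 2" "max 1 (\<beta> * \<theta>)"] index_p zero by (auto simp: le_max_iff_disj)
  qed
  then show ?thesis
    using p2 x t by (simp add: critical_def \<beta>_def t_def)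
qed

lemma M_iff: "(x, 1 + t) \<in> M p \<longleftrightarrow> critical x t \<and> g x (1 + t) = 0"
proof
  assume *: "critical x t \<and> g x (1 + t) = 0"
  then show "(x, 1 + t) \<in> M p"
    using criticalD(2,3)[of x t]
    by (auto simp: M_def q_domain_def \<rho>_def dist_eq_pabs)
next
  assume "(x, 1 + t) \<in> M p"
  then show "critical x t \<and> g x (1 + t) = 0"
    using M_imp_critical[of x "1 + t"] by (auto simp: M_def)
qed

lemma critical_near:
  assumes "critical x t" "pabs (y - x) < Q_radius p x" "pabs s = pabs t"
  shows "critical y s"
  using assms Q_radius_cong[of x y] by (auto simp: critical_def)

lemma g_term_le_ratio:
  assumes "critical x t" "n \<noteq> 0" "n \<noteq> p - 2"
  shows "pabs (g_term n x t) \<le> pabs t / \<rho>"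
proof (cases "n < p - 2")
  case True
  have "pabs (g_term n x t) \<le> pabs t"
    by (rule pabs_g_term_small_index(2)[OF criticalD(2)[OF assms(1)] True assms(2)
          less_imp_le[OF criticalD(10)[OF assms(1)]]])
  then show ?thesis
    using criticalD(9)[OF assms(1)] by (rule order_trans)
next
  case False
  then show ?thesis
    using g_term_beyond_p_le[OF criticalD(2,3)[OF assms(1)], of n] assms(3) criticalD(4)[OF assms(1)] by simp
qed

text \<open>
  On the critical circle all other terms lie in the maximal ideal, modulo which \<open>g\<close> therefore reduces
  to a binomial.
\<close>

lemma g_reduction:
  assumes "critical x t"
  shows "pabs (g x (1 + t) - (g_term 0 x t + g_term (p - 2) x t)) \<le> pabs t / \<rho>"
proof -
  let ?f = "\<lambda>n. g_term n x t"
  have "(\<lambda>n. if n = p - 2 then 0 else if n = 0 then 0 else ?f n) sums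
      (g x (1 + t) - ?f 0 - (if p - 2 = 0 then 0 else ?f (p - 2)))"
    by (intro padic_sums_remove g_sums criticalD[OF assms])
  then have "pabs (g x (1 + t) - ?f 0 - (if p - 2 = 0 then 0 else ?f (p - 2))) \<le> pabs t / \<rho>"
    using g_term_le_ratio[OF assms] rho_pos by (elim padic_sums_le) auto
  then show ?thesis
    using criticalD(1)[OF assms] by (simp add: diff_diff_eq)
qed

subsection \<open>The equation over the ring of power series\<close>

text \<open>
  The partial sums of \<open>g\<close>, with power series substituted for both variables. Estimates for them
  yield, with constant series, estimates for \<open>g\<close> itself and, with non-constant ones, the
  analyticity of the solution.
\<close>

definition A_fps :: "nat \<Rightarrow> 'a fps \<Rightarrow> 'a fps" where
  "A_fps n U = (\<Prod>k\<in>{2..n + 1}. U - of_nat k)"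

definition g_fps :: "nat \<Rightarrow> 'a fps \<Rightarrow> 'a fps \<Rightarrow> 'a fps" where
  "g_fps N U V = (\<Sum>n<N. fps_const (1 / fact (n + 2)) * A_fps n U * V ^ n)"

definition g_part :: "nat \<Rightarrow> 'a \<Rightarrow> 'a \<Rightarrow> 'a" where
  "g_part N x t = (\<Sum>n<N. g_term n x t)"

lemma A_fps_const: "A_fps n (fps_const x) = fps_const (poly (A n) x)"
  unfolding A_fps_def poly_A by (simp only: prod_fps_const fps_const_sub flip: fps_of_nat)

lemma g_fps_const: "g_fps N (fps_const x) (fps_const t) = fps_const (g_part N x t)"
proof -
  have "fps_const (1 / fact (n + 2)) * A_fps n (fps_const x) * fps_const t ^ n
      = fps_const (g_term n x t)" for n
    by (simp add: A_fps_const g_term_def fps_const_power del: fact_Suc add_2_eq_Suc')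
  then show ?thesis
    unfolding g_fps_def g_part_def by (simp only: sum_fps_const)
qed

lemma g_part_tendsto:
  assumes "pabs x \<le> 1" "pabs t < \<rho>"
  shows "(\<lambda>N. g_part N x t) \<longlonglongrightarrow> g x (1 + t)"
  using g_sums[OF assms] by (simp add: sums_def g_part_def)

lemma gauss_le_minus_of_nat:
  assumes "0 < r" "gauss_le r 1 U"
  shows "gauss_le r 1 (U - of_nat k)"
  using assms by (intro gauss_le_diff gauss_le_of_nat) auto

lemma gauss_le_A_fps_1:
  assumes "0 < r" "gauss_le r 1 U"
  shows "gauss_le r 1 (A_fps n U)"
  unfolding A_fps_def by (intro gauss_le_prod_1 gauss_le_minus_of_nat assms)

lemma gauss_le_A_fps_diff:
  assumes "0 < r" "gauss_le r 1 U" "gauss_le r 1 U'" "gauss_le r D (U - U')"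
  shows "gauss_le r D (A_fps n U - A_fps n U')"
  unfolding A_fps_def using assms gauss_le_nonneg[OF assms(4)]
  by (intro gauss_le_prod_diff gauss_le_minus_of_nat) auto

lemma gauss_le_if_close:
  assumes "0 < r" "gauss_le r (\<delta> * B) (f - fps_const c)" "\<delta> \<le> 1" "pabs c \<le> B"
  shows "gauss_le r B f"
proof -
  have "0 \<le> B"
    using assms(4) pabs_nonneg[of c] by linarith
  then have "gauss_le r B (f - fps_const c)"
    using assms(3) by (intro gauss_le_mono[OF assms(2)]) (use mult_right_mono[of \<delta> 1 B] in simp)
  from gauss_le_add[OF _ this, of "fps_const c"] show ?thesis
    using assms(1,4) by (simp add: gauss_le_const_iff)
qed

lemma gauss_le_mult_diff:
  assumes "0 < r" "gauss_le r a f" "gauss_le r b h'"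
    "gauss_le r (\<delta> * a) (f - f')" "gauss_le r (\<delta> * b) (h - h')"
  shows "gauss_le r (\<delta> * (a * b)) (f * h - f' * h')"
proof -
  have "f * h - f' * h' = f * (h - h') + (f - f') * h'"
    by (simp add: algebra_simps)
  moreover have "gauss_le r (\<delta> * (a * b)) (f * (h - h'))"
    using gauss_le_mult[OF assms(1,2,5)] by (simp add: mult_ac)
  moreover have "gauss_le r (\<delta> * (a * b)) ((f - f') * h')"
    using gauss_le_mult[OF assms(1,4,3)] by (simp add: mult_ac)
  ultimately show ?thesis
    using assms(1) by (simp add: gauss_le_add)
qed

lemma gauss_le_power_diff:
  assumes "0 < r" "0 \<le> \<delta>" "gauss_le r a f" "gauss_le r a f'" "gauss_le r (\<delta> * a) (f - f')"
  shows "gauss_le r (\<delta> * a ^ n) (f ^ n - f' ^ n)"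
proof (induction n)
  case (Suc n)
  show ?case
    using gauss_le_mult_diff[OF assms(1,3) gauss_le_power[OF assms(1,4)] assms(5) Suc.IH] by simp
qed (use assms(2) in simp)

lemma gauss_le_A_fps_near:
  assumes "0 < r" "pabs x \<le> 1" "\<delta> \<le> 1" "gauss_le r (\<delta> * Q_radius p x) (U - fps_const x)"
  shows "gauss_le r 1 (A_fps n U)"
    "gauss_le r (\<delta> * Q_radius p x) (A_fps n U - fps_const (poly (A n) x))"
proof -
  have "\<delta> * Q_radius p x \<le> 1 * 1"
    using assms(2,3) Q_radius_le_1[OF assms(2)] by (intro mult_mono) (auto simp: Q_radius_def)
  then have "gauss_le r 1 (U - fps_const x)"
    by (intro gauss_le_mono[OF assms(4)]) simp
  then have U: "gauss_le r 1 U"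
    using gauss_le_if_close[OF assms(1), of 1 1 U x] assms(2) by simp
  show "gauss_le r (\<delta> * Q_radius p x) (A_fps n U - fps_const (poly (A n) x))"
    using gauss_le_A_fps_diff[OF assms(1) U _ assms(4), of n] assms(2)
    by (simp add: A_fps_const gauss_le_const_iff)
  show "gauss_le r 1 (A_fps n U)"
    by (rule gauss_le_A_fps_1[OF assms(1) U])
qed

lemma gauss_le_A_fps_radius:
  assumes "0 < r" "pabs x \<le> 1" "\<delta> \<le> 1" "gauss_le r (\<delta> * Q_radius p x) (U - fps_const x)" "p - 2 \<le> n"
  shows "gauss_le r (Q_radius p x) (A_fps n U)"
  by (rule gauss_le_if_close[OF assms(1) gauss_le_A_fps_near(2)[OF assms(1-4)] assms(3)
        pabs_poly_A_le_radius[OF assms(2,5)]])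

lemma pabs_coeff_bounds:
  assumes "critical x t"
  shows "pabs (1 / fact (p - 2 + j + 2) :: 'a) * Q_radius p x * pabs t ^ (p - 2 + j) \<le> (pabs t / \<rho>) ^ j"
    and "pabs (1 / fact (n + 2) :: 'a) * Q_radius p x * pabs t ^ n \<le> 1"
    and "n < p - 2 \<Longrightarrow> pabs (1 / fact (n + 2) :: 'a) = 1"
proof -
  note c = criticalD[OF assms]
  show *: "pabs (1 / fact (p - 2 + j + 2) :: 'a) * Q_radius p x * pabs t ^ (p - 2 + j) \<le> (pabs t / \<rho>) ^ j" for j
  proof -
    have "Q_radius p x * (pabs (1 / fact (p - 2 + j + 2) :: 'a) * pabs t ^ (p - 2 + j))
        \<le> Q_radius p x * (real p * pabs t ^ (p - 2) * (pabs t / \<rho>) ^ j)"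
      using c by (intro mult_left_mono inverse_fact_power_le) auto
    also have "\<dots> = (real p * Q_radius p x * pabs t ^ (p - 2)) * (pabs t / \<rho>) ^ j"
      by (simp only: mult_ac)
    finally have "Q_radius p x * (pabs (1 / fact (p - 2 + j + 2) :: 'a) * pabs t ^ (p - 2 + j)) \<le> (pabs t / \<rho>) ^ j"
      unfolding c(4) by (simp only: mult_1_left)
    then show ?thesis
      by (simp only: mult_ac)
  qed
  show small: "pabs (1 / fact (n + 2) :: 'a) = 1" if "n < p - 2" for n
    using pabs_fact_less_p[of "n + 2"] that by simp
  show "pabs (1 / fact (n + 2) :: 'a) * Q_radius p x * pabs t ^ n \<le> 1"
  proof (cases "n < p - 2")
    case True
    then show ?thesis
      using small[of n] Q_radius_le_1[OF c(2)] c by (simp add: mult_le_one power_le_one)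
  next
    case False
    then obtain j where "n = p - 2 + j"
      by (metis le_add_diff_inverse not_le)
    moreover have "(pabs t / \<rho>) ^ j \<le> 1"
      using c rho_pos by (intro power_le_one) auto
    ultimately show ?thesis
      using *[of j] by simp
  qed
qed

text \<open>
  The derivative of \<open>g\<close> in the second variable is dominated by the term of index \<open>p - 2\<close>, whose
  exponent is prime to \<open>p\<close>; so it is invertible, of absolute value \<open>1 / pabs t\<close>, and
  constant up to a factor close to \<open>1\<close>.
\<close>

lemma g_fps_increment:
  fixes x t0 :: 'a
  defines "s \<equiv> of_nat (p - 2) * (poly (A (p - 2)) x / fact p * t0 ^ (p - 3))"
  assumes crit: "critical x t0" and r: "0 < r" and \<delta>: "pabs t0 / \<rho> \<le> \<delta>" "\<delta> \<le> 1"
    and U: "gauss_le r (\<delta> * Q_radius p x) (U - fps_const x)"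
    and V: "gauss_le r (\<delta> * pabs t0) (V - fps_const t0)"
    and V': "gauss_le r (\<delta> * pabs t0) (V' - fps_const t0)"
    and D: "gauss_le r D (V - V')"
    and N: "p - 2 < N"
  shows "gauss_le r (\<delta> * D / pabs t0) (g_fps N U V - g_fps N U V' - fps_const s * (V - V'))"
    and "pabs s = 1 / pabs t0"
proof -
  note c = criticalD[OF crit]
  define \<tau> where "\<tau> = pabs t0"
  define \<alpha> where "\<alpha> = Q_radius p x"
  have \<delta>0: "0 \<le> \<delta>"
    using \<delta>(1) c rho_pos by (meson divide_nonneg_pos order_trans pabs_nonneg)
  have p2: "p - 2 = Suc (p - 3)"
    using c(1) by simp
  have pf: "p - 2 + 2 = p"
    using c(1) by simp
  have \<tau>: "0 < \<tau>" "\<tau> \<le> \<delta>"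
    using c \<delta> by (auto simp: \<tau>_def)
  have balance: "real p * \<alpha> * \<tau> ^ (p - 3) = 1 / \<tau>"
    using c(4) \<tau> unfolding p2 \<alpha>_def \<tau>_def by (simp add: field_simps)
  have pp: "pabs (of_nat (p - 2) :: 'a) = 1"
    using c(1) by (intro pabs_of_nat_less_p) auto
  show "pabs s = 1 / pabs t0"
    unfolding s_def pabs_mult pp using balance
    by (simp add: pabs_fact_p \<alpha>_def \<tau>_def Q_radius_def mult_ac)
  have gV: "gauss_le r \<tau> V" and gV': "gauss_le r \<tau> V'"
    using gauss_le_if_close[OF r V \<delta>(2)] gauss_le_if_close[OF r V' \<delta>(2)] by (auto simp: \<tau>_def)
  \<comment> \<open>\<open>H n\<close> is the cofactor of \<open>V - V'\<close> in the difference of the \<open>n\<close>-th powers, and \<open>E n\<close> the error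
    made by keeping only the limit \<open>s\<close> of the cofactor for \<open>n = p - 2\<close>.\<close>
  define H where "H n = (\<Sum>i<n. V' ^ (n - Suc i) * V ^ i)" for n
  define E where "E n = fps_const (1 / fact (n + 2)) * A_fps n U * H n -
      (if n = p - 2 then fps_const s else 0)" for n
  have H: "gauss_le r (\<tau> ^ (n - 1)) (H n)" for n
    unfolding H_def
  proof (rule gauss_le_sum)
    fix i assume "i \<in> {..<n}"
    then have "\<tau> ^ (n - 1) = \<tau> ^ (n - Suc i) * \<tau> ^ i"
      by (simp flip: power_add)
    then show "gauss_le r (\<tau> ^ (n - 1)) (V' ^ (n - Suc i) * V ^ i)"
      using gauss_le_mult[OF r gauss_le_power[OF r gV'] gauss_le_power[OF r gV]] by simp
  qed (use r \<tau> in auto)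
  have Hp: "gauss_le r (\<delta> * \<tau> ^ (p - 3)) (H (p - 2) - fps_const (of_nat (p - 2) * t0 ^ (p - 3)))"
  proof -
    have "H (p - 2) - fps_const (of_nat (p - 2) * t0 ^ (p - 3))
        = (\<Sum>i<p - 2. V' ^ (p - 2 - Suc i) * V ^ i - fps_const t0 ^ (p - 2 - Suc i) * fps_const t0 ^ i)"
    proof -
      have "fps_const t0 ^ (p - 2 - Suc i) * fps_const t0 ^ i = fps_const (t0 ^ (p - 3))"
        if "i < p - 2" for i
      proof -
        have "p - 2 - Suc i + i = p - 3"
          using that by simp
        then show ?thesis
          by (metis fps_const_power power_add)
      qed
      then have "(\<Sum>i<p - 2. fps_const t0 ^ (p - 2 - Suc i) * fps_const t0 ^ i)
          = (\<Sum>i<p - 2. fps_const (t0 ^ (p - 3)))"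
        by (intro sum.cong) auto
      then have "(\<Sum>i<p - 2. fps_const t0 ^ (p - 2 - Suc i) * fps_const t0 ^ i)
          = fps_const (of_nat (p - 2) * t0 ^ (p - 3))"
        by (simp only: sum_fps_const) simp
      then show ?thesis
        by (simp add: H_def sum_subtractf)
    qed
    also have "gauss_le r (\<delta> * \<tau> ^ (p - 3)) \<dots>"
    proof (rule gauss_le_sum)
      fix i assume "i \<in> {..<p - 2}"
      then have *: "\<tau> ^ (p - 3) = \<tau> ^ (p - 2 - Suc i) * \<tau> ^ i"
        by (simp flip: power_add)
      have t0: "gauss_le r \<tau> (fps_const t0)"
        by (simp add: gauss_le_const_iff \<tau>_def)
      show "gauss_le r (\<delta> * \<tau> ^ (p - 3))
          (V' ^ (p - 2 - Suc i) * V ^ i - fps_const t0 ^ (p - 2 - Suc i) * fps_const t0 ^ i)"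
        unfolding * using V V' t0 gV gV' r \<delta>0
        by (intro gauss_le_mult_diff gauss_le_power_diff gauss_le_power) (auto simp: \<tau>_def)
    qed (use r \<tau> \<delta>0 in auto)
    finally show ?thesis .
  qed
  have E: "gauss_le r (\<delta> / \<tau>) (E n)" for n
  proof (cases n "p - 2" rule: linorder_cases)
    case less
    show ?thesis
    proof (cases n)
      case 0
      then show ?thesis
        using less \<delta>0 \<tau> by (simp add: E_def H_def)
    next
      case (Suc m)
      have "gauss_le r (1 * 1 * \<tau> ^ (n - 1)) (fps_const (1 / fact (n + 2)) * A_fps n U * H n)"
        using pabs_coeff_bounds(3)[OF crit less] gauss_le_A_fps_near(1)[OF r c(2) \<delta>(2) U]
        by (intro gauss_le_mult r H) (simp_all add: gauss_le_const_iff del: fact_Suc add_2_eq_Suc')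
      moreover have "\<tau> ^ (n - 1) \<le> \<delta> / \<tau>"
      proof -
        have "\<tau> ^ n \<le> \<tau> ^ 1"
          using Suc \<tau> c by (intro power_decreasing) (auto simp: \<tau>_def)
        then have "\<tau> ^ n \<le> \<delta>"
          using \<tau> by simp
        then show ?thesis
          using \<tau> Suc by (simp add: pos_le_divide_eq mult.commute del: mult_le_cancel_left2 mult_le_cancel_left_pos)
      qed
      ultimately show ?thesis
        using less gauss_le_mono by (simp add: E_def)
    qed
  next
    case equal
    have "gauss_le r (\<delta> * (\<alpha> * \<tau> ^ (p - 3)))
        (A_fps (p - 2) U * H (p - 2) - fps_const (poly (A (p - 2)) x) * fps_const (of_nat (p - 2) * t0 ^ (p - 3)))"
      using gauss_le_A_fps_radius[OF r c(2) \<delta>(2) U le_refl] gauss_le_A_fps_near(2)[OF r c(2) \<delta>(2) U] Hp pp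
      by (intro gauss_le_mult_diff r) (auto simp: \<alpha>_def \<tau>_def gauss_le_const_iff pabs_mult)
    from gauss_le_const_mult[OF r this, of "1 / fact p"]
    have "gauss_le r (real p * (\<delta> * (\<alpha> * \<tau> ^ (p - 3))))
        (fps_const (1 / fact p) * (A_fps (p - 2) U * H (p - 2) -
          fps_const (poly (A (p - 2)) x) * fps_const (of_nat (p - 2) * t0 ^ (p - 3))))"
      by (simp add: pabs_fact_p)
    moreover have "real p * (\<delta> * (\<alpha> * \<tau> ^ (p - 3))) = \<delta> / \<tau>"
      using balance by (metis (no_types, lifting) mult.left_commute mult.assoc times_divide_eq_right mult.right_neutral)
    moreover have "fps_const (1 / fact p) * (A_fps (p - 2) U * H (p - 2) -
          fps_const (poly (A (p - 2)) x) * fps_const (of_nat (p - 2) * t0 ^ (p - 3))) = E n"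
    proof -
      have "fps_const (1 / fact p) * (fps_const (poly (A (p - 2)) x) * fps_const (of_nat (p - 2) * t0 ^ (p - 3)))
          = fps_const s"
        by (simp add: s_def mult_ac)
      then show ?thesis
        by (simp add: E_def equal pf right_diff_distrib mult.assoc del: add_2_eq_Suc')
    qed
    ultimately show ?thesis
      by simp
  next
    case greater
    then obtain j where j: "n = p - 2 + Suc j"
      using less_imp_Suc_add[OF greater] by auto
    have "gauss_le r (pabs (1 / fact (n + 2) :: 'a) * \<alpha> * \<tau> ^ (n - 1))
        (fps_const (1 / fact (n + 2)) * A_fps n U * H n)"
      using gauss_le_A_fps_radius[OF r c(2) \<delta>(2) U, of n] greater
      by (intro gauss_le_mult r H) (auto simp: gauss_le_const_iff \<alpha>_def)
    moreover have "pabs (1 / fact (n + 2) :: 'a) * \<alpha> * \<tau> ^ (n - 1) \<le> \<delta> / \<tau>"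
    proof -
      have "\<tau> ^ n = \<tau> ^ (n - 1) * \<tau>"
        using j by simp
      then have "pabs (1 / fact (n + 2) :: 'a) * \<alpha> * \<tau> ^ (n - 1) * \<tau> \<le> (\<tau> / \<rho>) ^ Suc j"
        using pabs_coeff_bounds(1)[OF crit, of "Suc j"]
        unfolding j[symmetric] \<alpha>_def[symmetric] \<tau>_def[symmetric] by (simp only: mult.assoc)
      also have "\<dots> \<le> (\<tau> / \<rho>) ^ 1"
        using c rho_pos by (intro power_decreasing) (auto simp: \<tau>_def)
      finally show ?thesis
        using \<delta>(1) \<tau> by (simp add: pos_le_divide_eq \<tau>_def)
    qed
    ultimately show ?thesis
      using greater gauss_le_mono by (simp add: E_def)
  qed
  have "g_fps N U V - g_fps N U V' = (\<Sum>n<N. fps_const (1 / fact (n + 2)) * A_fps n U * (V ^ n - V' ^ n))"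
    unfolding g_fps_def by (simp only: sum_subtractf right_diff_distrib)
  also have "\<dots> = (\<Sum>n<N. (V - V') * (fps_const (1 / fact (n + 2)) * A_fps n U * H n))"
    unfolding H_def power_diff_sumr2 by (simp only: mult_ac)
  also have "\<dots> - fps_const s * (V - V') = (V - V') * (\<Sum>n<N. E n)"
  proof -
    have "(\<Sum>n<N. if n = p - 2 then fps_const s else 0) = fps_const s"
      using N by simp
    then show ?thesis
      by (simp only: E_def sum_subtractf right_diff_distrib sum_distrib_left[symmetric])
        (simp add: algebra_simps)
  qed
  finally have "g_fps N U V - g_fps N U V' - fps_const s * (V - V') = (V - V') * (\<Sum>n<N. E n)" .
  moreover have "gauss_le r (D * (\<delta> / \<tau>)) ((V - V') * (\<Sum>n<N. E n))"
    using r \<delta>0 \<tau> by (intro gauss_le_mult D gauss_le_sum E) auto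
  ultimately show "gauss_le r (\<delta> * D / pabs t0) (g_fps N U V - g_fps N U V' - fps_const s * (V - V'))"
    by (simp add: \<tau>_def mult_ac)
qed

text \<open>
  The linear term governs the increments of \<open>g\<close> for displacements shorter than \<open>pabs t\<close>. In
  particular, distinct zeros for the same \<open>x\<close> are at least \<open>pabs t\<close> apart.
\<close>

lemma pabs_g_diff:
  assumes crit: "critical x t" and close: "pabs (t' - t) < pabs t"
  shows "pabs (g x (1 + t') - g x (1 + t)) = pabs (t' - t) / pabs t"
proof -
  note c = criticalD[OF crit]
  define \<delta> where "\<delta> = max (pabs t / \<rho>) (pabs (t' - t) / pabs t)"
  define s where "s = of_nat (p - 2) * (poly (A (p - 2)) x / fact p * t ^ (p - 3))"
  have \<delta>: "pabs t / \<rho> \<le> \<delta>" "\<delta> < 1" "pabs (t' - t) \<le> \<delta> * pabs t" "0 \<le> \<delta>"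
    using c close rho_pos by (auto simp: \<delta>_def simp flip: pos_divide_le_eq intro: le_max_iff_disj[THEN iffD2])
  have t': "pabs t' = pabs t"
    using pabs_eq_if_close[OF close] .
  have part: "pabs (g_part N x t' - g_part N x t - s * (t' - t)) \<le> \<delta> * pabs (t' - t) / pabs t"
    and s: "pabs s = 1 / pabs t" if "p - 2 < N" for N
    using g_fps_increment[OF crit zero_less_one \<delta>(1) _ _ _ _ _ that, of "fps_const x" "fps_const t'" "fps_const t"
        "pabs (t' - t)"] \<delta> c
    by (simp_all add: gauss_le_const_iff g_fps_const s_def)
  have "(\<lambda>N. g_part N x t' - g_part N x t - s * (t' - t)) \<longlonglongrightarrow> g x (1 + t') - g x (1 + t) - s * (t' - t)"
    using c t' by (intro padic_tendsto_diff g_part_tendsto tendsto_const) auto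
  then have *: "pabs (g x (1 + t') - g x (1 + t) - s * (t' - t)) \<le> \<delta> * pabs (t' - t) / pabs t"
    by (rule pabs_limit_le[of _ _ "p - 1"]) (use part c(1) in auto)
  show ?thesis
  proof (cases "t' = t")
    case False
    have "\<delta> * pabs (t' - t) < 1 * pabs (t' - t)"
      using \<delta> False by (intro mult_strict_right_mono) auto
    then have "\<delta> * pabs (t' - t) / pabs t < pabs (t' - t) / pabs t"
      using c by (simp add: divide_strict_right_mono)
    also have "\<dots> = pabs (s * (t' - t))"
      using s[of "p - 1"] c(1) by (simp add: pabs_mult)
    finally have "pabs (g x (1 + t') - g x (1 + t)) = pabs (s * (t' - t))"
      using * by (intro pabs_eq_if_close) simp
    then show ?thesis
      using s[of "p - 1"] c(1) by (simp add: pabs_mult)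
  qed simp
qed

lemma zero_unique:
  assumes "critical x t" "g x (1 + t) = 0" "g x (1 + t') = 0" "pabs (t' - t) < pabs t"
  shows "t' = t"
  using pabs_g_diff[OF assms(1,4)] assms(2,3) criticalD(7)[OF assms(1)] by simp

subsection \<open>Solving for the second variable\<close>

lemma gauss_le_diff_trans:
  assumes "0 < r" "gauss_le r B (f - h)" "gauss_le r B (h - k)"
  shows "gauss_le r B (f - k)"
  using gauss_le_add[OF less_imp_le[OF assms(1)] assms(2,3)] by simp

text \<open>
  Newton's iteration, with the derivative kept at its initial value, over the power series that
  converge for \<open>pabs y < r\<close>. The \<open>k\<close>-th step uses a partial sum of \<open>g\<close> whose length grows with
  \<open>k\<close>, so that only polynomial expressions in power series occur.
\<close>

lemma implicit_function:
  assumes crit: "critical x t0" and start: "pabs (g x (1 + t0)) < 1"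
    and r: "0 < r" "r < Q_radius p x"
  obtains W where "gauss_le r (pabs t0) W"
    "\<And>y::'a. pabs y < r \<Longrightarrow> pabs (fps_value W y - t0) < pabs t0"
    "\<And>y::'a. pabs y < r \<Longrightarrow> g (x + y) (1 + fps_value W y) = 0"
proof -
  note c = criticalD[OF crit]
  define \<tau> where "\<tau> = pabs t0"
  define \<alpha> where "\<alpha> = Q_radius p x"
  \<comment> \<open>The factor gained by each step bounds the initial error, the ratio of convergence of \<open>g\<close> and
    the relative size of the ball.\<close>
  define \<delta> where "\<delta> = max (max (pabs (g x (1 + t0))) (\<tau> / \<rho>)) (r / \<alpha>)"
  define s where "s = of_nat (p - 2) * (poly (A (p - 2)) x / fact p * t0 ^ (p - 3))"
  define U where "U = fps_const x + fps_X"
  have \<alpha>: "0 < \<alpha>" "\<alpha> \<le> 1" and \<tau>: "0 < \<tau>"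
    using c Q_radius_le_1 by (auto simp: \<alpha>_def \<tau>_def)
  have \<delta>: "\<delta> < 1" "pabs (g x (1 + t0)) \<le> \<delta>" "\<tau> / \<rho> \<le> \<delta>" "r / \<alpha> \<le> \<delta>" "0 < \<delta>"
    using c start r \<alpha> by (auto simp: \<delta>_def \<alpha>_def \<tau>_def less_max_iff_disj)
  have U: "gauss_le r (\<delta> * \<alpha>) (U - fps_const x)"
    using r \<delta>(4) \<alpha> by (simp add: U_def gauss_le_X pos_divide_le_eq)
  note near = gauss_le_A_fps_near[OF r(1) c(2) less_imp_le[OF \<delta>(1)] U[unfolded \<alpha>_def]]
  note radius = gauss_le_A_fps_radius[OF r(1) c(2) less_imp_le[OF \<delta>(1)] U[unfolded \<alpha>_def]]
  note increment = g_fps_increment[OF crit r(1) \<delta>(3)[unfolded \<tau>_def] less_imp_le[OF \<delta>(1)]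
      U[unfolded \<alpha>_def], folded \<tau>_def s_def]
  have s: "pabs s = 1 / \<tau>"
  proof -
    have "gauss_le r (\<delta> * \<tau>) (fps_const t0 - fps_const t0)" "gauss_le r 0 (fps_const t0 - fps_const t0)"
      using \<delta> \<tau> by simp_all
    from increment(2)[OF this(1,1,2)] show ?thesis
      using c(1) by (meson lessI)
  qed
  have s0: "s \<noteq> 0"
    using s \<tau> by auto
  have nonneg: "0 \<le> \<delta> ^ k" for k
    using \<delta> by simp
  \<comment> \<open>Length \<open>p\<close> instead of \<open>p - 1\<close> at the start gives the bound for the next term its second extra
    factor \<open>\<delta>\<close>.\<close>
  define F where "F k = g_fps (p + k) U" for k
  \<comment> \<open>Passing to the next partial sum changes the value by less than the error of the next step.\<close>
  have next_term: "gauss_le r (\<delta> ^ (k + 2)) (F (Suc k) V - F k V)"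
    if V: "gauss_le r (\<delta> * \<tau>) (V - fps_const t0)" for V k
  proof -
    have pk: "p + k = p - 2 + (k + 2)"
      using c(1) by simp
    have gV: "gauss_le r \<tau> V"
      using gauss_le_if_close[OF r(1) V] \<delta> by (simp add: \<tau>_def)
    have "F (Suc k) V - F k V = fps_const (1 / fact (p + k + 2)) * A_fps (p + k) U * V ^ (p + k)"
      by (simp add: F_def g_fps_def del: fact_Suc add_2_eq_Suc')
    moreover have "gauss_le r (pabs (1 / fact (p + k + 2) :: 'a) * \<alpha> * \<tau> ^ (p + k))
        (fps_const (1 / fact (p + k + 2)) * A_fps (p + k) U * V ^ (p + k))"
      unfolding \<alpha>_def
      by (intro gauss_le_mult r gauss_le_power gV radius) (auto simp: gauss_le_const_iff)
    moreover have "pabs (1 / fact (p + k + 2) :: 'a) * \<alpha> * \<tau> ^ (p + k) \<le> (\<tau> / \<rho>) ^ (k + 2)"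
      unfolding pk \<alpha>_def \<tau>_def by (rule pabs_coeff_bounds(1)[OF crit])
    moreover have "(\<tau> / \<rho>) ^ (k + 2) \<le> \<delta> ^ (k + 2)"
      using \<delta> \<tau> rho_pos by (intro power_mono) auto
    ultimately show ?thesis
      by (metis gauss_le_mono order_trans)
  qed
  define W where "W = rec_nat (fps_const t0) (\<lambda>k V. V - fps_const (1 / s) * F k V)"
  have W_0: "W 0 = fps_const t0" and W_Suc: "W (Suc k) = W k - fps_const (1 / s) * F k (W k)" for k
    by (simp_all add: W_def)
  have start_fps: "gauss_le r \<delta> (F 0 (fps_const t0))"
  proof -
    have "gauss_le r \<delta> (F 0 (fps_const t0) - g_fps p (fps_const x) (fps_const t0))"
    proof -
      have "gauss_le r \<delta> (fps_const (1 / fact (n + 2)) * (A_fps n U - fps_const (poly (A n) x)) * fps_const t0 ^ n)" for n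
      proof (rule gauss_le_mono)
        show "gauss_le r (pabs (1 / fact (n + 2) :: 'a) * (\<delta> * \<alpha>) * \<tau> ^ n)
          (fps_const (1 / fact (n + 2)) * (A_fps n U - fps_const (poly (A n) x)) * fps_const t0 ^ n)"
          unfolding \<alpha>_def \<tau>_def
          by (intro gauss_le_mult r gauss_le_power near) (auto simp: gauss_le_const_iff)
        have "\<delta> * (pabs (1 / fact (n + 2) :: 'a) * \<alpha> * \<tau> ^ n) \<le> \<delta> * 1"
          unfolding \<alpha>_def \<tau>_def using \<delta> by (intro mult_left_mono pabs_coeff_bounds(2)[OF crit]) auto
        then show "pabs (1 / fact (n + 2) :: 'a) * (\<delta> * \<alpha>) * \<tau> ^ n \<le> \<delta>"
          by (simp only: mult_ac mult_1_right)
      qed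
      then have "gauss_le r \<delta> (\<Sum>n<p. fps_const (1 / fact (n + 2)) * (A_fps n U - fps_const (poly (A n) x)) * fps_const t0 ^ n)"
        using r \<delta> by (intro gauss_le_sum) auto
      then show ?thesis
        by (simp only: F_def g_fps_def A_fps_const right_diff_distrib left_diff_distrib sum_subtractf add_0_right)
    qed
    moreover have "pabs (g_part p x t0) \<le> \<delta>"
    proof -
      have tail: "(\<lambda>n. g_term (n + p) x t0) sums (g x (1 + t0) - g_part p x t0)"
        using padic_sums_shift[OF g_sums[OF c(2,3)], of p] by (simp add: g_part_def)
      have "pabs (g_term (n + p) x t0) \<le> \<delta>" for n
      proof -
        have "n + p \<noteq> 0" "n + p \<noteq> p - 2"
          using c(1) by auto
        from g_term_le_ratio[OF crit this] show ?thesis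
          using \<delta>(3) by (simp add: \<tau>_def)
      qed
      from padic_sums_le[OF tail this] have "pabs (g x (1 + t0) - g_part p x t0) \<le> \<delta>" .
      from pabs_diff_le[OF \<delta>(2) this] show ?thesis
        by simp
    qed
    ultimately show ?thesis
      using gauss_le_add[of r \<delta> "F 0 (fps_const t0) - g_fps p (fps_const x) (fps_const t0)" "fps_const (g_part p x t0)"] r
      by (simp add: g_fps_const gauss_le_const_iff)
  qed
  have iter: "gauss_le r (\<delta> * \<tau>) (W k - fps_const t0) \<and> gauss_le r (\<delta> ^ Suc k) (F k (W k))" for k
  proof (induction k)
    case 0
    show ?case
      using start_fps \<delta> \<tau> by (simp add: W_0)
  next
    case (Suc k)
    then have near_k: "gauss_le r (\<delta> * \<tau>) (W k - fps_const t0)" and Fk: "gauss_le r (\<delta> ^ Suc k) (F k (W k))"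
      by auto
    have step: "gauss_le r (\<tau> * \<delta> ^ Suc k) (W (Suc k) - W k)"
      using gauss_le_const_mult[OF r(1) Fk, of "1 / s"] s by (simp add: W_Suc gauss_le_minus)
    have "\<delta> ^ Suc k \<le> \<delta> ^ 1"
      using \<delta> by (intro power_decreasing) auto
    then have "gauss_le r (\<delta> * \<tau>) (W (Suc k) - W k)"
      using \<tau> by (intro gauss_le_mono[OF step]) (simp add: mult.commute)
    from gauss_le_diff_trans[OF r(1) this near_k]
    have near_Suc: "gauss_le r (\<delta> * \<tau>) (W (Suc k) - fps_const t0)" .
    have "gauss_le r (\<delta> * (\<tau> * \<delta> ^ Suc k) / \<tau>) (F k (W (Suc k)) - F k (W k) - fps_const s * (W (Suc k) - W k))"
      unfolding F_def using c(1) by (intro increment(1) near_Suc near_k step) simp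
    moreover have "fps_const s * (W (Suc k) - W k) = - F k (W k)"
      using s0 by (simp add: W_Suc flip: mult.assoc)
    ultimately have "gauss_le r (\<delta> ^ Suc (Suc k)) (F k (W (Suc k)))"
      using \<tau> by simp
    moreover have "gauss_le r (\<delta> ^ Suc (Suc k)) (F (Suc k) (W (Suc k)) - F k (W (Suc k)))"
      using next_term[OF near_Suc, of k] by (simp only: add_2_eq_Suc')
    ultimately have "gauss_le r (\<delta> ^ Suc (Suc k)) (F (Suc k) (W (Suc k)) - F k (W (Suc k)) + F k (W (Suc k)))"
      by (intro gauss_le_add less_imp_le[OF r(1)])
    then have "gauss_le r (\<delta> ^ Suc (Suc k)) (F (Suc k) (W (Suc k)))"
      by (simp only: diff_add_cancel)
    then show ?case
      using near_Suc by blast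
  qed
  have "gauss_le r (\<tau> * \<delta> * \<delta> ^ k) (W (Suc k) - W k)" for k
    using gauss_le_const_mult[OF r(1) iter[THEN conjunct2], of "1 / s" k] s
    by (simp add: W_Suc gauss_le_minus mult_ac)
  from gauss_geometric_limit[OF r(1) less_imp_le[OF \<delta>(5)] \<delta>(1) this]
  obtain V where V: "\<And>k. gauss_le r (\<tau> * \<delta> * \<delta> ^ k) (V - W k)"
    by blast
  have V0: "gauss_le r (\<delta> * \<tau>) (V - fps_const t0)"
    using V[of 0] by (simp add: W_0 mult_ac)
  have gV: "gauss_le r \<tau> V"
    using gauss_le_if_close[OF r(1) V0] \<delta> by (simp add: \<tau>_def)
  have FV: "gauss_le r (\<delta> * \<delta> ^ k) (F k V)" for k
  proof -
    have D: "gauss_le r (\<tau> * (\<delta> * \<delta> ^ k)) (V - W k)"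
      using V[of k] by (simp add: mult_ac)
    have "gauss_le r (\<delta> * (\<tau> * (\<delta> * \<delta> ^ k)) / \<tau>) (F k V - F k (W k) - fps_const s * (V - W k))"
      unfolding F_def using c(1) by (intro increment(1) V0 iter[THEN conjunct1] D) simp
    then have "gauss_le r (\<delta> * \<delta> ^ k) (F k V - F k (W k) - fps_const s * (V - W k))"
      using \<tau> \<delta> nonneg by (elim gauss_le_mono) (simp add: mult_left_le_one_le)
    moreover have "gauss_le r (\<delta> * \<delta> ^ k) (fps_const s * (V - W k))"
      using gauss_le_const_mult[OF r(1) D, of s] s \<tau> by simp
    moreover have "gauss_le r (\<delta> * \<delta> ^ k) (F k (W k))"
      using iter[THEN conjunct2, of k] by (simp only: power_Suc)
    ultimately have "gauss_le r (\<delta> * \<delta> ^ k)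
        ((F k V - F k (W k) - fps_const s * (V - W k)) + fps_const s * (V - W k) + F k (W k))"
      by (intro gauss_le_add less_imp_le[OF r(1)])
    then show ?thesis
      by simp
  qed
  show ?thesis
  proof
    show "gauss_le r (pabs t0) V"
      using gV by (simp add: \<tau>_def)
    fix y :: 'a assume y: "pabs y < r"
    have "fps_value (V - fps_const t0) y = fps_value V y - t0"
      using fps_value_diff[OF r(1) gV _ y, of \<tau> "fps_const t0"] by (simp add: gauss_le_const_iff \<tau>_def)
    then have "pabs (fps_value V y - t0) \<le> \<delta> * \<tau>"
      using fps_value_le[OF r(1) V0 y] by simp
    also have "\<dots> < 1 * \<tau>"
      using \<delta>(1) \<tau> by (intro mult_strict_right_mono) auto
    finally show "pabs (fps_value V y - t0) < pabs t0"
      by (simp add: \<tau>_def)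
    have gU: "gauss_le r 1 U"
      using gauss_le_if_close[OF r(1), of 1 1 U x] gauss_le_mono[OF U, of 1] \<delta> \<alpha> c(2) r
      by (simp add: mult_le_one)
    have U_y: "fps_value (U - of_nat n) y = x + y - of_nat n" for n
    proof -
      have "fps_value (U - fps_const (of_nat n)) y = fps_value U y - of_nat n"
        using fps_value_diff[OF r(1) gU _ y, of 1 "fps_const (of_nat n)"] pabs_of_nat_le_1[of n]
        by (simp add: gauss_le_const_iff)
      moreover have "fps_value U y = x + y"
        using fps_value_add[OF r(1) _ _ y, of "pabs x" "fps_const x" r fps_X] r
        by (simp add: U_def gauss_le_const_iff gauss_le_X)
      ultimately show ?thesis
        by (simp add: fps_of_nat)
    qed
    have "fps_value (fps_const (1 / fact (n + 2)) * A_fps n U * V ^ n) y = g_term n (x + y) (fps_value V y)" for n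
    proof -
      have AU: "gauss_le r 1 (A_fps n U)"
        by (rule gauss_le_A_fps_1[OF r(1) gU])
      have "fps_value (A_fps n U) y = poly (A n) (x + y)"
        unfolding A_fps_def poly_A
        by (subst fps_value_prod[OF r(1) gauss_le_minus_of_nat[OF r(1) gU] y]) (simp only: U_y)
      then show ?thesis
        using fps_value_mult[OF r(1) gauss_le_const_mult[OF r(1) AU] gauss_le_power[OF r(1) gV] y]
          fps_value_const_mult[OF r(1) AU y] fps_value_power[OF r(1) gV y]
        by (simp add: g_term_def del: fact_Suc add_2_eq_Suc')
    qed
    moreover have "\<exists>B. gauss_le r B (fps_const (1 / fact (n + 2)) * A_fps n U * V ^ n)" for n
      using gauss_le_mult[OF r(1) gauss_le_const_mult[OF r(1) gauss_le_A_fps_1[OF r(1) gU]] gauss_le_power[OF r(1) gV]]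
      by blast
    then obtain B where B: "\<And>n. gauss_le r (B n) (fps_const (1 / fact (n + 2)) * A_fps n U * V ^ n)"
      by metis
    ultimately have F_y: "fps_value (F k V) y = g_part (p + k) (x + y) (fps_value V y)" for k
      unfolding F_def g_fps_def g_part_def by (subst fps_value_sum[OF r(1) B y]) auto
    have "pabs (fps_value V y) \<le> \<tau>"
      by (rule fps_value_le[OF r(1) gV y])
    moreover have "pabs (x + y) \<le> 1"
      using c(2) y r \<alpha> by (intro pabs_add_le) (auto simp: \<alpha>_def)
    ultimately have "(\<lambda>k. g_part (p + k) (x + y) (fps_value V y)) \<longlonglongrightarrow> g (x + y) (1 + fps_value V y)"
      using LIMSEQ_ignore_initial_segment[OF g_part_tendsto, of "x + y" "fps_value V y" p] c(3)
      by (simp add: \<tau>_def add.commute)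
    moreover have "(\<lambda>k. g_part (p + k) (x + y) (fps_value V y)) \<longlonglongrightarrow> 0"
    proof (rule tendsto_0_geometric)
      show "pabs (g_part (p + k) (x + y) (fps_value V y)) \<le> \<delta> * \<delta> ^ k" for k
        using fps_value_le[OF r(1) FV y] F_y by simp
    qed (use \<delta> in auto)
    ultimately show "g (x + y) (1 + fps_value V y) = 0"
      by (rule LIMSEQ_unique)
  qed
qed

lemma solution_near:
  fixes y :: 'a
  assumes "critical x t" "pabs (g x (1 + t)) < 1" "pabs (y - x) < Q_radius p x"
  obtains s where "pabs (s - t) < pabs t" "g y (1 + s) = 0"
proof -
  obtain r where r: "pabs (y - x) < r" "r < Q_radius p x"
    using assms(3) dense by blast
  then have "0 < r"
    using pabs_nonneg[of "y - x"] by linarith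
  then obtain W where W: "\<And>z. pabs z < r \<Longrightarrow> pabs (fps_value W z - t) < pabs t"
    "\<And>z. pabs z < r \<Longrightarrow> g (x + z) (1 + fps_value W z) = 0"
    using implicit_function[OF assms(1,2) _ r(2)] by blast
  show ?thesis
  proof (rule that)
    show "pabs (fps_value W (y - x) - t) < pabs t"
      by (rule W(1)[OF r(1)])
    show "g y (1 + fps_value W (y - x)) = 0"
      using W(2)[OF r(1)] by simp
  qed
qed

lemma mem_ball_pabs: "z \<in> ball x r \<longleftrightarrow> pabs (z - x) < r" for x z :: 'a
  by (simp add: dist_eq_pabs pabs_minus_commute)

lemma ex1_solution:
  assumes "critical x t" "g x (1 + t) = 0" "pabs (y - x) < Q_radius p x"
  shows "\<exists>!q'. q' \<in> ball (1 + t) (pabs t) \<and> (y, q') \<in> M p"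
proof -
  obtain s where s: "pabs (s - t) < pabs t" "g y (1 + s) = 0"
    using solution_near[OF assms(1) _ assms(3)] assms(2) by auto
  have near: "critical y s'" if "pabs (s' - t) < pabs t" for s'
    using critical_near[OF assms(1,3)] pabs_eq_if_close[OF that] .
  show ?thesis
  proof (rule ex1I[of _ "1 + s"])
    show "1 + s \<in> ball (1 + t) (pabs t) \<and> (y, 1 + s) \<in> M p"
      using s near by (simp add: mem_ball_pabs M_iff del: mem_ball)
  next
    fix q' assume q': "q' \<in> ball (1 + t) (pabs t) \<and> (y, q') \<in> M p"
    define s' where "s' = q' - 1"
    have s': "q' = 1 + s'"
      by (simp add: s'_def)
    have close: "pabs (s' - t) < pabs t" and zero: "g y (1 + s') = 0"
      using q' by (simp_all add: s' mem_ball_pabs M_iff del: mem_ball)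
    have "pabs (s' - s) < pabs t"
      using pabs_diff_less[OF close s(1)] by simp
    then have "s' = s"
      using zero_unique[OF near[OF s(1)] s(2) zero] pabs_eq_if_close[OF s(1)] by simp
    then show "q' = 1 + s"
      by (simp add: s')
  qed
qed

subsection \<open>The zeros above a fixed point\<close>

text \<open>The polynomial \<open>X ^ n - 1\<close> is prime to its derivative, hence has \<open>n\<close> distinct roots.\<close>

lemma roots_of_unity:
  assumes "0 < n"
  obtains R :: "'a set" where "finite R" "card R = n" "\<And>z. z \<in> R \<Longrightarrow> z ^ n = 1"
    "\<And>z. z ^ n - 1 = (\<Prod>r\<in>R. z - r)"
proof -
  define P where "P = monom (1::'a) n - 1"
  have coeff_n: "coeff P n = 1"
    using assms by (simp add: P_def)
  have deg: "degree P = n"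
    using coeff_n by (intro antisym le_degree degree_le) (auto simp: P_def)
  then have lead: "lead_coeff P = 1"
    using coeff_n by simp
  have "P \<noteq> 0"
    using coeff_n by auto
  then obtain B where B: "size B = n" "P = (\<Prod>r\<in>#B. [:- r, 1:])"
    using alg_closed_imp_factorization[of P] lead deg by auto
  have poly_P: "poly P z = z ^ n - 1" for z
    by (simp add: P_def poly_monom)
  have root: "z ^ n = 1" if "z \<in># B" for z
  proof -
    have "poly P z = 0"
      using multi_member_split[OF that] by (auto simp: B(2))
    then show ?thesis
      by (simp add: poly_P)
  qed
  have "count B z \<le> 1" for z
  proof (rule ccontr)
    assume "\<not> count B z \<le> 1"
    then have "{#z, z#} \<subseteq># B"
      by (simp add: subseteq_mset_def)
    then obtain C where "B = {#z, z#} + C"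
      using mset_subset_eq_exists_conv by blast
    then have "P = [:- z, 1:] * ([:- z, 1:] * (\<Prod>r\<in>#C. [:- r, 1:]))" and "z \<in># B"
      by (simp_all add: B(2))
    then have "poly (pderiv P) z = 0"
      by (simp only: pderiv_mult poly_mult poly_add) simp
    moreover have "pderiv P = monom (of_nat n) (n - 1)"
      by (simp add: P_def pderiv_diff pderiv_monom)
    ultimately have "z = 0"
      using assms by (simp add: poly_monom)
    then show False
      using root[OF \<open>z \<in># B\<close>] assms by (simp add: zero_power)
  qed
  then have "count B z = count (mset_set (set_mset B)) z" for z
    using count_greater_zero_iff[of B z] by (cases "z \<in># B") (auto simp: count_eq_zero_iff le_Suc_eq)
  then have B_eq: "B = mset_set (set_mset B)"
    by (rule multiset_eqI)
  show ?thesis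
  proof (rule that[of "set_mset B"])
    show "card (set_mset B) = n"
      using B(1) B_eq by (metis size_mset_set)
    show "z ^ n - 1 = (\<Prod>r\<in>set_mset B. z - r)" for z
    proof -
      have "P = (\<Prod>r\<in>set_mset B. [:- r, 1:])"
        using B(2) B_eq by (metis prod_unfold_prod_mset)
      then show ?thesis
        unfolding poly_P[symmetric] by (simp add: poly_prod)
    qed
  qed (use root in auto)
qed

text \<open>
  Since \<open>n\<close> is prime to \<open>p\<close>, the \<open>n\<close>-th roots of unity have distinct residues: a root \<open>z\<close> close to
  \<open>1\<close> would make the vanishing sum \<open>1 + z + \<dots> + z ^ (n - 1)\<close> close to \<open>n\<close>.
\<close>

lemma pabs_root_of_unity:
  assumes "z ^ n = (1::'a)" "0 < n"
  shows "pabs z = 1"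
proof -
  have "pabs z ^ n = 1 ^ n"
    using assms(1) by (simp flip: pabs_power)
  then show ?thesis
    by (rule power_eq_imp_eq_base) (use assms(2) in auto)
qed

lemma roots_of_unity_distinct_residues:
  fixes z w :: 'a
  assumes "z ^ n = 1" "w ^ n = 1" "0 < n" "coprime n p" "z \<noteq> w"
  shows "1 \<le> pabs (z - w)"
proof (rule ccontr)
  assume "\<not> ?thesis"
  then have "pabs (z - w) < 1"
    by simp
  have w: "pabs w = 1" "w \<noteq> 0"
    using pabs_root_of_unity[OF assms(2,3)] by auto
  define e where "e = z / w"
  have "e - 1 = (z - w) / w"
    using w(2) by (simp add: e_def diff_divide_distrib)
  then have close: "pabs (e - 1) < 1"
    using \<open>pabs (z - w) < 1\<close> w(1) by simp
  have "e ^ n = 1" "e \<noteq> 1"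
    using assms w by (auto simp: e_def power_divide)
  then have "(e - 1) * (\<Sum>i<n. e ^ i) = 0"
    by (simp flip: power_diff_1_eq)
  then have sum0: "(\<Sum>i<n. e ^ i) = 0"
    using \<open>e \<noteq> 1\<close> by simp
  have "pabs e = 1"
    using pabs_root_of_unity[OF \<open>e ^ n = 1\<close> assms(3)] .
  have "pabs (e ^ i - 1) \<le> pabs (e - 1)" for i
  proof -
    have "e ^ i - 1 = (e - 1) * (\<Sum>k<i. e ^ k)"
      by (rule power_diff_1_eq)
    moreover have "pabs (\<Sum>k<i. e ^ k) \<le> 1"
      using \<open>pabs e = 1\<close> by (intro pabs_sum_le) auto
    ultimately show ?thesis
      by (simp add: pabs_mult mult_left_le)
  qed
  then have "pabs (\<Sum>i<n. e ^ i - 1) \<le> pabs (e - 1)"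
    by (intro pabs_sum_le) auto
  moreover have "(\<Sum>i<n. e ^ i - 1) = - of_nat n"
    using sum0 by (simp add: sum_subtractf)
  ultimately show False
    using close pabs_of_nat_coprime[OF assms(4)] by simp
qed

definition zeros_above :: "'a \<Rightarrow> 'a set" where
  "zeros_above x = {t. critical x t \<and> g x (1 + t) = 0}"

lemma phi1_fiber_eq: "phi1_fiber p x = (\<lambda>t. (x, 1 + t)) ` zeros_above x"
proof
  show "phi1_fiber p x \<subseteq> (\<lambda>t. (x, 1 + t)) ` zeros_above x"
  proof
    fix y assume "y \<in> phi1_fiber p x"
    then have M: "(x, 1 + (snd y - 1)) \<in> M p" and y: "y = (x, 1 + (snd y - 1))"
      by (auto simp: phi1_fiber_def)
    have "snd y - 1 \<in> zeros_above x"
      using M unfolding M_iff zeros_above_def by simp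
    then show "y \<in> (\<lambda>t. (x, 1 + t)) ` zeros_above x"
      using y by (rule rev_image_eqI)
  qed
qed (auto simp: phi1_fiber_def zeros_above_def M_iff)

lemma zeros_above_pabs_eq:
  assumes "critical x t" "critical x t'"
  shows "pabs t' = pabs t"
proof -
  note c = criticalD[OF assms(1)]
  have "real p * Q_radius p x * pabs t' ^ (p - 2) = real p * Q_radius p x * pabs t ^ (p - 2)"
    unfolding c(4) criticalD(4)[OF assms(2)] ..
  then have "pabs t' ^ (p - 2) = pabs t ^ (p - 2)"
    using c(6) p_gt_1 by simp
  then show ?thesis
    by (rule power_eq_imp_eq_base) (use c(1) in auto)
qed

lemma zeros_above_spread:
  assumes "t \<in> zeros_above x" "t' \<in> zeros_above x" "t \<noteq> t'"
  shows "pabs (t - t') = pabs t'"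
proof (rule antisym)
  have crit: "critical x t'" "critical x t" and zero: "g x (1 + t') = 0" "g x (1 + t) = 0"
    using assms by (auto simp: zeros_above_def)
  show "pabs (t - t') \<le> pabs t'"
    using zeros_above_pabs_eq[OF crit] by (intro pabs_diff_le) auto
  show "pabs t' \<le> pabs (t - t')"
    using zero_unique[OF crit(1) zero] assms(3) not_le by blast
qed

lemma g_reduction_zero:
  assumes "critical x t" "g x (1 + t) = 0"
  shows "pabs (g_term 0 x t + g_term (p - 2) x t) \<le> pabs t / \<rho>"
  using g_reduction[OF assms(1)] unfolding assms(2) diff_0 pabs_minus .

lemma zeros_above_power_close:
  assumes "t \<in> zeros_above x" "t' \<in> zeros_above x"
  shows "pabs (t' ^ (p - 2) - t ^ (p - 2)) < pabs t ^ (p - 2)"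
proof -
  have crit: "critical x t" "critical x t'" and zero: "g x (1 + t) = 0" "g x (1 + t') = 0"
    using assms by (auto simp: zeros_above_def)
  note c = criticalD[OF crit(1)]
  have "pabs (g_term 0 x t + g_term (p - 2) x t) \<le> pabs t / \<rho>"
    by (rule g_reduction_zero[OF crit(1) zero(1)])
  moreover have "pabs (g_term 0 x t' + g_term (p - 2) x t') \<le> pabs t / \<rho>"
    using g_reduction_zero[OF crit(2) zero(2)] zeros_above_pabs_eq[OF crit] by simp
  ultimately have "pabs ((g_term 0 x t' + g_term (p - 2) x t') - (g_term 0 x t + g_term (p - 2) x t)) \<le> pabs t / \<rho>"
    by (intro pabs_diff_le)
  moreover have "(g_term 0 x t' + g_term (p - 2) x t') - (g_term 0 x t + g_term (p - 2) x t)
      = g_term (p - 2) x t * ((t' ^ (p - 2) - t ^ (p - 2)) / t ^ (p - 2))"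
  proof -
    have "a * s' - a * s = a * s * ((s' - s) / s)" if "s \<noteq> 0" for a s s' :: 'a
      using that by (simp add: field_simps)
    note * = this
    have "g_term 0 x t' = g_term 0 x t"
      by (simp add: g_term_def)
    then have "(g_term 0 x t' + g_term (p - 2) x t') - (g_term 0 x t + g_term (p - 2) x t)
        = g_term (p - 2) x t' - g_term (p - 2) x t"
      by (simp only: add_diff_cancel_left)
    also have "\<dots> = g_term (p - 2) x t * ((t' ^ (p - 2) - t ^ (p - 2)) / t ^ (p - 2))"
      unfolding g_term_def by (rule *) (use c(5) in simp)
    finally show ?thesis .
  qed
  ultimately have "pabs ((t' ^ (p - 2) - t ^ (p - 2)) / t ^ (p - 2)) < 1"
    using c(8) by (simp only: pabs_mult[of "g_term (p - 2) x t"] pabs_g_term_p c(4) mult_1_left)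
  then show ?thesis
    using c(7) by (simp add: pos_divide_less_eq)
qed

text \<open>
  The reduction of \<open>g\<close> is a binomial in the \<open>p - 2\<close>-nd power of \<open>t\<close>; so the multiples of one
  zero by the roots of unity of order dividing \<open>p - 2\<close> are approximate zeros, and each zero is
  close to exactly one of them.
\<close>

lemma card_zeros_above:
  assumes "t0 \<in> zeros_above x"
  shows "card (zeros_above x) = p - 2"
proof -
  define n where "n = p - 2"
  have crit: "critical x t0" and zero: "g x (1 + t0) = 0"
    using assms by (auto simp: zeros_above_def)
  note c = criticalD[OF crit]
  have n: "0 < n"
    using c(1) by (simp add: n_def)
  have coprime: "coprime n p"
  proof -
    have "\<not> p dvd n"
      using n p_gt_1 by (auto simp: n_def dest: dvd_imp_le)
    then show ?thesis
      using prime_p prime_imp_coprime coprime_commute by blast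
  qed
  obtain R :: "'a set" where R: "finite R" "card R = n" "\<And>z. z \<in> R \<Longrightarrow> z ^ n = 1"
    "\<And>z. z ^ n - 1 = (\<Prod>r\<in>R. z - r)"
    using roots_of_unity[OF n] by blast
  have R1: "pabs z = 1" if "z \<in> R" for z
    using pabs_root_of_unity[OF R(3)[OF that] n] .
  have crit_R: "critical x (z * t0)" if "z \<in> R" for z
    using crit R1[OF that] by (simp add: critical_def pabs_mult)
  have "\<exists>t. t \<in> zeros_above x \<and> pabs (t - z * t0) < pabs t0" if z: "z \<in> R" for z
  proof -
    have "(z * t0) ^ n = t0 ^ n"
      using R(3)[OF z] by (simp add: power_mult_distrib)
    then have "g_term 0 x (z * t0) = g_term 0 x t0" "g_term (p - 2) x (z * t0) = g_term (p - 2) x t0"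
      by (simp_all add: g_term_def n_def)
    then have "pabs (g x (1 + z * t0) - (g_term 0 x t0 + g_term (p - 2) x t0)) \<le> pabs t0 / \<rho>"
      using g_reduction[OF crit_R[OF z]] R1[OF z] by (simp add: pabs_mult)
    moreover have "pabs (g_term 0 x t0 + g_term (p - 2) x t0) \<le> pabs t0 / \<rho>"
      by (rule g_reduction_zero[OF crit zero])
    ultimately have "pabs (g x (1 + z * t0)) \<le> pabs t0 / \<rho>"
      using pabs_add_le by fastforce
    then obtain t where t: "pabs (t - z * t0) < pabs (z * t0)" "g x (1 + t) = 0"
      using solution_near[OF crit_R[OF z], of x] c(6,8) by auto
    then have "critical x t"
      using critical_near[OF crit_R[OF z], of x t] c(6) pabs_eq_if_close[OF t(1)] by simp
    then show ?thesis
      using t R1[OF z] by (auto simp: zeros_above_def pabs_mult)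
  qed
  then obtain f where f: "\<And>z. z \<in> R \<Longrightarrow> f z \<in> zeros_above x \<and> pabs (f z - z * t0) < pabs t0"
    by metis
  have "inj_on f R"
  proof (rule inj_onI, rule ccontr)
    fix z w assume zw: "z \<in> R" "w \<in> R" "f z = f w" "z \<noteq> w"
    have "pabs ((f w - w * t0) - (f z - z * t0)) < pabs t0"
      using f[OF zw(1)] f[OF zw(2)] pabs_diff_less by blast
    then have "pabs (z - w) * pabs t0 < pabs t0"
      using zw(3) by (simp add: algebra_simps flip: pabs_mult)
    then show False
      using roots_of_unity_distinct_residues[OF R(3)[OF zw(1)] R(3)[OF zw(2)] n coprime zw(4)] c(7)
      by simp
  qed
  moreover have "f ` R = zeros_above x"
  proof
    show "zeros_above x \<subseteq> f ` R"
    proof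
      fix t assume t: "t \<in> zeros_above x"
      have "pabs ((t / t0) ^ n - 1) < 1"
      proof -
        have "(t / t0) ^ n - 1 = (t ^ n - t0 ^ n) / t0 ^ n"
          using c(5) by (simp add: power_divide diff_divide_distrib)
        then show ?thesis
          using zeros_above_power_close[OF assms t] c(7) by (simp add: n_def pos_divide_less_eq)
      qed
      have "\<exists>z\<in>R. pabs (t / t0 - z) < 1"
      proof (rule ccontr)
        assume "\<not> ?thesis"
        then have "1 \<le> (\<Prod>z\<in>R. pabs (t / t0 - z))"
          by (intro prod_ge_1) auto
        then show False
          using \<open>pabs ((t / t0) ^ n - 1) < 1\<close> unfolding R(4) pabs_prod by simp
      qed
      then obtain z where z: "z \<in> R" "pabs (t / t0 - z) < 1"
        by blast
      have "t - z * t0 = (t / t0 - z) * t0"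
        using c(5) by (simp add: field_simps)
      then have "pabs (t - z * t0) < pabs t0"
        using z(2) c(7) by (simp add: pabs_mult)
      then have "pabs (t - f z) < pabs t0"
        using pabs_diff_less[of "t - z * t0" _ "f z - z * t0"] f[OF z(1)] by simp
      moreover have "pabs (f z) = pabs t0"
        using f[OF z(1)] zeros_above_pabs_eq[OF crit] by (auto simp: zeros_above_def)
      ultimately have "t = f z"
        using zeros_above_spread[OF t, of "f z"] f[OF z(1)] by auto
      then show "t \<in> f ` R"
        using z(1) by blast
    qed
  qed (use f in auto)
  ultimately show ?thesis
    using card_image[of f R] R(2) by (simp add: n_def)
qed

lemma card_phi1_fiber:
  fixes x q :: 'a
  assumes "(x, q) \<in> M p"
  shows "card (phi1_fiber p x) = p - 2"
proof -
  have "q - 1 \<in> zeros_above x"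
    using assms M_iff[of x "q - 1"] by (simp add: zeros_above_def)
  moreover have "card (phi1_fiber p x) = card (zeros_above x)"
    unfolding phi1_fiber_eq by (intro card_image inj_onI) auto
  ultimately show ?thesis
    using card_zeros_above by simp
qed

lemma residue_eq_iff: "residue x = residue y \<longleftrightarrow> pabs (x - y) < 1" for x y :: 'a
proof
  assume "residue x = residue y"
  moreover have "x \<in> residue x"
    by (simp add: residue_def)
  ultimately show "pabs (x - y) < 1"
    by (simp add: residue_def)
next
  assume xy: "pabs (x - y) < 1"
  show "residue x = residue y"
  proof (rule set_eqI)
    fix z
    show "z \<in> residue x \<longleftrightarrow> z \<in> residue y"
      using pabs_add_less[of "z - x" 1 "x - y"] pabs_diff_less[of "z - y" 1 "x - y"] xy
      by (auto simp: residue_def)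
  qed
qed

context
  fixes p_pow :: "real \<Rightarrow> 'a"
  assumes p_pow: "\<forall>r\<in>\<rat>. pabs (p_pow r) = real p powr (- r)"
begin

lemma pabs_p_pow_pval: "t \<noteq> 0 \<Longrightarrow> pabs (p_pow (pval p t)) = pabs t" for t :: 'a
  using p_pow pval_rational powr_minus_pval by simp

lemma ex1_unit_factor:
  fixes t :: 'a
  assumes "t \<noteq> 0"
  shows "\<exists>!u. u \<in> O_units \<and> 1 + t = 1 + p_pow (pval p t) * u"
proof (rule ex1I[of _ "t / p_pow (pval p t)"])
  have "p_pow (pval p t) \<noteq> 0"
    using pabs_p_pow_pval[OF assms] assms by (metis pabs_eq_0)
  then show "t / p_pow (pval p t) \<in> O_units \<and> 1 + t = 1 + p_pow (pval p t) * (t / p_pow (pval p t))"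
    using pabs_p_pow_pval[OF assms] assms by (simp add: O_units_def)
  show "u = t / p_pow (pval p t)" if "u \<in> O_units \<and> 1 + t = 1 + p_pow (pval p t) * u" for u
  proof -
    have "t = p_pow (pval p t) * u"
      using that by simp
    then show ?thesis
      using \<open>p_pow (pval p t) \<noteq> 0\<close> by (metis nonzero_mult_div_cancel_left)
  qed
qed

lemma unit_factors_distinct_residues:
  assumes "t \<in> zeros_above x" "t' \<in> zeros_above x" "t \<noteq> t'"
    "t = p_pow (pval p t) * u" "t' = p_pow (pval p t') * u'"
  shows "residue u \<noteq> residue u'"
proof
  assume "residue u = residue u'"
  then have "pabs (u - u') < 1"
    by (simp add: residue_eq_iff)
  have crit: "critical x t'" "critical x t"
    using assms by (auto simp: zeros_above_def)
  have eq: "pabs t = pabs t'"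
    using zeros_above_pabs_eq[OF crit] .
  then have "pval p t = pval p t'"
    by (simp add: pval_def)
  then have "t - t' = p_pow (pval p t') * (u - u')"
    using assms(4,5) by (simp add: right_diff_distrib)
  then have "pabs (t - t') = pabs t' * pabs (u - u')"
    using pabs_p_pow_pval[OF criticalD(5)[OF crit(1)]] by (simp add: pabs_mult)
  then show False
    using zeros_above_spread[OF assms(1-3)] \<open>pabs (u - u') < 1\<close> criticalD(7)[OF crit(1)] by simp
qed

end

section \<open>The map \<open>Q\<close>\<close>

lemma Q_map_eq_The: "Q_map p (1 + t) y = (THE q'. q' \<in> ball (1 + t) (pabs t) \<and> (y, q') \<in> M p)" for t y :: 'a
  by (simp add: Q_map_def)

lemma Q_map_solution:
  fixes y :: 'a
  assumes "critical x t" "g x (1 + t) = 0" "pabs (y - x) < Q_radius p x"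
  obtains s where "Q_map p (1 + t) y = 1 + s" "pabs (s - t) < pabs t" "critical y s" "g y (1 + s) = 0"
proof -
  define s where "s = Q_map p (1 + t) y - 1"
  have "Q_map p (1 + t) y \<in> ball (1 + t) (pabs t) \<and> (y, Q_map p (1 + t) y) \<in> M p"
    unfolding Q_map_eq_The by (rule theI'[OF ex1_solution[OF assms]])
  moreover have s: "Q_map p (1 + t) y = 1 + s"
    by (simp add: s_def)
  ultimately have "pabs (1 + s - (1 + t)) < pabs t" "critical y s \<and> g y (1 + s) = 0"
    unfolding s mem_ball_pabs M_iff by auto
  then show ?thesis
    using that[OF s] by simp
qed

lemma Q_map_eqI:
  fixes y :: 'a
  assumes "critical x t" "g x (1 + t) = 0" "pabs (y - x) < Q_radius p x"
    "pabs (s - t) < pabs t" "g y (1 + s) = 0"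
  shows "Q_map p (1 + t) y = 1 + s"
proof -
  have "critical y s"
    using critical_near[OF assms(1,3)] pabs_eq_if_close[OF assms(4)] .
  then have "1 + s \<in> ball (1 + t) (pabs t) \<and> (y, 1 + s) \<in> M p"
    using assms by (simp add: M_iff mem_ball_pabs del: mem_ball)
  then show ?thesis
    unfolding Q_map_eq_The by (rule the1_equality[OF ex1_solution[OF assms(1-3)]])
qed

lemma pabs_Q_map_minus:
  fixes y :: 'a
  assumes "critical x t" "g x (1 + t) = 0" "pabs (y - x) < Q_radius p x"
  shows "pabs (Q_map p (1 + t) y - (1 + t)) = pabs (t * g y (1 + t))"
proof -
  obtain s where s: "Q_map p (1 + t) y = 1 + s" "pabs (s - t) < pabs t" "g y (1 + s) = 0"
    using Q_map_solution[OF assms] by metis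
  have "critical y t"
    using critical_near[OF assms(1,3)] by simp
  from pabs_g_diff[OF this s(2)] show ?thesis
    using s criticalD(7)[OF assms(1)] by (simp add: pabs_mult)
qed

text \<open>
  Close to \<open>0\<close> the first nonzero term of a power series dominates all others, so it cannot exist if the
  values are of higher order. For \<open>C = 0\<close>, induction on \<open>m\<close> yields the identity theorem.
\<close>

lemma fps_nth_eq_0I:
  assumes "0 < r" "gauss_le r B f" "\<And>i. i < m \<Longrightarrow> f $ i = 0"
    "\<And>y. pabs y < r \<Longrightarrow> pabs (fps_value f y) \<le> C * pabs y ^ Suc m"
  shows "f $ m = 0"
proof (rule ccontr)
  assume nz: "f $ m \<noteq> 0"
  define K where "K = \<bar>C\<bar> + B / r ^ Suc m + 1"
  have "0 \<le> B / r ^ Suc m"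
    using gauss_le_nonneg[OF assms(2)] assms(1) by simp
  then have K: "0 < K" "C \<le> K" "B / r ^ Suc m \<le> K"
    unfolding K_def by linarith+
  obtain y :: 'a where y: "y \<noteq> 0" "pabs y < min r (pabs (f $ m) / K)"
    using small_nonzero_element[of "min r (pabs (f $ m) / K)"] nz K assms(1) by auto
  have y_r: "pabs y < r" and y_K: "K * pabs y < pabs (f $ m)"
    using y K by (auto simp: pos_less_divide_eq mult.commute)
  have "(\<Sum>i<Suc m. f $ i * y ^ i) = f $ m * y ^ m"
    using assms(3) by simp
  then have "(\<lambda>i. f $ (i + Suc m) * y ^ (i + Suc m)) sums (fps_value f y - f $ m * y ^ m)"
    using padic_sums_shift[OF fps_value_sums[OF assms(1,2) y_r], of "Suc m"] by simp
  moreover have "pabs (f $ (i + Suc m) * y ^ (i + Suc m)) \<le> K * pabs y ^ Suc m" for i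
  proof -
    have "pabs (f $ (i + Suc m) * y ^ (i + Suc m)) \<le> B * (pabs y / r) ^ (i + Suc m)"
      by (rule gauss_le_term[OF assms(1,2)])
    also have "\<dots> \<le> B * (pabs y / r) ^ Suc m"
      using gauss_le_nonneg[OF assms(2)] y_r assms(1)
      by (intro mult_left_mono power_decreasing) auto
    also have "\<dots> = B / r ^ Suc m * pabs y ^ Suc m"
      by (simp add: power_divide)
    also have "\<dots> \<le> K * pabs y ^ Suc m"
      using K by (intro mult_right_mono) auto
    finally show ?thesis .
  qed
  ultimately have "pabs (fps_value f y - f $ m * y ^ m) \<le> K * pabs y ^ Suc m"
    by (rule padic_sums_le)
  moreover have "pabs (fps_value f y) \<le> K * pabs y ^ Suc m"
    using assms(4)[OF y_r] mult_right_mono[OF K(2), of "pabs y ^ Suc m"] by simp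
  ultimately have "pabs (fps_value f y - (fps_value f y - f $ m * y ^ m)) \<le> K * pabs y ^ Suc m"
    by (rule pabs_diff_le[rotated])
  then have "pabs (f $ m) * pabs y ^ m \<le> (K * pabs y) * pabs y ^ m"
    by (simp add: pabs_mult)
  then have "pabs (f $ m) \<le> K * pabs y"
    using y(1) by simp
  then show False
    using y_K by simp
qed

lemma fps_eqI_values:
  assumes "0 < r" "gauss_le r B f" "gauss_le r C h" "\<And>y. pabs y < r \<Longrightarrow> fps_value f y = fps_value h y"
  shows "f = h"
proof -
  have d: "gauss_le r (max B C) (f - h)"
    using assms by (intro gauss_le_diff) (auto intro: gauss_le_mono)
  have "(f - h) $ m = 0" for m
  proof (induction m rule: less_induct)
    case (less m)
    have "fps_value (f - h) y = 0" if "pabs y < r" for y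
      using fps_value_diff[OF assms(1-3) that] assms(4)[OF that] by simp
    then show ?case
      using less by (intro fps_nth_eq_0I[OF assms(1) d, of m 0]) auto
  qed
  then show ?thesis
    by (simp add: fps_eq_iff)
qed

lemma gauss_le_smaller_radius:
  assumes "gauss_le r B f" "0 \<le> r'" "r' \<le> r"
  shows "gauss_le r' B f"
  unfolding gauss_le_def
proof
  fix m
  have "pabs (f $ m) * r' ^ m \<le> pabs (f $ m) * r ^ m"
    using assms by (intro mult_left_mono power_mono) auto
  then show "pabs (f $ m) * r' ^ m \<le> B"
    using gauss_leD[OF assms(1), of m] by linarith
qed

text \<open>
  Newton's iteration converges uniformly only on smaller balls; by the identity theorem the
  resulting power series are all the same.
\<close>

lemma Q_map_analytic:
  assumes crit: "critical x t" and zero: "g x (1 + t) = 0"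
  shows "analytic_on_ball (Q_map p (1 + t)) x (Q_radius p x)"
proof -
  note c = criticalD[OF crit]
  define \<alpha> where "\<alpha> = Q_radius p x"
  have local: "\<exists>W. gauss_le r 1 W \<and> (\<forall>y. pabs y < r \<longrightarrow> fps_value W y = Q_map p (1 + t) (x + y))"
    if r: "0 < r" "r < \<alpha>" for r
  proof -
    have start: "pabs (g x (1 + t)) < 1"
      by (simp add: zero)
    obtain W where gW: "gauss_le r (pabs t) W"
      and W: "\<And>y. pabs y < r \<Longrightarrow> pabs (fps_value W y - t) < pabs t"
        "\<And>y. pabs y < r \<Longrightarrow> g (x + y) (1 + fps_value W y) = 0"
      using implicit_function[OF crit start r(1) r(2)[unfolded \<alpha>_def]] by blast
    have gW1: "gauss_le r 1 W"
      using gW c(10) by (elim gauss_le_mono) simp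
    have "fps_value (fps_const 1 + W) y = Q_map p (1 + t) (x + y)" if y: "pabs y < r" for y
    proof -
      have "Q_map p (1 + t) (x + y) = 1 + fps_value W y"
        using y r W[OF y] by (intro Q_map_eqI[OF crit zero]) (auto simp: \<alpha>_def)
      then show ?thesis
        using fps_value_add[OF r(1) _ gW y, of 1 "fps_const 1"]
        by (simp add: gauss_le_const_iff del: fps_const_1_eq_1)
    qed
    moreover have "gauss_le r 1 (fps_const 1 + W)"
      using gW1 r by (intro gauss_le_add) (auto simp: gauss_le_const_iff simp del: fps_const_1_eq_1)
    ultimately show ?thesis
      by blast
  qed
  have \<alpha>2: "0 < \<alpha> / 2" "\<alpha> / 2 < \<alpha>"
    using c(6) by (auto simp: \<alpha>_def)
  obtain W where W: "gauss_le (\<alpha> / 2) 1 W" "\<And>y. pabs y < \<alpha> / 2 \<Longrightarrow> fps_value W y = Q_map p (1 + t) (x + y)"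
    using local[OF \<alpha>2] by blast
  have "(\<lambda>n. W $ n * (z - x) ^ n) sums Q_map p (1 + t) z" if "pabs (z - x) < \<alpha>" for z
  proof -
    have "max (\<alpha> / 2) (pabs (z - x)) < \<alpha>"
      using that \<alpha>2 by simp
    then obtain r where r: "max (\<alpha> / 2) (pabs (z - x)) < r" "r < \<alpha>"
      using dense by blast
    then have r': "0 < r" "\<alpha> / 2 \<le> r" "pabs (z - x) < r"
      using \<alpha>2 by auto
    obtain V where V: "gauss_le r 1 V" "\<And>y. pabs y < r \<Longrightarrow> fps_value V y = Q_map p (1 + t) (x + y)"
      using local[OF r'(1) r(2)] by blast
    have "gauss_le (\<alpha> / 2) 1 V"
      using \<alpha>2 r' by (intro gauss_le_smaller_radius[OF V(1)]) auto
    then have "W = V"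
      using W V(2) r' by (intro fps_eqI_values[OF \<alpha>2(1) W(1)]) auto
    then show ?thesis
      using fps_value_sums[OF r'(1) V(1) r'(3)] V(2)[OF r'(3)] by simp
  qed
  then show ?thesis
    unfolding analytic_on_ball_def has_power_series_on_def
    by (intro exI[of _ "fps_nth W"]) (simp add: mem_ball_pabs \<alpha>_def del: mem_ball)
qed

section \<open>Polynomials with bounded coefficients\<close>

definition coeff_le :: "real \<Rightarrow> 'a poly \<Rightarrow> bool" where
  "coeff_le B P \<longleftrightarrow> (\<forall>i. pabs (coeff P i) \<le> B)"

lemma coeff_le_iff_gauss_le: "coeff_le B P \<longleftrightarrow> gauss_le 1 B (fps_of_poly P)"
  by (simp add: coeff_le_def gauss_le_def)

lemma coeff_leD: "coeff_le B P \<Longrightarrow> pabs (coeff P i) \<le> B"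
  by (simp add: coeff_le_def)

lemma coeff_le_nonneg: "coeff_le B P \<Longrightarrow> 0 \<le> B"
  using coeff_leD[of B P 0] order_trans[OF pabs_nonneg[of "coeff P 0"]] by simp

lemma coeff_le_0 [simp]: "coeff_le B 0 \<longleftrightarrow> 0 \<le> B"
  by (simp add: coeff_le_def)

lemma coeff_le_add: "coeff_le B P \<Longrightarrow> coeff_le B R \<Longrightarrow> coeff_le B (P + R)"
  by (simp add: coeff_le_def pabs_add_le)

lemma coeff_le_diff: "coeff_le B P \<Longrightarrow> coeff_le B R \<Longrightarrow> coeff_le B (P - R)"
  by (simp add: coeff_le_def pabs_diff_le)

lemma coeff_le_sum:
  assumes "0 \<le> B" "\<And>i. i \<in> S \<Longrightarrow> coeff_le B (f i)"
  shows "coeff_le B (sum f S)"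
  using assms(2) by (induction S rule: infinite_finite_induct) (auto intro!: coeff_le_add assms(1))

lemma coeff_le_mult: "coeff_le B P \<Longrightarrow> coeff_le C R \<Longrightarrow> coeff_le (B * C) (P * R)"
  unfolding coeff_le_iff_gauss_le fps_of_poly_mult by (rule gauss_le_mult) simp_all

lemma coeff_le_smult:
  assumes "coeff_le B P" "pabs c \<le> C"
  shows "coeff_le (C * B) (smult c P)"
  unfolding coeff_le_def
proof
  fix i
  have "0 \<le> C"
    using assms(2) pabs_nonneg[of c] by linarith
  then show "pabs (coeff (smult c P) i) \<le> C * B"
    using coeff_leD[OF assms(1), of i] assms(2) by (simp add: pabs_mult mult_mono)
qed

lemma coeff_le_prod_1: "(\<And>i. i \<in> S \<Longrightarrow> coeff_le 1 (f i)) \<Longrightarrow> coeff_le 1 (prod f S)"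
  unfolding coeff_le_iff_gauss_le fps_of_poly_prod by (intro gauss_le_prod_1) simp_all

lemma coeff_le_pCons: "coeff_le B (pCons a P) \<longleftrightarrow> pabs a \<le> B \<and> coeff_le B P"
proof -
  have "(\<forall>i. pabs (coeff (pCons a P) i) \<le> B) \<longleftrightarrow> pabs a \<le> B \<and> (\<forall>i. pabs (coeff P i) \<le> B)"
    by (metis coeff_pCons_0 coeff_pCons_Suc not0_implies_Suc)
  then show ?thesis
    by (simp add: coeff_le_def)
qed

lemma coeff_le_linear: "pabs a \<le> 1 \<Longrightarrow> coeff_le 1 [:a, 1:]"
  by (simp add: coeff_le_pCons)

lemma coeff_le_shift:
  assumes "coeff_le B P" "pabs x \<le> 1"
  shows "coeff_le B (P \<circ>\<^sub>p [:x, 1:])"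
  using assms(1)
proof (induction P)
  case (pCons a P)
  then have "coeff_le (1 * B) ([:x, 1:] * (P \<circ>\<^sub>p [:x, 1:]))"
    using assms(2) by (intro coeff_le_mult coeff_le_linear) (auto simp: coeff_le_pCons)
  moreover have "coeff_le B [:a:]"
    using pCons.prems coeff_le_nonneg by (auto simp: coeff_le_pCons)
  ultimately show ?case
    by (simp add: pcompose_pCons coeff_le_add)
qed simp

lemma coeff_le_shift_diff:
  assumes "coeff_le 1 P" "pabs z \<le> 1"
  shows "coeff_le (pabs z) (P \<circ>\<^sub>p [:z, 1:] - P)"
  using assms(1)
proof (induction P)
  case (pCons a P)
  have "pCons a P \<circ>\<^sub>p [:z, 1:] - pCons a P = smult z (P \<circ>\<^sub>p [:z, 1:]) + pCons 0 (P \<circ>\<^sub>p [:z, 1:] - P)"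
    by (simp add: pcompose_pCons)
  moreover have "coeff_le (pabs z * 1) (smult z (P \<circ>\<^sub>p [:z, 1:]))"
    using pCons.prems assms(2) by (intro coeff_le_smult coeff_le_shift) (auto simp: coeff_le_pCons)
  moreover have "coeff_le (pabs z) (pCons 0 (P \<circ>\<^sub>p [:z, 1:] - P))"
    using pCons by (simp add: coeff_le_pCons)
  ultimately show ?case
    by (simp add: coeff_le_add)
qed simp

lemma coeff_le_pderiv:
  assumes "coeff_le B P"
  shows "coeff_le B (pderiv P)"
  unfolding coeff_le_def
proof
  fix i
  have "pabs (of_nat (Suc i) :: 'a) * pabs (coeff P (Suc i)) \<le> 1 * B"
    using coeff_leD[OF assms] by (intro mult_mono pabs_of_nat_le_1) auto
  then show "pabs (coeff (pderiv P) i) \<le> B"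
    by (simp add: coeff_pderiv pabs_mult)
qed

lemma coeff_le_poly_shift: "coeff_le B P \<Longrightarrow> coeff_le B (poly_shift n P)"
  by (simp add: coeff_le_def coeff_poly_shift)

lemma pabs_poly_le:
  assumes "coeff_le B P" "pabs y \<le> 1"
  shows "pabs (poly P y) \<le> B"
  unfolding poly_altdef
proof (rule pabs_sum_le)
  show "pabs (coeff P i * y ^ i) \<le> B" for i
    using coeff_leD[OF assms(1), of i] mult_mono[of "pabs (coeff P i)" B "pabs y ^ i" 1]
      coeff_le_nonneg[OF assms(1)] assms(2) by (simp add: pabs_mult power_le_one)
qed (rule coeff_le_nonneg[OF assms(1)])

lemma pCons_poly_shift: "pCons (coeff P 0) (poly_shift 1 P) = P" for P :: "'a poly"
  by (rule poly_eqI) (simp add: coeff_pCons coeff_poly_shift split: nat.split)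

lemma coeff_0_shift: "coeff (P \<circ>\<^sub>p [:x, 1:]) 0 = poly P x" for x :: 'a
  by (simp add: poly_pcompose flip: poly_0_coeff_0)

lemma coeff_1_shift: "coeff (P \<circ>\<^sub>p [:x, 1:]) 1 = poly (pderiv P) x" for x :: 'a
proof -
  have "coeff (P \<circ>\<^sub>p [:x, 1:]) 1 = poly (pderiv (P \<circ>\<^sub>p [:x, 1:])) 0"
    by (simp add: poly_0_coeff_0 coeff_pderiv)
  then show ?thesis
    by (simp add: pderiv_pcompose poly_pcompose pderiv_pCons)
qed

lemma poly_taylor_le:
  assumes "coeff_le B P" "pabs x \<le> 1" "pabs h \<le> 1"
  shows "pabs (poly P (x + h) - poly P x) \<le> B * pabs h"
    and "pabs (poly P (x + h) - poly P x - poly (pderiv P) x * h) \<le> B * (pabs h)\<^sup>2"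
proof -
  define S where "S = P \<circ>\<^sub>p [:x, 1:]"
  define S1 where "S1 = poly_shift 1 S"
  define S2 where "S2 = poly_shift 1 S1"
  have S: "coeff_le B S"
    unfolding S_def by (rule coeff_le_shift[OF assms(1,2)])
  then have S12: "coeff_le B S1" "coeff_le B S2"
    by (simp_all add: S1_def S2_def coeff_le_poly_shift)
  have "poly S h = poly P (x + h)"
    by (simp add: S_def poly_pcompose)
  moreover have "S = pCons (poly P x) S1" "S1 = pCons (poly (pderiv P) x) S2"
    using pCons_poly_shift[of S] pCons_poly_shift[of S1] coeff_0_shift[of P x] coeff_1_shift[of P x]
    by (simp_all add: S1_def S2_def S_def coeff_poly_shift)
  ultimately have S_h: "poly P (x + h) = poly P x + h * poly S1 h"
    and S1_h: "poly S1 h = poly (pderiv P) x + h * poly S2 h"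
    by (metis poly_pCons)+
  have eq: "poly P (x + h) - poly P x = poly S1 h * h"
    "poly P (x + h) - poly P x - poly (pderiv P) x * h = poly S2 h * h\<^sup>2"
    unfolding S_h by (simp_all add: S1_h algebra_simps power2_eq_square)
  show "pabs (poly P (x + h) - poly P x) \<le> B * pabs h"
    unfolding eq(1) pabs_mult by (intro mult_right_mono pabs_poly_le S12 assms) simp
  show "pabs (poly P (x + h) - poly P x - poly (pderiv P) x * h) \<le> B * (pabs h)\<^sup>2"
    unfolding eq(2) pabs_mult pabs_power by (intro mult_right_mono pabs_poly_le S12 assms) simp
qed

subsection \<open>Roots\<close>

text \<open>
  If every root is at least \<open>s\<close> in absolute value, then each factor \<open>X - r\<close> has Gauss norm
  \<open>pabs r\<close> for the radius \<open>s\<close>, so that the constant coefficient bounds the Gauss norm of the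
  product.
\<close>

lemma poly_small_root:
  fixes P :: "'a poly"
  assumes "pabs (coeff P 0) \<le> \<delta>" "pabs (coeff P m) = 1" "0 < m" "\<delta> < 1"
  obtains z where "poly P z = 0" "pabs z ^ m \<le> \<delta>"
proof (rule ccontr)
  assume "\<not> thesis"
  then have large: "\<delta> < pabs z ^ m" if "poly P z = 0" for z
    using that \<open>\<And>z. poly P z = 0 \<Longrightarrow> pabs z ^ m \<le> \<delta> \<Longrightarrow> thesis\<close> by force
  have "P \<noteq> 0"
    using assms(2) by auto
  then obtain c B where P: "P = smult c (\<Prod>r\<in>#B. [:- r, 1:])"
    using alg_closed_imp_factorization[of P] by blast
  have root: "poly P r = 0" if "r \<in># B" for r
    using multi_member_split[OF that] by (auto simp: P)
  have "B \<noteq> {#}"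
  proof
    assume "B = {#}"
    then have "P = [:c:]"
      using P by simp
    then have "coeff P m = 0"
      using assms(3) by (metis coeff_pCons_Suc coeff_0 gr0_implies_Suc)
    then show False
      using assms(2) by simp
  qed
  define s where "s = Min (pabs ` set_mset B)"
  have "s \<in> pabs ` set_mset B"
    unfolding s_def using \<open>B \<noteq> {#}\<close> by (intro Min_in) auto
  then have s: "\<delta> < s ^ m" "0 \<le> s"
    using large root by auto
  have "0 \<le> \<delta>"
    using assms(1) pabs_nonneg[of "coeff P 0"] by linarith
  then have s0: "0 < s"
    using s assms(3) by (cases "s = 0") (auto simp: zero_power)
  have s_le: "s \<le> pabs r" if "r \<in># B" for r
    unfolding s_def using that by (intro Min_le) auto
  have "gauss_le s (\<Prod>r\<in>#C. pabs r) (fps_of_poly (\<Prod>r\<in>#C. [:- r, 1:])) \<and>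
      pabs (coeff (\<Prod>r\<in>#C. [:- r, 1:]) 0) = (\<Prod>r\<in>#C. pabs r)" if "set_mset C \<subseteq> set_mset B" for C
    using that
  proof (induction C)
    case (add r C)
    have "gauss_le s (pabs r) (fps_of_poly [:- r, 1:])"
      unfolding gauss_le_def
    proof
      fix i
      show "pabs (fps_of_poly [:- r, 1:] $ i) * s ^ i \<le> pabs r"
        using s_le[of r] add.prems by (cases i rule: nat.exhaust[case_names 0 Suc]; cases "i = 1")
          (auto simp: coeff_pCons split: nat.split)
    qed
    moreover have "gauss_le s (\<Prod>r\<in>#C. pabs r) (fps_of_poly (\<Prod>r\<in>#C. [:- r, 1:]))"
      using add by auto
    ultimately have "gauss_le s (pabs r * (\<Prod>r\<in>#C. pabs r)) (fps_of_poly ([:- r, 1:] * (\<Prod>r\<in>#C. [:- r, 1:])))"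
      unfolding fps_of_poly_mult by (rule gauss_le_mult[OF s0])
    moreover have IH: "pabs (coeff (\<Prod>r\<in>#C. [:- r, 1:]) 0) = (\<Prod>r\<in>#C. pabs r)"
      using add by auto
    moreover have "coeff ([:- r, 1:] * (\<Prod>r\<in>#C. [:- r, 1:])) 0 = - r * coeff (\<Prod>r\<in>#C. [:- r, 1:]) 0"
      by (simp add: coeff_mult)
    ultimately show ?case
      using IH by (simp only: image_mset_add_mset prod_mset.add_mset pabs_mult pabs_minus)
  qed (auto intro: gauss_le_1)
  note product = this[OF order_refl]
  have "gauss_le s (pabs c * (\<Prod>r\<in>#B. pabs r)) (fps_of_poly P)"
    using gauss_le_const_mult[OF s0 product[THEN conjunct1], of c] by (simp only: P fps_of_poly_smult)
  moreover have "pabs (coeff P 0) = pabs c * (\<Prod>r\<in>#B. pabs r)"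
    using product[THEN conjunct2] by (simp only: P coeff_smult pabs_mult)
  ultimately have "gauss_le s \<delta> (fps_of_poly P)"
    using assms(1) gauss_le_mono by metis
  then have "pabs (coeff P m) * s ^ m \<le> \<delta>"
    using gauss_leD[of s \<delta> "fps_of_poly P" m] by simp
  then show False
    using assms(2) s by simp
qed

text \<open>
  Continuity of roots: near a root of one polynomial, the next one in the sequence has a root.
  Translating by an element of the maximal ideal does not affect which coefficients are units.
\<close>

lemma zero_of_polynomial_limit:
  fixes P :: "nat \<Rightarrow> 'a poly"
  assumes integral: "\<And>k. coeff_le 1 (P k)" and step: "\<And>k. coeff_le (\<theta> ^ Suc k) (P (Suc k) - P k)"
    and \<theta>: "0 \<le> \<theta>" "\<theta> < 1" and unit: "\<And>k. pabs (coeff (P k) m) = 1" and m: "0 < m"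
    and const: "pabs (coeff (P 0) 0) < 1"
  obtains z where "pabs z < 1" "(\<lambda>k. poly (P k) z) \<longlonglongrightarrow> 0"
proof -
  have "\<exists>z. pabs z < 1 \<and> poly (P 0) z = 0"
  proof -
    obtain z where z: "poly (P 0) z = 0" "pabs z ^ m \<le> pabs (coeff (P 0) 0)"
      using poly_small_root[OF order_refl unit m const] .
    then have "pabs z ^ m < 1 ^ m"
      using const by simp
    then show ?thesis
      using z(1) power_less_imp_less_base[of "pabs z" m 1] by auto
  qed
  moreover have "\<exists>w. (pabs w < 1 \<and> poly (P (Suc k)) w = 0) \<and> pabs (w - z) ^ m \<le> \<theta> ^ Suc k"
    if z: "pabs z < 1 \<and> poly (P k) z = 0" for k z
  proof -
    define S where "S = P (Suc k) \<circ>\<^sub>p [:z, 1:]"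
    have "coeff S 0 = poly (P (Suc k) - P k) z"
      using z by (simp add: S_def coeff_0_shift)
    also have "pabs \<dots> \<le> \<theta> ^ Suc k"
      using z by (intro pabs_poly_le step) simp
    finally have S0: "pabs (coeff S 0) \<le> \<theta> ^ Suc k" .
    have "pabs (coeff S m - coeff (P (Suc k)) m) \<le> pabs z"
      using coeff_leD[OF coeff_le_shift_diff[OF integral, of z "Suc k"], of m] z by (simp add: S_def)
    then have "pabs (coeff S m - coeff (P (Suc k)) m) < pabs (coeff (P (Suc k)) m)"
      using z unfolding unit by linarith
    from pabs_eq_if_close[OF this] have Sm: "pabs (coeff S m) = 1"
      unfolding unit .
    have "\<theta> ^ Suc k \<le> \<theta> ^ 1"
      using \<theta> by (intro power_decreasing) auto
    then have "\<theta> ^ Suc k < 1"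
      using \<theta> by simp
    from poly_small_root[OF S0 Sm m this] obtain h where h: "poly S h = 0" "pabs h ^ m \<le> \<theta> ^ Suc k" .
    then have "pabs h ^ m < 1 ^ m"
      using \<open>\<theta> ^ Suc k < 1\<close> by simp
    then have "pabs h < 1"
      using power_less_imp_less_base[of "pabs h" m 1] by auto
    then have "pabs (z + h) < 1"
      using z pabs_add_less by blast
    moreover have "poly (P (Suc k)) (z + h) = 0"
      using h(1) by (simp add: S_def poly_pcompose)
    ultimately show ?thesis
      using h(2) by (intro exI[of _ "z + h"]) simp
  qed
  ultimately obtain z where z: "\<And>k. pabs (z k) < 1" "\<And>k. poly (P k) (z k) = 0"
    "\<And>k. pabs (z (Suc k) - z k) ^ m \<le> \<theta> ^ Suc k"
    using dependent_nat_choice[of "\<lambda>k z. pabs z < 1 \<and> poly (P k) z = 0"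
        "\<lambda>k z w. pabs (w - z) ^ m \<le> \<theta> ^ Suc k"] by metis
  \<comment> \<open>Only the \<open>m\<close>-th powers of the distances are controlled.\<close>
  define \<eta> where "\<eta> = root m \<theta>"
  have \<eta>: "0 \<le> \<eta>" "\<eta> < 1" "\<eta> ^ m = \<theta>"
    using \<theta> m by (simp_all add: \<eta>_def)
  have "pabs (z (Suc k) - z k) \<le> \<eta> * \<eta> ^ k" for k
  proof -
    have "pabs (z (Suc k) - z k) ^ m \<le> (\<eta> ^ Suc k) ^ m"
      using z(3)[of k] \<eta>(3) by (metis mult.commute power_mult)
    then show ?thesis
      using power_mono_iff[of "pabs (z (Suc k) - z k)" "\<eta> ^ Suc k" m] \<eta> m by simp
  qed
  then have "gauss_le 1 (\<eta> * \<eta> ^ k) (fps_const (z (Suc k)) - fps_const (z k))" for k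
    by (simp add: gauss_le_const_iff)
  from gauss_geometric_limit[OF zero_less_one \<eta>(1,2) this]
  obtain f where "\<And>k. gauss_le 1 (\<eta> * \<eta> ^ k) (f - fps_const (z k))"
    by blast
  then have lim: "pabs (f $ 0 - z k) \<le> \<eta> * \<eta> ^ k" for k
    using gauss_leD[of 1 "\<eta> * \<eta> ^ k" "f - fps_const (z k)" 0] by simp
  show ?thesis
  proof (rule that[of "f $ 0"])
    show *: "pabs (f $ 0) < 1"
      using pabs_add_less[of "f $ 0 - z 0" 1 "z 0"] lim[of 0] \<eta> z(1) by simp
    show "(\<lambda>k. poly (P k) (f $ 0)) \<longlonglongrightarrow> 0"
    proof (rule tendsto_0_geometric)
      fix k
      have "\<eta> * \<eta> ^ k \<le> 1"
        using \<eta> by (simp add: mult_le_one power_le_one)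
      then have "pabs (poly (P k) (z k + (f $ 0 - z k)) - poly (P k) (z k)) \<le> 1 * pabs (f $ 0 - z k)"
        using z(1)[of k] order_trans[OF lim[of k]] by (intro poly_taylor_le(1) integral) auto
      then show "pabs (poly (P k) (f $ 0)) \<le> \<eta> * \<eta> ^ k"
        using lim[of k] z(2)[of k] by simp
    qed (use \<eta> in auto)
  qed
qed

section \<open>The zeros of \<open>g\<close> in the first variable\<close>

text \<open>
  Multiplying \<open>g\<close> by \<open>p! / t ^ (p - 2)\<close> makes the coefficient of \<open>A (p - 2)\<close> equal to \<open>1\<close> and,
  on the critical circle, all other coefficients integral.
\<close>

definition scale :: "'a \<Rightarrow> 'a" where
  "scale t = fact p / t ^ (p - 2)"

definition scaled_g :: "'a \<Rightarrow> 'a \<Rightarrow> 'a" where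
  "scaled_g t y = scale t * g y (1 + t)"

definition scaled_coeff :: "'a \<Rightarrow> nat \<Rightarrow> 'a" where
  "scaled_coeff t n = scale t * (t ^ n / fact (n + 2))"

definition x_poly :: "'a \<Rightarrow> nat \<Rightarrow> 'a poly" where
  "x_poly t N = (\<Sum>n<N. smult (scaled_coeff t n) (A n))"

lemma pabs_scale:
  assumes "critical x t"
  shows "pabs (scale t) = Q_radius p x"
proof -
  note c = criticalD[OF assms]
  have "real p * pabs t ^ (p - 2) \<noteq> 0"
    using c p_gt_1 by simp
  moreover have "Q_radius p x * (real p * pabs t ^ (p - 2)) = 1"
    using c(4) by (simp add: mult_ac)
  ultimately have "Q_radius p x = 1 / (real p * pabs t ^ (p - 2))"
    by (simp only: eq_divide_eq) simp
  then show ?thesis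
    by (simp add: scale_def pabs_fact_p)
qed

lemma scaled_coeff_bounds:
  assumes "critical x t"
  shows "pabs (scaled_coeff t (p - 2 + j)) \<le> (pabs t / \<rho>) ^ j"
    and "pabs (scaled_coeff t n) \<le> 1"
    and "scaled_coeff t (p - 2) = 1"
    and "n \<noteq> 0 \<Longrightarrow> n \<noteq> p - 2 \<Longrightarrow> pabs (scaled_coeff t n) \<le> pabs t / \<rho>"
proof -
  note c = criticalD[OF assms]
  have eq: "pabs (scaled_coeff t n) = pabs (1 / fact (n + 2) :: 'a) * Q_radius p x * pabs t ^ n" for n
    using pabs_scale[OF assms] by (simp add: scaled_coeff_def pabs_mult del: fact_Suc add_2_eq_Suc')
  show tail: "pabs (scaled_coeff t (p - 2 + j)) \<le> (pabs t / \<rho>) ^ j" for j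
    unfolding eq by (rule pabs_coeff_bounds(1)[OF assms])
  show "pabs (scaled_coeff t n) \<le> 1"
    unfolding eq by (rule pabs_coeff_bounds(2)[OF assms])
  have "p - 2 + 2 = p"
    using c(1) by simp
  then show "scaled_coeff t (p - 2) = 1"
    using c(5) by (simp add: scaled_coeff_def scale_def del: fact_Suc add_2_eq_Suc')
  show "pabs (scaled_coeff t n) \<le> pabs t / \<rho>" if n: "n \<noteq> 0" "n \<noteq> p - 2"
  proof (cases "n < p - 2")
    case True
    have "pabs t ^ n \<le> pabs t ^ 1"
      using n c by (intro power_decreasing) auto
    then have "1 * Q_radius p x * pabs t ^ n \<le> 1 * 1 * pabs t"
      using Q_radius_le_1[OF c(2)] c by (intro mult_mono) auto
    then show ?thesis
      unfolding eq pabs_coeff_bounds(3)[OF assms True] using c(9) by linarith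
  next
    case False
    then have "p - 2 < n"
      using n by simp
    then obtain j where j: "n = p - 2 + Suc j"
      using less_imp_Suc_add by fastforce
    have "(pabs t / \<rho>) ^ Suc j \<le> (pabs t / \<rho>) ^ 1"
      using c rho_pos by (intro power_decreasing) auto
    then show ?thesis
      using tail[of "Suc j"] unfolding j by simp
  qed
qed

lemma coeff_le_A: "coeff_le 1 (A n)"
  unfolding A_def by (intro coeff_le_prod_1 coeff_le_linear) (simp add: pabs_of_nat_le_1)

lemma x_poly_integral:
  assumes "critical x t"
  shows "coeff_le 1 (x_poly t N)"
  unfolding x_poly_def using scaled_coeff_bounds(2)[OF assms] coeff_le_smult[OF coeff_le_A]
  by (intro coeff_le_sum) fastforce+

text \<open>The partial sums from length \<open>p - 1\<close> on contain the term of index \<open>p - 2\<close>.\<close>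

lemma x_poly_step:
  assumes "critical x t"
  shows "coeff_le ((pabs t / \<rho>) ^ Suc k) (x_poly t (Suc (p - 1 + k)) - x_poly t (p - 1 + k))"
proof -
  have idx: "p - 1 + k = p - 2 + Suc k"
    using criticalD(1)[OF assms] by simp
  have "coeff_le ((pabs t / \<rho>) ^ Suc k * 1) (smult (scaled_coeff t (p - 2 + Suc k)) (A (p - 2 + Suc k)))"
    by (intro coeff_le_smult coeff_le_A scaled_coeff_bounds(1)[OF assms])
  then show ?thesis
    unfolding x_poly_def idx by simp
qed

text \<open>Modulo the maximal ideal, only the terms of index \<open>0\<close> and \<open>p - 2\<close> remain.\<close>

lemma x_poly_reduction:
  assumes "critical x t"
  shows "coeff_le (pabs t / \<rho>) (x_poly t (p - 1 + k) - A (p - 2) - [:scaled_coeff t 0:])"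
proof -
  note c = criticalD[OF assms]
  let ?N = "p - 1 + k"
  define E where "E n = smult (scaled_coeff t n) (A n) - (if n = p - 2 then A (p - 2) else 0) -
      (if n = 0 then [:scaled_coeff t 0:] else 0)" for n
  have "coeff_le (pabs t / \<rho>) (E n)" for n
  proof -
    consider "n = 0" | "n = p - 2" | "n \<noteq> 0" "n \<noteq> p - 2"
      by blast
    then show ?thesis
    proof cases
      case 1
      then show ?thesis
        using c rho_pos by (simp add: E_def A_def)
    next
      case 2
      then show ?thesis
        using c rho_pos scaled_coeff_bounds(3)[OF assms] by (simp add: E_def)
    next
      case 3
      then show ?thesis
        using coeff_le_smult[OF coeff_le_A scaled_coeff_bounds(4)[OF assms 3], of n] by (simp add: E_def)
    qed
  qed
  then have "coeff_le (pabs t / \<rho>) (\<Sum>n<?N. E n)"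
    using rho_pos by (intro coeff_le_sum) auto
  moreover have "(\<Sum>n<?N. E n) = x_poly t ?N - A (p - 2) - [:scaled_coeff t 0:]"
  proof -
    have "(\<Sum>n<?N. if n = p - 2 then A (p - 2) else 0) = (A (p - 2) :: 'a poly)"
      "(\<Sum>n<?N. if n = 0 then [:scaled_coeff t 0:] else 0) = [:scaled_coeff t 0:]"
      using c(1) by (simp_all add: sum.delta)
    then show ?thesis
      by (simp only: E_def x_poly_def sum_subtractf)
  qed
  ultimately show ?thesis
    by simp
qed

lemma pderiv_x_poly_reduction:
  assumes "critical x t"
  shows "coeff_le (pabs t / \<rho>) (pderiv (x_poly t (p - 1 + k)) - pderiv (A (p - 2)))"
  using coeff_le_pderiv[OF x_poly_reduction[OF assms, of k]]
  by (simp add: pderiv_diff pderiv_pCons)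

lemma x_poly_tendsto:
  assumes "critical x t" "pabs y \<le> 1"
  shows "(\<lambda>k. poly (x_poly t (p - 1 + k)) y) \<longlonglongrightarrow> scaled_g t y"
proof -
  have "poly (x_poly t N) y = scale t * g_part N y t" for N
    unfolding x_poly_def g_part_def g_term_def scaled_coeff_def
    by (simp add: poly_sum sum_distrib_left mult_ac del: fact_Suc add_2_eq_Suc')
  moreover have "(\<lambda>k. g_part (k + (p - 1)) y t) \<longlonglongrightarrow> g y (1 + t)"
    by (rule LIMSEQ_ignore_initial_segment[OF g_part_tendsto[OF assms(2) criticalD(3)[OF assms(1)]]])
  ultimately show ?thesis
    unfolding scaled_g_def by (simp add: padic_tendsto_cmult add.commute)
qed

lemma scaled_g_eq_0_iff:
  assumes "critical x t"
  shows "scaled_g t y = 0 \<longleftrightarrow> g y (1 + t) = 0"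
  using criticalD(5)[OF assms] by (simp add: scaled_g_def scale_def)

text \<open>Hence the derivative of \<open>g\<close> in the first variable is, up to scaling, close to that of \<open>A (p - 2)\<close>.\<close>

lemma scaled_g_increment:
  assumes "critical x t" "pabs y \<le> 1" "pabs h \<le> 1"
  shows "pabs (scaled_g t (y + h) - scaled_g t y - poly (pderiv (A (p - 2))) y * h)
    \<le> max (pabs t / \<rho>) (pabs h) * pabs h"
proof (rule pabs_limit_le)
  let ?P = "\<lambda>k. x_poly t (p - 1 + k)"
  have yh: "pabs (y + h) \<le> 1"
    using assms by (intro pabs_add_le)
  show "(\<lambda>k. poly (?P k) (y + h) - poly (?P k) y - poly (pderiv (A (p - 2))) y * h)
      \<longlonglongrightarrow> scaled_g t (y + h) - scaled_g t y - poly (pderiv (A (p - 2))) y * h"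
    by (intro padic_tendsto_diff x_poly_tendsto[OF assms(1)] yh assms(2) tendsto_const)
  fix k :: nat
  have taylor: "pabs (poly (?P k) (y + h) - poly (?P k) y - poly (pderiv (?P k)) y * h) \<le> 1 * (pabs h)\<^sup>2"
    by (rule poly_taylor_le(2)[OF x_poly_integral[OF assms(1)] assms(2,3)])
  have "pabs (poly (pderiv (?P k) - pderiv (A (p - 2))) y) \<le> pabs t / \<rho>"
    by (rule pabs_poly_le[OF pderiv_x_poly_reduction[OF assms(1)] assms(2)])
  then have deriv: "pabs (poly (pderiv (?P k) - pderiv (A (p - 2))) y * h) \<le> pabs t / \<rho> * pabs h"
    unfolding pabs_mult by (rule mult_right_mono) simp
  have max: "1 * (pabs h)\<^sup>2 \<le> max (pabs t / \<rho>) (pabs h) * pabs h"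
    "pabs t / \<rho> * pabs h \<le> max (pabs t / \<rho>) (pabs h) * pabs h"
    unfolding power2_eq_square mult_1_left by (intro mult_right_mono; simp)+
  have "pabs ((poly (?P k) (y + h) - poly (?P k) y - poly (pderiv (?P k)) y * h) +
      poly (pderiv (?P k) - pderiv (A (p - 2))) y * h) \<le> max (pabs t / \<rho>) (pabs h) * pabs h"
    by (rule pabs_add_le[OF order_trans[OF taylor max(1)] order_trans[OF deriv max(2)]])
  then show "pabs (poly (?P k) (y + h) - poly (?P k) y - poly (pderiv (A (p - 2))) y * h)
      \<le> max (pabs t / \<rho>) (pabs h) * pabs h"
    by (simp add: algebra_simps)
qed

lemma pabs_deriv_A_le_1: "pabs y \<le> 1 \<Longrightarrow> pabs (poly (pderiv (A n)) y) \<le> 1" for y :: 'a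
  by (intro pabs_poly_le coeff_le_pderiv coeff_le_A)

lemma scaled_g_isometric:
  assumes "critical x t" "pabs y \<le> 1" "pabs h < 1" "pabs (poly (pderiv (A (p - 2))) y) = 1"
  shows "pabs (scaled_g t (y + h) - scaled_g t y) = pabs h"
proof (cases "h = 0")
  case False
  have "max (pabs t / \<rho>) (pabs h) * pabs h < 1 * pabs h"
    using criticalD(8)[OF assms(1)] assms(3) False by (intro mult_strict_right_mono) auto
  then have "pabs (scaled_g t (y + h) - scaled_g t y - poly (pderiv (A (p - 2))) y * h)
      < pabs (poly (pderiv (A (p - 2))) y * h)"
    using scaled_g_increment[OF assms(1,2), of h] assms(3,4) by (simp add: pabs_mult)
  then have "pabs (scaled_g t (y + h) - scaled_g t y) = pabs (poly (pderiv (A (p - 2))) y * h)"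
    by (rule pabs_eq_if_close)
  then show ?thesis
    using assms(4) by (simp add: pabs_mult)
qed simp

text \<open>
  If \<open>A (p - 2)\<close> is not a unit at \<open>x\<close>, then \<open>x\<close> is congruent to one of its roots, and these are
  simple modulo the maximal ideal.
\<close>

lemma deriv_A_unit_if_radius_less_1:
  fixes x :: 'a
  assumes "pabs x \<le> 1" "Q_radius p x < 1"
  shows "pabs (poly (pderiv (A (p - 2))) x) = 1"
proof -
  let ?I = "{2..p - 2 + 1}"
  have "\<exists>k\<in>?I. pabs (x - of_nat k) < 1"
  proof (rule ccontr)
    assume "\<not> ?thesis"
    then have "1 \<le> (\<Prod>k\<in>?I. pabs (x - of_nat k))"
      by (intro prod_ge_1) (auto simp: not_less)
    then show False
      using assms(2) unfolding Q_radius_def poly_A pabs_prod by linarith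
  qed
  then obtain k where k: "k \<in> ?I" "pabs (x - of_nat k) < 1"
    by blast
  define R where "R = (\<Prod>j\<in>?I - {k}. [:- of_nat j, 1 :: 'a:])"
  have "coeff_le 1 R"
    unfolding R_def by (intro coeff_le_prod_1 coeff_le_linear) (simp add: pabs_of_nat_le_1)
  have "A (p - 2) = [:- of_nat k, 1:] * R"
    unfolding A_def R_def by (rule prod.remove[OF _ k(1)]) simp
  then have deriv: "poly (pderiv (A (p - 2))) x = (x - of_nat k) * poly (pderiv R) x + poly R x"
    by (simp only: pderiv_mult poly_add poly_mult) (simp add: pderiv_pCons)
  have "pabs (x - of_nat j) = 1" if "j \<in> ?I - {k}" for j
  proof -
    have "pabs (of_nat k - of_nat j :: 'a) = 1"
    proof (cases "j < k")
      case True
      then show ?thesis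
        using pabs_of_nat_less_p[of "k - j"] k(1) that by (auto simp: of_nat_diff)
    next
      case False
      then show ?thesis
        using pabs_of_nat_less_p[of "j - k"] k(1) that pabs_minus_commute[of "of_nat k" "of_nat j"]
        by (auto simp: of_nat_diff)
    qed
    note kj = this
    have "pabs ((x - of_nat j) - (of_nat k - of_nat j)) < pabs (of_nat k - of_nat j :: 'a)"
      unfolding kj using k(2) by simp
    from pabs_eq_if_close[OF this] show ?thesis
      unfolding kj .
  qed
  then have R1: "pabs (poly R x) = 1"
    by (simp add: R_def poly_prod pabs_prod)
  have "pabs (poly (pderiv R) x) \<le> 1"
    by (rule pabs_poly_le[OF coeff_le_pderiv[OF \<open>coeff_le 1 R\<close>] assms(1)])
  then have "pabs (x - of_nat k) * pabs (poly (pderiv R) x) < 1"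
    using k(2) mult_left_le[of "pabs (poly (pderiv R) x)" "pabs (x - of_nat k)"] by simp
  then have "pabs (poly (pderiv (A (p - 2))) x - poly R x) < pabs (poly R x)"
    by (simp add: deriv R1 pabs_mult)
  from pabs_eq_if_close[OF this] show ?thesis
    unfolding R1 .
qed

lemma degree_A: "degree (A n :: 'a poly) = n" "lead_coeff (A n :: 'a poly) = 1"
proof -
  have "degree (\<Prod>k\<in>S. [:- of_nat k, 1 :: 'a:]) = card S \<and> lead_coeff (\<Prod>k\<in>S. [:- of_nat k, 1 :: 'a:]) = 1"
    if "finite S" for S
    using that
  proof (induction S rule: finite_induct)
    case (insert k S)
    have "(\<Prod>k\<in>S. [:- of_nat k, 1 :: 'a:]) \<noteq> 0"
      unfolding prod_zero_iff[OF insert.hyps(1)] by simp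
    then have "degree (\<Prod>k\<in>insert k S. [:- of_nat k, 1 :: 'a:]) = card (insert k S)"
      using insert by (simp add: degree_mult_eq del: mult_pCons_left)
    moreover have "lead_coeff (\<Prod>k\<in>insert k S. [:- of_nat k, 1 :: 'a:]) = 1"
      by (simp only: prod.insert[OF insert.hyps] lead_coeff_mult insert.IH[THEN conjunct2]) simp
    ultimately show ?case
      by blast
  qed simp
  note * = this[OF finite_atLeastAtMost, of 2 "n + 1"]
  show "degree (A n :: 'a poly) = n"
    using *[THEN conjunct1] by (simp add: A_def del: prod.cl_ivl_Suc)
  show "lead_coeff (A n :: 'a poly) = 1"
    using *[THEN conjunct2] unfolding A_def .
qed

lemma coeff_x_poly_shift:
  assumes "critical x t" "pabs y \<le> 1"
  shows "pabs (coeff (x_poly t (p - 1 + k) \<circ>\<^sub>p [:y, 1:]) (p - 2)) = 1"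
proof -
  note c = criticalD[OF assms(1)]
  let ?P = "x_poly t (p - 1 + k)"
  have "coeff (A (p - 2) \<circ>\<^sub>p [:y, 1:]) (p - 2) = 1"
    using lead_coeff_comp[of "[:y, 1:]" "A (p - 2)"] degree_A[of "p - 2"] by (simp add: degree_pcompose)
  moreover have "coeff ([:scaled_coeff t 0:] \<circ>\<^sub>p [:y, 1:]) (p - 2) = 0"
    using c(1) by (cases "p - 2") (auto simp: pcompose_pCons)
  moreover have "pabs (coeff ((?P - A (p - 2) - [:scaled_coeff t 0:]) \<circ>\<^sub>p [:y, 1:]) (p - 2)) \<le> pabs t / \<rho>"
    by (rule coeff_leD[OF coeff_le_shift[OF x_poly_reduction[OF assms(1)] assms(2)]])
  ultimately have "pabs (coeff (?P \<circ>\<^sub>p [:y, 1:]) (p - 2) - 1) < pabs (1::'a)"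
    using c(8) by (simp only: pcompose_diff coeff_diff pabs_1) simp
  from pabs_eq_if_close[OF this] show ?thesis
    by simp
qed

lemma x_poly_step_shift:
  assumes "critical x t" "pabs y \<le> 1"
  shows "coeff_le ((pabs t / \<rho>) ^ Suc k)
    (x_poly t (p - 1 + Suc k) \<circ>\<^sub>p [:y, 1:] - x_poly t (p - 1 + k) \<circ>\<^sub>p [:y, 1:])"
  using coeff_le_shift[OF x_poly_step[OF assms(1)] assms(2), of k] by (simp add: pcompose_diff)

subsection \<open>Solving for the first variable\<close>

text \<open>
  The root theorem gives a zero in the residue class of \<open>x\<close>. It lies in the ball of radius
  \<open>Q_radius p x\<close> because either this is the whole class, or \<open>g\<close> is isometric up to scaling.
\<close>

lemma solution_in_first_variable:
  assumes crit: "critical x t" and zero: "g x (1 + t) = 0" and close: "pabs (s - t) < pabs t"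
  obtains y where "pabs (y - x) < Q_radius p x" "g y (1 + s) = 0"
proof -
  have s: "pabs s = pabs t"
    by (rule pabs_eq_if_close[OF close])
  have crit_s: "critical x s"
    using crit s by (simp add: critical_def)
  note c = criticalD[OF crit_s]
  define \<theta> where "\<theta> = pabs s / \<rho>"
  have \<theta>: "0 \<le> \<theta>" "\<theta> < 1"
    using c rho_pos by (auto simp: \<theta>_def)
  define P where "P k = x_poly s (p - 1 + k) \<circ>\<^sub>p [:x, 1:]" for k
  have Fx: "pabs (scaled_g s x) < Q_radius p x"
  proof -
    have "pabs (g x (1 + s)) = pabs (s - t) / pabs t"
      using pabs_g_diff[OF crit close] zero by simp
    also have "\<dots> < 1"
      using close by (simp add: divide_less_eq)
    finally show ?thesis
      using c(6) by (simp add: scaled_g_def pabs_mult pabs_scale[OF crit_s])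
  qed
  have const: "pabs (coeff (P 0) 0) < 1"
  proof -
    have "pabs (poly (x_poly s (p - 1)) x - scaled_g s x) \<le> \<theta>"
    proof (rule pabs_limit_le)
      show "(\<lambda>k. poly (x_poly s (p - 1)) x - poly (x_poly s (p - 1 + k)) x)
          \<longlonglongrightarrow> poly (x_poly s (p - 1)) x - scaled_g s x"
        by (intro padic_tendsto_diff tendsto_const x_poly_tendsto[OF crit_s c(2)])
      fix k :: nat
      have "coeff_le \<theta> (x_poly s (p - 1) - x_poly s (p - 1 + k))"
      proof -
        have "(u - a - c) - (w - a - c) = u - w" for u w a c :: "'a poly"
          by simp
        then show ?thesis
          using coeff_le_diff[OF x_poly_reduction[OF crit_s, of 0] x_poly_reduction[OF crit_s, of k]]
          by (simp only: \<theta>_def add_0_right)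
      qed
      from pabs_poly_le[OF this c(2)]
      show "pabs (poly (x_poly s (p - 1)) x - poly (x_poly s (p - 1 + k)) x) \<le> \<theta>"
        by simp
    qed
    then have "pabs ((poly (x_poly s (p - 1)) x - scaled_g s x) + scaled_g s x) < 1"
      using Fx Q_radius_le_1[OF c(2)] \<theta>(2) by (intro pabs_add_less) linarith+
    then show ?thesis
      by (simp add: P_def coeff_0_shift)
  qed
  obtain z where z: "pabs z < 1" "(\<lambda>k. poly (P k) z) \<longlonglongrightarrow> 0"
  proof (rule zero_of_polynomial_limit[of P \<theta> "p - 2"])
    show "coeff_le 1 (P k)" for k
      unfolding P_def by (intro coeff_le_shift x_poly_integral[OF crit_s] c(2))
    show "coeff_le (\<theta> ^ Suc k) (P (Suc k) - P k)" for k
      unfolding P_def \<theta>_def by (rule x_poly_step_shift[OF crit_s c(2)])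
    show "pabs (coeff (P k) (p - 2)) = 1" for k
      unfolding P_def by (rule coeff_x_poly_shift[OF crit_s c(2)])
  qed (use \<theta> const c(1) in auto)
  have "pabs (x + z) \<le> 1"
    using c(2) z(1) by (intro pabs_add_le) auto
  then have "(\<lambda>k. poly (P k) z) \<longlonglongrightarrow> scaled_g s (x + z)"
    using x_poly_tendsto[OF crit_s] by (simp add: P_def poly_pcompose)
  then have F0: "scaled_g s (x + z) = 0"
    using z(2) LIMSEQ_unique by blast
  have "pabs z < Q_radius p x"
  proof (cases "Q_radius p x < 1")
    case True
    have "pabs z = pabs (scaled_g s (x + z) - scaled_g s x)"
      using scaled_g_isometric[OF crit_s c(2) z(1) deriv_A_unit_if_radius_less_1[OF c(2) True]] by simp
    also have "\<dots> = pabs (scaled_g s x)"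
      by (simp add: F0)
    finally show ?thesis
      using Fx by simp
  qed (use z(1) in linarith)
  then show ?thesis
    using that[of "x + z"] F0 scaled_g_eq_0_iff[OF crit_s] by simp
qed

lemma Q_map_image:
  assumes "critical x t" "g x (1 + t) = 0"
  shows "Q_map p (1 + t) ` ball x (Q_radius p x) = ball (1 + t) (pabs t)"
proof
  show "Q_map p (1 + t) ` ball x (Q_radius p x) \<subseteq> ball (1 + t) (pabs t)"
  proof
    fix q' assume "q' \<in> Q_map p (1 + t) ` ball x (Q_radius p x)"
    then obtain y where y: "q' = Q_map p (1 + t) y" "pabs (y - x) < Q_radius p x"
      unfolding mem_ball_pabs by (auto simp: dist_eq_pabs pabs_minus_commute)
    obtain s where "Q_map p (1 + t) y = 1 + s" "pabs (s - t) < pabs t"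
      using Q_map_solution[OF assms y(2)] by metis
    then show "q' \<in> ball (1 + t) (pabs t)"
      unfolding mem_ball_pabs y(1) by simp
  qed
  show "ball (1 + t) (pabs t) \<subseteq> Q_map p (1 + t) ` ball x (Q_radius p x)"
  proof
    fix q' assume "q' \<in> ball (1 + t) (pabs t)"
    then have close: "pabs ((q' - 1) - t) < pabs t"
      unfolding mem_ball_pabs by (simp add: algebra_simps)
    obtain y where y: "pabs (y - x) < Q_radius p x" "g y (1 + (q' - 1)) = 0"
      using solution_in_first_variable[OF assms close] .
    have "Q_map p (1 + t) y = q'"
      using Q_map_eqI[OF assms y(1) close y(2)] by simp
    moreover have "y \<in> ball x (Q_radius p x)"
      using y(1) unfolding mem_ball_pabs .
    ultimately show "q' \<in> Q_map p (1 + t) ` ball x (Q_radius p x)"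
      by blast
  qed
qed

subsection \<open>Distances between values of \<open>Q\<close>\<close>

text \<open>
  If \<open>s\<close> solves the equation at \<open>y\<close>, then the value of \<open>g\<close> for the same \<open>s\<close> at \<open>y'\<close> measures how far
  \<open>s\<close> is from the solution at \<open>y'\<close>. Distances between values of \<open>Q\<close> thereby become increments of
  \<open>g\<close> in the first variable.
\<close>

lemma pabs_Q_map_diff:
  assumes crit: "critical x t" and zero: "g x (1 + t) = 0"
    and y: "pabs (y - x) < Q_radius p x" and y': "pabs (y' - x) < Q_radius p x"
  obtains s where "critical x s" "scaled_g s y = 0"
    "pabs (Q_map p (1 + t) y - Q_map p (1 + t) y')
      = pabs t / Q_radius p x * pabs (scaled_g s y' - scaled_g s y)"
proof -
  obtain s where s: "Q_map p (1 + t) y = 1 + s" "pabs (s - t) < pabs t" "critical y s" "g y (1 + s) = 0"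
    using Q_map_solution[OF crit zero y] .
  obtain s' where s': "Q_map p (1 + t) y' = 1 + s'" "pabs (s' - t) < pabs t" "critical y' s'" "g y' (1 + s') = 0"
    using Q_map_solution[OF crit zero y'] .
  have abs: "pabs s = pabs t" "pabs s' = pabs t"
    by (rule pabs_eq_if_close[OF s(2)], rule pabs_eq_if_close[OF s'(2)])
  have crit_s: "critical x s"
    using crit abs(1) by (simp add: critical_def)
  have y_s: "scaled_g s y = 0"
    using s(4) by (simp add: scaled_g_def)
  have "pabs (s - s') < pabs s'"
    using pabs_diff_less[OF s(2) s'(2)] abs by simp
  from pabs_g_diff[OF s'(3) this] have "pabs (g y' (1 + s)) = pabs (s - s') / pabs t"
    using s'(4) abs by simp
  then have "pabs (scaled_g s y' - scaled_g s y) = Q_radius p x * (pabs (s - s') / pabs t)"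
    unfolding y_s by (simp add: scaled_g_def pabs_mult pabs_scale[OF crit_s])
  then have "pabs (s - s') = pabs t / Q_radius p x * pabs (scaled_g s y' - scaled_g s y)"
    using criticalD(5,6)[OF crit] by simp
  then show ?thesis
    using that[OF crit_s y_s] s(1) s'(1) by simp
qed

lemma contraction_factor:
  assumes "critical x t"
  shows "real p powr (1 - (real p - 1) * pval p t) = pabs t / Q_radius p x"
proof -
  note c = criticalD[OF assms]
  have "real p powr (1 - (real p - 1) * pval p t) = real p * (real p powr (- pval p t)) powr (real p - 1)"
    using p_gt_1 by (simp add: powr_powr powr_add[symmetric] powr_mult_base algebra_simps)
  also have "(real p powr (- pval p t)) powr (real p - 1) = pabs t ^ (p - 1)"
    unfolding powr_minus_pval[OF c(5)] using c(7) p_gt_1 by (simp add: of_nat_diff flip: powr_realpow)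
  also have "pabs t ^ (p - 1) = pabs t ^ (p - 2) * pabs t"
  proof -
    have "p - 1 = Suc (p - 2)"
      using c(1) by simp
    then show ?thesis
      by (simp only: power_Suc2)
  qed
  also have "real p * (pabs t ^ (p - 2) * pabs t) = (real p * pabs t ^ (p - 2)) * pabs t"
    by simp
  also have "real p * pabs t ^ (p - 2) = 1 / Q_radius p x"
    using c(4,6) by (simp add: eq_divide_eq mult_ac)
  finally show ?thesis
    by simp
qed

text \<open>
  These increments have the absolute value of the displacement if the derivative of \<open>A (p - 2)\<close> is a
  unit, and a smaller one otherwise.
\<close>

lemma bijective_contraction_iff:
  assumes crit: "critical x t" and zero: "g x (1 + t) = 0"
  shows "Q_bijective_contraction p x (1 + t) \<longleftrightarrow> A_deriv_unit p x"
proof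
  note c = criticalD[OF crit]
  have factor: "0 < pabs t / Q_radius p x"
    using c by simp
  {
    assume contraction: "Q_bijective_contraction p x (1 + t)"
    show "A_deriv_unit p x"
    proof (rule ccontr)
      assume "\<not> A_deriv_unit p x"
      then have small: "pabs (poly (pderiv (A (p - 2))) x) < 1"
        using pabs_deriv_A_le_1[OF c(2), of "p - 2"] by (simp add: A_deriv_unit_def)
      obtain h :: 'a where h: "h \<noteq> 0" "pabs h < Q_radius p x"
        using small_nonzero_element[OF c(6)] .
      then have h1: "pabs h < 1"
        using Q_radius_le_1[OF c(2)] by linarith
      obtain s where s: "critical x s" "scaled_g s x = 0"
        "pabs (Q_map p (1 + t) x - Q_map p (1 + t) (x + h))
          = pabs t / Q_radius p x * pabs (scaled_g s (x + h) - scaled_g s x)"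
        using pabs_Q_map_diff[OF crit zero, of x "x + h"] c(6) h(2) by auto
      have "x \<in> ball x (Q_radius p x)" "x + h \<in> ball x (Q_radius p x)"
        unfolding mem_ball_pabs using c(6) h(2) by simp_all
      then have "pabs (Q_map p (1 + t) x - Q_map p (1 + t) (x + h)) = pabs t / Q_radius p x * pabs (x - (x + h))"
        using contraction contraction_factor[OF crit] unfolding Q_bijective_contraction_def by simp
      then have eq: "pabs (scaled_g s (x + h) - scaled_g s x) = pabs h"
        using s(3) factor c(5,6) by simp
      have "pabs (scaled_g s (x + h) - scaled_g s x - poly (pderiv (A (p - 2))) x * h) < pabs h"
      proof -
        have "max (pabs s / \<rho>) (pabs h) * pabs h < 1 * pabs h"
          using criticalD(8)[OF s(1)] h1 h(1) by (intro mult_strict_right_mono) auto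
        then show ?thesis
          using scaled_g_increment[OF s(1) c(2), of h] h1 by simp
      qed
      moreover have "pabs (poly (pderiv (A (p - 2))) x * h) < pabs h"
        using small h(1) by (simp add: pabs_mult)
      ultimately have "pabs (scaled_g s (x + h) - scaled_g s x) < pabs h"
        using pabs_add_less by fastforce
      then show False
        using eq by simp
    qed
  next
    assume "A_deriv_unit p x"
    then have unit: "pabs (poly (pderiv (A (p - 2))) x) = 1"
      by (simp add: A_deriv_unit_def)
    have isometry: "pabs (Q_map p (1 + t) y - Q_map p (1 + t) y') = pabs t / Q_radius p x * pabs (y - y')"
      if "y \<in> ball x (Q_radius p x)" "y' \<in> ball x (Q_radius p x)" for y y'
    proof -
      have y: "pabs (y - x) < Q_radius p x" "pabs (y' - x) < Q_radius p x"
        using that unfolding mem_ball_pabs .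
      obtain s where s: "critical x s"
        "pabs (Q_map p (1 + t) y - Q_map p (1 + t) y')
          = pabs t / Q_radius p x * pabs (scaled_g s y' - scaled_g s y)"
        using pabs_Q_map_diff[OF crit zero y] by metis
      have y1: "pabs y \<le> 1"
        using Q_radius_cong(1)[OF c(2) y(1)] .
      have "pabs (y' - y) < 1"
        using pabs_diff_less[OF y(2,1)] Q_radius_le_1[OF c(2)] by simp
      have yx: "pabs (y - x) < 1"
        using y(1) Q_radius_le_1[OF c(2)] by linarith
      have "pabs (poly (pderiv (A (p - 2))) (x + (y - x)) - poly (pderiv (A (p - 2))) x) \<le> 1 * pabs (y - x)"
        using yx by (intro poly_taylor_le(1) coeff_le_pderiv coeff_le_A c(2)) simp
      then have "pabs (poly (pderiv (A (p - 2))) y - poly (pderiv (A (p - 2))) x) < pabs (poly (pderiv (A (p - 2))) x)"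
        using yx unit by simp
      from pabs_eq_if_close[OF this] have "pabs (poly (pderiv (A (p - 2))) y) = 1"
        unfolding unit .
      from scaled_g_isometric[OF s(1) y1 \<open>pabs (y' - y) < 1\<close> this] show ?thesis
        unfolding s(2) by (simp add: pabs_minus_commute)
    qed
    have "inj_on (Q_map p (1 + t)) (ball x (Q_radius p x))"
    proof (rule inj_onI)
      fix y y' assume "y \<in> ball x (Q_radius p x)" "y' \<in> ball x (Q_radius p x)" "Q_map p (1 + t) y = Q_map p (1 + t) y'"
      then have "pabs t / Q_radius p x * pabs (y - y') = 0"
        using isometry[of y y'] by simp
      then show "y = y'"
        using factor by auto
    qed
    then show "Q_bijective_contraction p x (1 + t)"
      using isometry Q_map_image[OF crit zero] contraction_factor[OF crit]
      unfolding Q_bijective_contraction_def bij_betw_def by simp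
  }
qed

section \<open>Multiplicities\<close>

lemma fps_value_of_poly: "fps_value (fps_of_poly P) y = poly P y"
proof -
  have "(\<lambda>m. fps_of_poly P $ m * y ^ m) sums (\<Sum>m\<le>degree P. fps_of_poly P $ m * y ^ m)"
    by (intro sums_finite) (auto simp: coeff_eq_0)
  then show ?thesis
    by (intro sums_imp_fps_value) (simp add: poly_altdef)
qed

text \<open>
  The Taylor expansion of \<open>g\<close> in the first variable, as the limit of those of its partial sums. Its
  reduction is the Taylor expansion of \<open>A (p - 2)\<close> up to the constant term.
\<close>

lemma g_power_series:
  assumes crit: "critical x t" and y: "pabs y \<le> 1"
  obtains c where "has_power_series_on (\<lambda>X. g X (1 + t)) y 1 c" "c (p - 2) \<noteq> 0"
    "pabs (poly (pderiv (A (p - 2))) y) = 1 \<Longrightarrow> c 1 \<noteq> 0"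
proof -
  note c = criticalD[OF crit]
  define \<theta> where "\<theta> = pabs t / \<rho>"
  have \<theta>: "0 \<le> \<theta>" "\<theta> < 1"
    using c rho_pos by (auto simp: \<theta>_def)
  define P where "P k = x_poly t (p - 1 + k) \<circ>\<^sub>p [:y, 1:]" for k
  have P1: "gauss_le 1 1 (fps_of_poly (P k))" for k
    using coeff_le_shift[OF x_poly_integral[OF crit] y] by (simp add: P_def coeff_le_iff_gauss_le)
  have "gauss_le 1 (\<theta> * \<theta> ^ k) (fps_of_poly (P (Suc k)) - fps_of_poly (P k))" for k
    using x_poly_step_shift[OF crit y, of k]
    by (simp only: P_def \<theta>_def coeff_le_iff_gauss_le fps_of_poly_diff power_Suc)
  from gauss_geometric_limit[OF zero_less_one \<theta> this]
  obtain f where f: "\<And>k. gauss_le 1 (\<theta> * \<theta> ^ k) (f - fps_of_poly (P k))"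
    by blast
  have close: "pabs (f $ m - coeff (P 0) m) \<le> \<theta>" for m
    using gauss_leD[OF f[of 0], of m] by simp
  have f1: "gauss_le 1 1 f"
    using gauss_le_add[OF zero_le_one gauss_le_mono[OF f[of 0], of 1] P1[of 0]] \<theta> by simp
  have f_value: "fps_value f h = scaled_g t (y + h)" if h: "pabs h < 1" for h
  proof -
    have "(\<lambda>k. poly (P k) h) \<longlonglongrightarrow> fps_value f h"
    proof (rule tendsto_pabs_le)
      show "pabs (poly (P k) h - fps_value f h) \<le> \<theta> * \<theta> ^ k" for k
        using fps_value_le[OF zero_less_one f[of k] h] fps_value_diff[OF zero_less_one f1 P1[of k] h]
        by (simp add: fps_value_of_poly pabs_minus_commute)
      show "(\<lambda>k. \<theta> * \<theta> ^ k) \<longlonglongrightarrow> 0"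
        using tendsto_mult_left[OF LIMSEQ_realpow_zero[OF \<theta>], of \<theta>] by simp
    qed
    moreover have "(\<lambda>k. poly (P k) h) \<longlonglongrightarrow> scaled_g t (y + h)"
      using x_poly_tendsto[OF crit, of "y + h"] y h pabs_add_le[of y 1 h]
      by (simp add: P_def poly_pcompose)
    ultimately show ?thesis
      using LIMSEQ_unique by blast
  qed
  have scale0: "scale t \<noteq> 0"
    using pabs_scale[OF crit] c(6) by (metis pabs_pos)
  show ?thesis
  proof (rule that[of "\<lambda>m. 1 / scale t * f $ m"])
    show "has_power_series_on (\<lambda>X. g X (1 + t)) y 1 (\<lambda>m. 1 / scale t * f $ m)"
      unfolding has_power_series_on_def
    proof
      fix z assume "z \<in> ball y 1"
      then have z: "pabs (z - y) < 1"
        unfolding mem_ball_pabs .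
      show "(\<lambda>m. 1 / scale t * f $ m * (z - y) ^ m) sums g z (1 + t)"
        using padic_sums_cmult[OF fps_value_sums[OF zero_less_one f1 z], of "1 / scale t"] f_value[OF z] scale0
        by (simp add: scaled_g_def mult.assoc)
    qed
    have "f $ m \<noteq> 0" if "pabs (coeff (P 0) m) = 1" for m
    proof
      assume "f $ m = 0"
      then show False
        using close[of m] that \<theta> by simp
    qed
    note unit = this
    have "pabs (coeff (P 0) (p - 2)) = 1"
      unfolding P_def by (rule coeff_x_poly_shift[OF crit y])
    from unit[OF this] show "1 / scale t * f $ (p - 2) \<noteq> 0"
      using scale0 by simp
    show "1 / scale t * f $ 1 \<noteq> 0" if deriv: "pabs (poly (pderiv (A (p - 2))) y) = 1"
    proof -
      have "pabs (poly (pderiv (x_poly t (p - 1 + 0)) - pderiv (A (p - 2))) y) \<le> \<theta>"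
        unfolding \<theta>_def by (rule pabs_poly_le[OF pderiv_x_poly_reduction[OF crit] y])
      then have "pabs (coeff (P 0) 1 - poly (pderiv (A (p - 2))) y) < pabs (poly (pderiv (A (p - 2))) y)"
        unfolding deriv P_def coeff_1_shift using \<theta> by simp
      from pabs_eq_if_close[OF this] show ?thesis
        using unit[of 1] scale0 unfolding deriv by simp
    qed
  qed
qed

lemma has_power_series_on_nth_0:
  fixes f :: "'a \<Rightarrow> 'a"
  assumes "has_power_series_on f y r c" "0 < r"
  shows "c 0 = f y"
proof -
  have "y \<in> ball y r"
    using assms(2) by simp
  then have "(\<lambda>n. c n * (y - y) ^ n) sums f y"
    using assms(1) unfolding has_power_series_on_def by blast
  then have "(\<lambda>n. c n * 0 ^ n) sums f y"
    by (simp only: diff_self)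
  moreover have "(\<lambda>n. c n * 0 ^ n) sums (\<Sum>n\<in>{0}. c n * 0 ^ n)"
    by (intro sums_finite) auto
  ultimately have "f y = (\<Sum>n\<in>{0}. c n * 0 ^ n)"
    by (rule sums_unique2)
  then show ?thesis
    by simp
qed

lemma vanishing_order_nonzero:
  assumes "critical x t" "pabs y \<le> 1" "g y (1 + t) = 0"
  shows "vanishing_order (\<lambda>X. g X (1 + t)) y \<noteq> 0"
proof
  let ?P = "\<lambda>m. \<exists>c. (\<exists>r>0. has_power_series_on (\<lambda>X. g X (1 + t)) y r c) \<and> c m \<noteq> 0"
  assume "vanishing_order (\<lambda>X. g X (1 + t)) y = 0"
  obtain c where c: "has_power_series_on (\<lambda>X. g X (1 + t)) y 1 c" "c (p - 2) \<noteq> 0"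
    using g_power_series[OF assms(1,2)] by metis
  have "?P (p - 2)"
    using c zero_less_one by blast
  then have "?P (LEAST m. ?P m)"
    by (rule LeastI)
  then have "?P 0"
    using \<open>vanishing_order (\<lambda>X. g X (1 + t)) y = 0\<close> unfolding vanishing_order_def by simp
  then show False
    using has_power_series_on_nth_0 assms(3) by metis
qed

lemma vanishing_order_eq_1:
  assumes "critical x t" "pabs y \<le> 1" "g y (1 + t) = 0" "pabs (poly (pderiv (A (p - 2))) y) = 1"
  shows "vanishing_order (\<lambda>X. g X (1 + t)) y = 1"
proof -
  obtain c where c: "has_power_series_on (\<lambda>X. g X (1 + t)) y 1 c" "c 1 \<noteq> 0"
    using g_power_series[OF assms(1,2)] assms(4) by metis
  then have "vanishing_order (\<lambda>X. g X (1 + t)) y \<le> 1"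
    unfolding vanishing_order_def using zero_less_one by (intro Least_le) blast
  then show ?thesis
    using vanishing_order_nonzero[OF assms(1-3)] by linarith
qed

lemma power_series_gauss_le:
  fixes c :: "nat \<Rightarrow> 'a"
  assumes "(\<lambda>n. c n * y ^ n) sums s"
  obtains B where "gauss_le (pabs y) B (Abs_fps c)"
proof -
  let ?S = "\<lambda>n. \<Sum>i<n. c i * y ^ i"
  have S: "?S \<longlonglongrightarrow> s"
    using assms by (simp add: sums_def)
  have "(\<lambda>n. ?S (Suc n) - ?S n) \<longlonglongrightarrow> s - s"
    by (intro padic_tendsto_diff S LIMSEQ_Suc)
  then have "(\<lambda>n. c n * y ^ n) \<longlonglongrightarrow> 0"
    by simp
  then have "(\<lambda>n. pabs (c n * y ^ n)) \<longlonglongrightarrow> 0"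
    using tendsto_pabs[of _ 0] by simp
  then have "Bseq (\<lambda>n. pabs (c n * y ^ n))"
    by (intro convergent_imp_Bseq) (auto simp: convergent_def)
  then obtain B where "\<And>n. pabs (c n * y ^ n) \<le> B"
    unfolding Bseq_def by auto
  then have "gauss_le (pabs y) B (Abs_fps c)"
    by (simp add: gauss_le_def pabs_mult)
  then show ?thesis
    using that by blast
qed

text \<open>
  The order of vanishing is a minimum over all expansions, so a nonzero linear coefficient has to be
  ruled out for each of them; the given one only ensures that the minimum is attained.
\<close>

lemma vanishing_order_neq_1:
  fixes f :: "'a \<Rightarrow> 'a"
  assumes small: "\<And>h. pabs h < 1 \<Longrightarrow> pabs (f (y + h)) \<le> C * (pabs h)\<^sup>2"
    and series: "has_power_series_on f y r c" "0 < r" "c m \<noteq> 0"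
  shows "vanishing_order f y \<noteq> 1"
proof
  let ?P = "\<lambda>m. \<exists>c. (\<exists>r>0. has_power_series_on f y r c) \<and> c m \<noteq> 0"
  assume "vanishing_order f y = 1"
  have "?P m"
    using series by blast
  then have "?P (LEAST m. ?P m)"
    by (rule LeastI)
  then have "?P 1"
    using \<open>vanishing_order f y = 1\<close> unfolding vanishing_order_def by simp
  then obtain e s where e: "0 < s" "has_power_series_on f y s e" "e 1 \<noteq> 0"
    by blast
  have e_sums: "(\<lambda>n. e n * h ^ n) sums f (y + h)" if "pabs h < s" for h
  proof -
    have "y + h \<in> ball y s"
      unfolding mem_ball_pabs using that by simp
    then show ?thesis
      using e(2) unfolding has_power_series_on_def by fastforce
  qed
  obtain h :: 'a where h: "h \<noteq> 0" "pabs h < min s 1"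
    using small_nonzero_element[of "min s 1"] e(1) by auto
  then have h': "0 < pabs h" "pabs h < s" "pabs h < 1"
    by auto
  obtain B where B: "gauss_le (pabs h) B (Abs_fps e)"
    using power_series_gauss_le[OF e_sums[OF h'(2)]] .
  have bound: "pabs (fps_value (Abs_fps e) z) \<le> C * (pabs z)\<^sup>2" if "pabs z < pabs h" for z
    using e_sums[of z] small[of z] that h' sums_imp_fps_value[of "Abs_fps e" z "f (y + z)"] by simp
  have "pabs (f y) = 0"
    using small[of 0] pabs_nonneg[of "f y"] by simp
  then have "e 0 = 0"
    using has_power_series_on_nth_0[OF e(2,1)] by simp
  then have "Abs_fps e $ 1 = 0"
    using bound by (intro fps_nth_eq_0I[OF h'(1) B, of 1 C]) (auto simp: numeral_2_eq_2)
  then show False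
    using e(3) by simp
qed

lemma mem_M_fiber: "y \<in> M_fiber p (1 + t) \<longleftrightarrow> critical y t \<and> g y (1 + t) = 0"
  by (simp add: M_fiber_def M_iff)

lemma mem_M_fiber_if_zero:
  assumes "critical x t" "pabs y \<le> 1" "g y (1 + t) = 0"
  shows "y \<in> M_fiber p (1 + t)"
  using assms criticalD(3)[OF assms(1)]
  by (auto simp: M_fiber_def M_def q_domain_def \<rho>_def dist_eq_pabs)

text \<open>
  If the derivative is a unit, \<open>g\<close> is injective up to scaling on the residue class. Otherwise the
  reduction has a multiple zero: removing the zero \<open>x\<close> once, either another one is left in its
  residue class, or \<open>x\<close> itself is a multiple zero.
\<close>

lemma multiplicity_one_iff:
  assumes crit: "critical x t" and zero: "g x (1 + t) = 0"
  shows "A_deriv_unit p x \<longleftrightarrow> residue_multiplicity p (1 + t) x = 1"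
proof
  note c = criticalD[OF crit]
  let ?S = "{y \<in> M_fiber p (1 + t). residue y = residue x}"
  have x_in: "x \<in> ?S"
    using crit zero by (simp add: mem_M_fiber)
  {
    assume "A_deriv_unit p x"
    then have unit: "pabs (poly (pderiv (A (p - 2))) x) = 1"
      by (simp add: A_deriv_unit_def)
    have "?S = {x}"
    proof (intro equalityI subsetI)
      fix y assume "y \<in> ?S"
      then have y: "g y (1 + t) = 0" "pabs (y - x) < 1"
        by (auto simp: mem_M_fiber residue_eq_iff)
      have "pabs (y - x) = pabs (scaled_g t (x + (y - x)) - scaled_g t x)"
        using scaled_g_isometric[OF crit c(2) y(2) unit] by simp
      also have "\<dots> = 0"
        using y(1) zero by (simp add: scaled_g_def)
      finally show "y \<in> {x}"
        by simp
    qed (use x_in in blast)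
    then show "residue_multiplicity p (1 + t) x = 1"
      using vanishing_order_eq_1[OF crit c(2) zero unit] by (simp add: residue_multiplicity_def)
  next
    assume one: "residue_multiplicity p (1 + t) x = 1"
    show "A_deriv_unit p x"
    proof (rule ccontr)
      assume "\<not> A_deriv_unit p x"
      then have small: "pabs (poly (pderiv (A (p - 2))) x) < 1"
        using pabs_deriv_A_le_1[OF c(2), of "p - 2"] by (simp add: A_deriv_unit_def)
      have sum1: "(\<Sum>y\<in>?S. vanishing_order (\<lambda>X. g X (1 + t)) y) = 1"
        using one by (simp add: residue_multiplicity_def)
      then have fin: "finite ?S"
        by (rule contrapos_pp) (simp add: sum.infinite)
      have order_pos: "1 \<le> vanishing_order (\<lambda>X. g X (1 + t)) y" if "y \<in> ?S" for y
        using that vanishing_order_nonzero[of y t y] criticalD(2)[of y t]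
        by (auto simp: mem_M_fiber Suc_le_eq)
      have only: "y = x" if "y \<in> ?S" for y
      proof (rule ccontr)
        assume "y \<noteq> x"
        have "(\<Sum>y\<in>{x, y}. 1) \<le> (\<Sum>y\<in>{x, y}. vanishing_order (\<lambda>X. g X (1 + t)) y)"
          using x_in that order_pos by (intro sum_mono) blast
        also have "\<dots> \<le> (\<Sum>y\<in>?S. vanishing_order (\<lambda>X. g X (1 + t)) y)"
          using x_in that fin by (intro sum_mono2) auto
        finally show False
          using \<open>y \<noteq> x\<close> sum1 by simp
      qed
      then have "?S = {x}"
        using x_in by blast
      then have order1: "vanishing_order (\<lambda>X. g X (1 + t)) x = 1"
        using sum1 by simp
      define \<theta> where "\<theta> = pabs t / \<rho>"
      have \<theta>: "0 \<le> \<theta>" "\<theta> < 1"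
        using c rho_pos by (auto simp: \<theta>_def)
      \<comment> \<open>For \<open>p = 3\<close> the polynomial \<open>A (p - 2)\<close> is linear and its derivative is always a unit.\<close>
      have p4: "0 < p - 3"
      proof (rule ccontr)
        assume "\<not> 0 < p - 3"
        then have "p - 2 = 1"
          using c(1) by simp
        then have "A (p - 2) = [:- 2, 1 :: 'a:]"
          by (simp add: A_def numeral_2_eq_2)
        then show False
          using small by (simp add: pderiv_pCons)
      qed
      define S where "S k = x_poly t (p - 1 + k) \<circ>\<^sub>p [:x, 1:]" for k
      define R where "R k = poly_shift 1 (S k)" for k
      have S_eq: "S k = pCons (poly (x_poly t (p - 1 + k)) x) (R k)" for k
        using pCons_poly_shift[of "S k"] coeff_0_shift[of "x_poly t (p - 1 + k)" x]
        by (simp add: R_def S_def)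
      have R0: "coeff (R k) 0 = poly (pderiv (x_poly t (p - 1 + k))) x" for k
        using coeff_1_shift[of "x_poly t (p - 1 + k)" x] by (simp add: R_def S_def coeff_poly_shift)
      obtain z where z: "pabs z < 1" "(\<lambda>k. poly (R k) z) \<longlonglongrightarrow> 0"
      proof (rule zero_of_polynomial_limit[of R \<theta> "p - 3"])
        show "coeff_le 1 (R k)" for k
          unfolding R_def S_def
          by (intro coeff_le_poly_shift coeff_le_shift x_poly_integral[OF crit] c(2))
        have "R (Suc k) - R k = poly_shift 1 (S (Suc k) - S k)" for k
          by (rule poly_eqI) (simp add: R_def coeff_poly_shift)
        then show "coeff_le (\<theta> ^ Suc k) (R (Suc k) - R k)" for k
          using coeff_le_poly_shift[OF x_poly_step_shift[OF crit c(2), of k]]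
          by (simp only: S_def \<theta>_def)
        have "p - 3 + 1 = p - 2"
          using p4 by simp
        then show "pabs (coeff (R k) (p - 3)) = 1" for k
          using coeff_x_poly_shift[OF crit c(2), of k] by (simp only: R_def S_def coeff_poly_shift)
        have "pabs (poly (pderiv (x_poly t (p - 1 + 0)) - pderiv (A (p - 2))) x) \<le> \<theta>"
          unfolding \<theta>_def by (rule pabs_poly_le[OF pderiv_x_poly_reduction[OF crit] c(2)])
        then have "pabs ((coeff (R 0) 0 - poly (pderiv (A (p - 2))) x) + poly (pderiv (A (p - 2))) x) < 1"
          unfolding R0 using small \<theta>(2) by (intro pabs_add_less) simp_all
        then show "pabs (coeff (R 0) 0) < 1"
          by simp
      qed (use \<theta> p4 in auto)
      have xz: "pabs (x + z) \<le> 1"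
        using c(2) z(1) by (intro pabs_add_le) auto
      have P_x: "(\<lambda>k. poly (x_poly t (p - 1 + k)) x) \<longlonglongrightarrow> 0"
        using x_poly_tendsto[OF crit c(2)] zero by (simp add: scaled_g_def)
      have "(\<lambda>k. poly (x_poly t (p - 1 + k)) x + z * poly (R k) z) \<longlonglongrightarrow> 0 + z * 0"
        by (intro padic_tendsto_add padic_tendsto_cmult P_x z(2))
      moreover have "poly (x_poly t (p - 1 + k)) x + z * poly (R k) z = poly (x_poly t (p - 1 + k)) (x + z)" for k
        using arg_cong[OF S_eq[of k], of "\<lambda>P. poly P z"] by (simp add: S_def poly_pcompose)
      ultimately have "(\<lambda>k. poly (x_poly t (p - 1 + k)) (x + z)) \<longlonglongrightarrow> 0"
        by simp
      then have "scaled_g t (x + z) = 0"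
        using x_poly_tendsto[OF crit xz] LIMSEQ_unique by blast
      then have "x + z \<in> ?S"
        using z(1) mem_M_fiber_if_zero[OF crit xz] by (simp add: scaled_g_eq_0_iff[OF crit] residue_eq_iff)
      then have "z = 0"
        using only by fastforce
      then have deriv0: "(\<lambda>k. poly (pderiv (x_poly t (p - 1 + k))) x) \<longlonglongrightarrow> 0"
        using z(2) R0 by (simp add: poly_0_coeff_0)
      have quadratic: "pabs (g (x + h) (1 + t)) \<le> 1 / Q_radius p x * (pabs h)\<^sup>2" if h: "pabs h < 1" for h
      proof -
        have xh: "pabs (x + h) \<le> 1"
          using c(2) h by (intro pabs_add_le) auto
        have "(\<lambda>k. poly (x_poly t (p - 1 + k)) (x + h) - poly (x_poly t (p - 1 + k)) x
            - h * poly (pderiv (x_poly t (p - 1 + k))) x) \<longlonglongrightarrow> scaled_g t (x + h) - 0 - h * 0"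
          by (intro padic_tendsto_diff padic_tendsto_cmult x_poly_tendsto[OF crit] xh P_x deriv0)
        moreover have "pabs (poly (x_poly t (p - 1 + k)) (x + h) - poly (x_poly t (p - 1 + k)) x
            - h * poly (pderiv (x_poly t (p - 1 + k))) x) \<le> 1 * (pabs h)\<^sup>2" for k
          using poly_taylor_le(2)[OF x_poly_integral[OF crit] c(2) less_imp_le[OF h]]
          by (simp only: mult.commute)
        ultimately have "pabs (scaled_g t (x + h) - 0 - h * 0) \<le> 1 * (pabs h)\<^sup>2"
          by (rule pabs_limit_le)
        then show ?thesis
          using c(6) by (simp add: scaled_g_def pabs_mult pabs_scale[OF crit] pos_le_divide_eq mult.commute)
      qed
      obtain e where e: "has_power_series_on (\<lambda>X. g X (1 + t)) x 1 e" "e (p - 2) \<noteq> 0"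
        using g_power_series[OF crit c(2)] by metis
      show False
        using vanishing_order_neq_1[OF quadratic e(1) zero_less_one e(2)] order1 by simp
    qed
  }
qed

text \<open>Up to a unit, \<open>A_{p-2}'\<close> is a product of factors \<open>X - r\<close>; one of them must be small.\<close>

lemma deriv_A_nonunit_residue:
  fixes y :: 'a
  assumes "2 < p" "pabs y \<le> 1" "\<not> A_deriv_unit p y"
  obtains r where "poly (pderiv (A (p - 2))) r = 0" "residue y = residue r"
proof -
  let ?D = "pderiv (A (p - 2)) :: 'a poly"
  have small: "pabs (poly ?D y) < 1"
    using pabs_deriv_A_le_1[OF assms(2), of "p - 2"] assms(3) by (simp add: A_deriv_unit_def)
  have "lead_coeff ?D = of_nat (p - 2) * lead_coeff (A (p - 2))"
  proof -
    have "Suc (p - 3) = p - 2"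
      using assms(1) by simp
    moreover have "degree ?D = p - 3"
      by (simp add: degree_pderiv degree_A)
    ultimately show ?thesis
      by (simp only: coeff_pderiv degree_A)
  qed
  then have lead: "pabs (lead_coeff ?D) = 1"
    using pabs_of_nat_less_p[of "p - 2"] assms(1) degree_A(2)[of "p - 2"] by simp
  then have "?D \<noteq> 0"
    by auto
  then obtain c B where D: "?D = smult c (\<Prod>r\<in>#B. [:- r, 1:])" and c: "c = lead_coeff ?D"
    using alg_closed_imp_factorization[of ?D] by blast
  have poly_D: "poly ?D z = c * (\<Prod>r\<in>#B. z - r)" for z
    by (simp add: D poly_prod_mset image_mset.compositionality o_def)
  have "\<exists>r\<in>#B. pabs (y - r) < 1"
  proof (rule ccontr)
    assume "\<not> ?thesis"
    then have "\<And>r. r \<in># B \<Longrightarrow> 1 \<le> pabs (y - r)"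
      by (auto simp: not_less)
    then have "1 \<le> pabs (\<Prod>r\<in>#B. y - r)"
    proof (induction B)
      case (add r B)
      then have "1 * 1 \<le> pabs (y - r) * pabs (\<Prod>r\<in>#B. y - r)"
        by (intro mult_mono) auto
      then show ?case
        by (simp add: pabs_mult)
    qed simp
    then show False
      using small lead by (simp add: poly_D pabs_mult c)
  qed
  then obtain r where r: "r \<in># B" "pabs (y - r) < 1"
    by blast
  have "poly ?D r = 0"
    using multi_member_split[OF r(1)] by (auto simp: poly_D)
  then show ?thesis
    using that r(2) by (simp add: residue_eq_iff)
qed

lemma finite_exceptional_residues:
  "finite {residue y | (y :: 'a) q. (y, q) \<in> M p \<and>
     \<not> (Q_bijective_contraction p y q \<and> A_deriv_unit p y \<and> residue_multiplicity p q y = 1)}"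
  (is "finite ?E")
proof (cases "2 < p")
  case False
  then have "?E = {}"
    using M_imp_critical criticalD(1) by blast
  then show ?thesis
    by (simp only: finite.emptyI)
next
  case True
  let ?D = "pderiv (A (p - 2)) :: 'a poly"
  have "?E \<subseteq> residue ` {r. poly ?D r = 0}"
  proof
    fix E assume "E \<in> ?E"
    then obtain y :: 'a and q where yq: "E = residue y" "(y, q) \<in> M p"
      "\<not> (Q_bijective_contraction p y q \<and> A_deriv_unit p y \<and> residue_multiplicity p q y = 1)"
      by blast
    define t where "t = q - 1"
    have q: "q = 1 + t"
      by (simp add: t_def)
    have crit: "critical y t" "g y (1 + t) = 0"
      using yq(2) by (simp_all add: q M_iff)
    have "\<not> A_deriv_unit p y"
      using yq(3) bijective_contraction_iff[OF crit] multiplicity_one_iff[OF crit] unfolding q by blast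
    then obtain r where "poly ?D r = 0" "residue y = residue r"
      using deriv_A_nonunit_residue[OF True criticalD(2)[OF crit(1)]] by blast
    then show "E \<in> residue ` {r. poly ?D r = 0}"
      using yq(1) by blast
  qed
  moreover have "?D \<noteq> 0"
    using True degree_A(1)[of "p - 2"] by (auto simp: pderiv_eq_0_iff)
  ultimately show ?thesis
    using poly_roots_finite finite_surj by blast
qed

end

theorem theorem6:
  fixes p :: nat
    and p_pow :: "real \<Rightarrow> 'a::{alg_closed_field,field_char_0,complete_space}"
    and x :: 'a
  assumes "padic_complex TYPE('a) p"
    and "\<forall>r\<in>\<rat>. pabs (p_pow r) = real p powr (- r)"
    and "\<exists>q. (x, q) \<in> M p"
  shows
    \<comment> \<open>(1)\<close>
    "(card (phi1_fiber p x) = p - 2 \<and>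
      (\<forall>y\<in>phi1_fiber p x. \<exists>!u. u \<in> O_units \<and> snd y = 1 + p_pow (pval p (snd y - 1)) * u) \<and>
      (\<forall>y\<in>phi1_fiber p x. \<forall>y'\<in>phi1_fiber p x. \<forall>u\<in>O_units. \<forall>u'\<in>O_units.
         y \<noteq> y' \<longrightarrow>
         snd y = 1 + p_pow (pval p (snd y - 1)) * u \<longrightarrow>
         snd y' = 1 + p_pow (pval p (snd y' - 1)) * u' \<longrightarrow>
         residue u \<noteq> residue u')) \<and>
     \<comment> \<open>(2)\<close>
     (\<forall>q. (x, q) \<in> M p \<longrightarrow>
        (\<forall>x'\<in>ball x (Q_radius p x). \<exists>!q'. q' \<in> ball q (pabs (q - 1)) \<and> (x', q') \<in> M p) \<and>
        analytic_on_ball (Q_map p q) x (Q_radius p x) \<and>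
        Q_map p q ` ball x (Q_radius p x) = ball q (pabs (q - 1)) \<and>
        (\<forall>x'\<in>ball x (Q_radius p x).
           pabs (Q_map p q x' - q) =
             (if x' = 0 \<or> x' = 1 then pabs ((q - 1) * g x' q)
              else pabs ((q_bracket q x' - x') / (x' * (x' - 1)))))) \<and>
     \<comment> \<open>(3)\<close>
     (\<forall>q. (x, q) \<in> M p \<longrightarrow>
        (Q_bijective_contraction p x q \<longleftrightarrow> A_deriv_unit p x) \<and>
        (A_deriv_unit p x \<longleftrightarrow> residue_multiplicity p q x = 1)) \<and>
     finite {residue y | (y :: 'a) q. (y, q) \<in> M p \<and>
       \<not> (Q_bijective_contraction p y q \<and> A_deriv_unit p y \<and> residue_multiplicity p q y = 1)}"
proof -
  interpret padic_complex "TYPE('a)" p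
    by (rule assms(1))
  have above: "snd y - 1 \<in> zeros_above x" "y = (x, 1 + (snd y - 1))" if "y \<in> phi1_fiber p x" for y
    using that unfolding phi1_fiber_eq by auto
  have nonzero: "snd y - 1 \<noteq> 0" if "y \<in> phi1_fiber p x" for y
    using above(1)[OF that] criticalD(5) unfolding zeros_above_def by blast
  have unit: "\<exists>!u. u \<in> O_units \<and> snd y = 1 + p_pow (pval p (snd y - 1)) * u" if "y \<in> phi1_fiber p x" for y
    using ex1_unit_factor[OF assms(2) nonzero[OF that]] by simp
  have distinct: "residue u \<noteq> residue u'"
    if "y \<in> phi1_fiber p x" "y' \<in> phi1_fiber p x" "y \<noteq> y'"
      "snd y = 1 + p_pow (pval p (snd y - 1)) * u" "snd y' = 1 + p_pow (pval p (snd y' - 1)) * u'"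
    for y y' u u'
  proof (rule unit_factors_distinct_residues[OF assms(2) above(1)[OF that(1)] above(1)[OF that(2)]])
    show "snd y - 1 \<noteq> snd y' - 1"
      using above(2)[OF that(1)] above(2)[OF that(2)] that(3) by metis
    show "snd y - 1 = p_pow (pval p (snd y - 1)) * u"
      using that(4) by (metis add_diff_cancel_left')
    show "snd y' - 1 = p_pow (pval p (snd y' - 1)) * u'"
      using that(5) by (metis add_diff_cancel_left')
  qed
  have card: "card (phi1_fiber p x) = p - 2"
    using assms(3) card_phi1_fiber by blast
  have distinct_all: "\<forall>y\<in>phi1_fiber p x. \<forall>y'\<in>phi1_fiber p x. \<forall>u\<in>O_units. \<forall>u'\<in>O_units.
         y \<noteq> y' \<longrightarrow>
         snd y = 1 + p_pow (pval p (snd y - 1)) * u \<longrightarrow>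
         snd y' = 1 + p_pow (pval p (snd y' - 1)) * u' \<longrightarrow>
         residue u \<noteq> residue u'"
    by (intro ballI impI) (rule distinct)
  show ?thesis
  proof (rule conjI[OF _ conjI[OF _ conjI[OF _ finite_exceptional_residues]]], goal_cases)
    case 1
    show ?case
      by (rule conjI[OF card conjI[OF ballI[OF unit] distinct_all]])
  next
    case 2
    show ?case
    proof (intro allI impI, goal_cases)
      case (1 q)
      define t where "t = q - 1"
      have q: "q = 1 + t" and q1: "pabs (q - 1) = pabs t"
        by (simp_all add: t_def)
      have crit: "critical x t" and zero: "g x (1 + t) = 0"
        using 1 by (simp_all add: q M_iff)
      have ex1: "\<exists>!q'. q' \<in> ball q (pabs (q - 1)) \<and> (x', q') \<in> M p" if "x' \<in> ball x (Q_radius p x)" for x'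
        using ex1_solution[OF crit zero that[unfolded mem_ball_pabs]] unfolding q1 by (simp only: q)
      have distance: "pabs (Q_map p q x' - q) =
             (if x' = 0 \<or> x' = 1 then pabs ((q - 1) * g x' q)
              else pabs ((q_bracket q x' - x') / (x' * (x' - 1))))"
        if x': "x' \<in> ball x (Q_radius p x)" for x'
      proof -
        have close: "pabs (x' - x) < Q_radius p x"
          using x' unfolding mem_ball_pabs .
        have "pabs (Q_map p q x' - q) = pabs ((q - 1) * g x' q)"
          using pabs_Q_map_minus[OF crit zero close] unfolding q by simp
        moreover have "(q_bracket q x' - x') / (x' * (x' - 1)) = (q - 1) * g x' q" if "x' \<noteq> 0" "x' \<noteq> 1"
          using Q_radius_cong(1)[OF criticalD(2)[OF crit] close] criticalD(3,5)[OF crit] that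
          by (intro q_bracket_minus_self) (auto simp: q)
        ultimately show ?thesis
          by simp
      qed
      show ?case
        by (rule conjI[OF ballI[OF ex1] conjI[OF Q_map_analytic[OF crit zero, folded q]
                conjI[OF Q_map_image[OF crit zero, folded q, folded q1] ballI[OF distance]]]])
    qed
  next
    case 3
    show ?case
    proof (intro allI impI, goal_cases)
      case (1 q)
      then have "critical x (q - 1)" "g x (1 + (q - 1)) = 0"
        using M_iff[of x "q - 1"] by simp_all
      then show ?case
        using bijective_contraction_iff[of x "q - 1"] multiplicity_one_iff[of x "q - 1"] by simp
    qed
  qed
qed

end
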